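(* Suppose that $\mu\in\widetilde\Omega$ and fix $t\in\mathbb R$. (1) The functions $\theta\mapsto\mathsf s_{\mathrm L}(\theta,t)$ and $\theta\mapsto\mathsf s_{\mathrm R}(\theta,t)$ are left- and right-differentiable, respectively. For any $\theta_1<\theta_2$, any $x\in\mathbb T$ and any $\square\in\{\mathrm L,\mathrm R\}$, we have $$u_{\theta_2,\square}(t,x)-u_{\theta_1,\square}(t,x)=\sum_{\substack{\theta\in I_\square\\ \mathsf s_\square(\theta,t)=x}}\frac1{\partial_\theta\mathsf s_\square(\theta\pm_\square,t)},$$ where $I_{\mathrm L}=(\theta_1,\theta_2]$, $I_{\mathrm R}=[\theta_1,\theta_2)$, $\pm_{\mathrm L}=-$ and $\pm_{\mathrm R}=+$ (so $\partial_\theta\mathsf s_{\mathrm L}(\theta-,t)$ is the left derivative and $\partial_\theta\mathsf s_{\mathrm R}(\theta+,t)$ is the right derivative in $\theta$). (2) If $\mathsf s_{\mathrm L}(\theta,t)\ne\mathsf s_{\mathrm R}(\theta,t)$, then there is an $\varepsilon=\varepsilon(\theta,t)>0$ such that $(\theta',t,\mathsf s_{\mathrm L}(\theta,t))\in\mathsf S$ for all $\theta'\in[\theta,\theta+\varepsilon)$ and $(\theta',t,\mathsf s_{\mathrm R}(\theta,t))\in\mathsf S$ for all $\theta'\in(\theta-\varepsilon,\theta]$.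
   Context: $\mathbb T=\mathbb R/\mathbb Z$; derivatives of $\mathbb T$-valued functions are real-valued (via local lifts). A set is discrete if it has no accumulation points in the ambient space. $\Omega$ is the set of purely atomic (nonnegative) measures $\mu$ on $\mathbb R\times\mathbb T$, with atoms of finite mass, such that $\mathsf N:=\operatorname{supp}\mu$ is discrete. For $\theta\in\mathbb R$, $s<t$ and $X\in H^1([s,t];\mathbb T)$ the action is $\mathcal A_{\theta,s,t}[X]=\frac12\int_s^t(X'(r)-\theta)^2\,dr-\mu(\{(r,X(r)): r\in[s,t)\})$. $\mathscr M^\theta_{s,y\mid t,x}$ is the set of $X\in H^1([s,t];\mathbb T)$ with $X(s)=y$, $X(t)=x$ that minimize $\mathcal A_{\theta,s,t}$ among all such paths. $\mathscr M^\theta_t$ is the set of $X\in H^1_{\mathrm{loc}}((-\infty,t];\mathbb T)$ with $X|_{[s,t]}\in\mathscr M^\theta_{s,X(s)\mid t,X(t)}$ for all $s<t$, and $\mathscr M^\theta_{t,x}=\{X\in\mathscr M^\theta_t: X(t)=x\}$. On $\mathscr M^\theta_{t,x}$ the order is: $X_1\preccurlyeq X_2$ if $\int_r^tX_1'(s)\,ds\ge\int_r^tX_2'(s)\,ds$ for all $r\le t$. $\widetilde\Omega_1$ is the set of $\mu\in\Omega$ for which there is $M=M(\mu)>0$ such that for all $t\in\mathbb R$ there are $s=s(t)\le t-M$ and $y\in\mathbb T$ with $\mathsf N\cap([s-M,s+M]\times\mathbb T)=\{(s,y)\}$ and $\mu(\{(s,y)\})>\frac1{4M}$, and moreover $s(t)$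 can be chosen so that $\lim_{t\to+\infty}s(t)=+\infty$. For $\mu\in\widetilde\Omega_1$, each $\mathscr M^\theta_{t,x}$ is nonempty, consists of piecewise-linear paths, and has unique minimal and maximal elements $X_{\theta,t,x,\mathrm L}$ and $X_{\theta,t,x,\mathrm R}$ under $\preccurlyeq$. Put $u_{\theta,\square}(t,x)=X_{\theta,t,x,\square}'(t-)$ (derivative from below at $t$) for $\square\in\{\mathrm L,\mathrm R\}$. The shock set is $\mathsf S=\{(\theta,t,x)\in\mathbb R\times\mathbb R\times\mathbb T: u_{\theta,\mathrm L}(t,x)>u_{\theta,\mathrm R}(t,x)\}$, and $\mathsf S_\theta=\{(t,x):(\theta,t,x)\in\mathsf S\}$. For $(\theta,t,x)\in\mathsf S$, $T_\vee(\theta,t,x)=\sup\{s<t: X_{\theta,t,x,\mathrm L}(s)=X_{\theta,t,x,\mathrm R}(s)\}$. The set of global shocks is $\mathsf{GS}=\{(\theta,t,x)\in\mathsf S:\int_{T_\vee(\theta,t,x)}^tX_{\theta,t,x,\mathrm L}'(s)\,ds>\int_{T_\vee(\theta,t,x)}^tX_{\theta,t,x,\mathrm R}'(s)\,ds\}$; $\mathsf{GS}_\theta=\{(t,x):(\theta,t,x)\in\mathsf{GS}\}$ and $\mathsf{GS}_{\theta,t}=\{x:(\theta,t,x)\in\mathsf{GS}\}$. $\widetilde\Omega$ is the set of $\mu\in\widetilde\Omega_1$ such that for every $\theta\in\mathbb R$ we have $\#(\mathsf{GS}_\theta\cap\mathsf N)\le1$ and $(\mathsf S_\theta\cap\mathsf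 N)\setminus\mathsf{GS}_\theta=\varnothing$. Left and right global shocks: let $\mathsf{GS}^{\mathrm L}$ (resp. $\mathsf{GS}^{\mathrm R}$) be the set of $(\theta,t,x)\in\mathsf{GS}$ such that there is $s\in(T_\vee(\theta,t,x),t)$ with $(s,X_{\theta,t,x,\mathrm R}(s))\in\mathsf{GS}_\theta\cap\mathsf N$ (resp. $(s,X_{\theta,t,x,\mathrm L}(s))\in\mathsf{GS}_\theta\cap\mathsf N$). For $\mu\in\widetilde\Omega$ the set $\mathsf{GS}_{\theta,t}$ always has one or two elements; if $\mathsf{GS}_{\theta,t}=\{x\}$, then $\mathsf s_{\mathrm L}(\theta,t)=\mathsf s_{\mathrm R}(\theta,t)=x$; if it has two elements, exactly one, called $\mathsf s_{\mathrm L}(\theta,t)$, satisfies $(\theta,t,\mathsf s_{\mathrm L}(\theta,t))\in\mathsf{GS}^{\mathrm L}$, and the other, called $\mathsf s_{\mathrm R}(\theta,t)$, satisfies $(\theta,t,\mathsf s_{\mathrm R}(\theta,t))\in\mathsf{GS}^{\mathrm R}$. (Equivalently, $\mathsf s_{\mathrm L},\mathsf s_{\mathrm R}:\mathbb R\times\mathbb R\to\mathbb T$ are the unique functions with $\mathsf{GS}_{\theta,t}=\{\mathsf s_{\mathrm L}(\theta,t),\mathsf s_{\mathrm R}(\theta,t)\}$, with $\{\theta:\mathsf s_{\mathrm L}(\theta,t)\neq\mathsf s_{\mathrm R}(\theta,t)\}$ discrete for each $t$, and with $\mathsf s_{\mathrm L}(\theta,t)=\lim_{\theta'\uparrow\theta}\mathsf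 s_\diamond(\theta',t)$, $\mathsf s_{\mathrm R}(\theta,t)=\lim_{\theta'\downarrow\theta}\mathsf s_\diamond(\theta',t)$ for $\diamond\in\{\mathrm L,\mathrm R\}$.) *)

theory Defs
  imports "HOL-Analysis.Analysis"
begin

section \<open>The circle as the quotient of the reals by the integers\<close>

quotient_type circle = real / "\<lambda>x y :: real. x - y \<in> \<int>" morphisms rep_circle to_circle
proof (rule equivpI)
  show "reflp (\<lambda>x y :: real. x - y \<in> \<int>)"
    by (simp add: reflp_def)
  show "symp (\<lambda>x y :: real. x - y \<in> \<int>)"
  proof (rule sympI)
    fix x y :: real
    assume "x - y \<in> \<int>"
    from Ints_minus[OF this] show "y - x \<in> \<int>" by simp
  qed
  show "transp (\<lambda>x y :: real. x - y \<in> \<int>)"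
  proof (rule transpI)
    fix x y z :: real
    assume "x - y \<in> \<int>" "y - z \<in> \<int>"
    from Ints_add[OF this] show "x - z \<in> \<int>" by simp
  qed
qed

lemma to_circle_eq_iff: "to_circle x = to_circle y \<longleftrightarrow> x - y \<in> \<int>"
  by (rule circle.abs_eq_iff)

text \<open>The quotient topology.\<close>

instantiation circle :: topological_space
begin

definition open_circle :: "circle set \<Rightarrow> bool" where
  "open_circle U \<longleftrightarrow> open (to_circle -` U)"

instance
  by standard (auto simp: open_circle_def vimage_Union)

end

text \<open>
  One-sided and two-sided derivatives of circle-valued functions, taken along a lift near \<open>x\<close>.
  Differentiability makes the lift continuous at \<open>x\<close>, so the derivative does not depend on the
  choice of lift.
\<close>

definition has_circle_derivative :: "(real \<Rightarrow> circle) \<Rightarrow> real \<Rightarrow> real \<Rightarrow> real set \<Rightarrow> bool" where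
  "has_circle_derivative f d x A \<longleftrightarrow>
     (\<exists>F. f x = to_circle (F x) \<and> (\<forall>\<^sub>F y in at x within A. f y = to_circle (F y)) \<and>
          (F has_real_derivative d) (at x within A))"

definition circle_deriv :: "(real \<Rightarrow> circle) \<Rightarrow> real \<Rightarrow> real set \<Rightarrow> real" where
  "circle_deriv f x A = (THE d. has_circle_derivative f d x A)"

lemma has_circle_derivative_unique:
  assumes "has_circle_derivative f d x A" "has_circle_derivative f e x A"
    and "at x within A \<noteq> bot"
  shows "d = e"
proof -
  obtain F where F: "f x = to_circle (F x)" "\<forall>\<^sub>F y in at x within A. f y = to_circle (F y)"
      "(F has_real_derivative d) (at x within A)"
    using assms(1) unfolding has_circle_derivative_def by blast
  obtain G where G: "f x = to_circle (G x)" "\<forall>\<^sub>F y in at x within A. f y = to_circle (G y)"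
      "(G has_real_derivative e) (at x within A)"
    using assms(2) unfolding has_circle_derivative_def by blast
  define H where "H y = (F y - G y) - (F x - G x)" for y
  have der: "(H has_real_derivative (d - e)) (at x within A)"
    unfolding H_def using F(3) G(3) by (auto intro!: derivative_eq_intros)
  have "(H \<longlongrightarrow> H x) (at x within A)"
    using DERIV_continuous[OF der] by (simp add: continuous_within)
  then have "\<forall>\<^sub>F y in at x within A. \<bar>H y\<bar> < 1"
    unfolding tendsto_iff by (auto simp: H_def dist_real_def elim!: allE[of _ 1])
  moreover have "\<forall>\<^sub>F y in at x within A. H y \<in> \<int>"
    using F(2) G(2)
  proof eventually_elim
    case (elim y)
    then have "F y - G y \<in> \<int>" "F x - G x \<in> \<int>"
      using F(1) G(1) by (simp_all add: to_circle_eq_iff[symmetric])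
    then show ?case unfolding H_def by (rule Ints_diff)
  qed
  ultimately have "\<forall>\<^sub>F y in at x within A. H y = 0"
    by eventually_elim (blast intro: Ints_nonzero_abs_less1)
  moreover have "H x = 0" by (simp add: H_def)
  ultimately have "((\<lambda>_. 0) has_real_derivative (d - e)) (at x within A)"
    using der by (subst (asm) has_field_derivative_cong_eventually) auto
  moreover have "((\<lambda>_. 0) has_real_derivative 0) (at x within A)"
    by simp
  ultimately have "d - e = 0"
    using assms(3) has_field_derivative_unique by blast
  then show ?thesis by simp
qed

section \<open>Sobolev paths\<close>

text \<open>
  \<open>g\<close> is a square-integrable weak derivative of the path \<open>X\<close> on \<open>[s,t]\<close>: some lift of \<open>X\<close> is an
  indefinite integral of \<open>g\<close>.
\<close>

definition weak_derivative :: "real \<Rightarrow> real \<Rightarrow> (real \<Rightarrow> circle) \<Rightarrow> (real \<Rightarrow> real) \<Rightarrow> bool" where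
  "weak_derivative s t X g \<longleftrightarrow>
     set_integrable lborel {s..t} g \<and> set_integrable lborel {s..t} (\<lambda>r. (g r)\<^sup>2) \<and>
     (\<exists>F. \<forall>r\<in>{s..t}. X r = to_circle (F r) \<and> F r = F s + (LINT q:{s..r}|lborel. g q))"

text \<open>The choice is immaterial, since weak derivatives are unique almost everywhere.\<close>

definition path_deriv :: "real \<Rightarrow> real \<Rightarrow> (real \<Rightarrow> circle) \<Rightarrow> real \<Rightarrow> real" where
  "path_deriv s t X = (SOME g. weak_derivative s t X g)"

text \<open>The integral of \<open>X'\<close> over \<open>[r,t]\<close>.\<close>

definition displacement :: "(real \<Rightarrow> circle) \<Rightarrow> real \<Rightarrow> real \<Rightarrow> real" where
  "displacement X r t = (LINT q:{r..t}|lborel. path_deriv r t X q)"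

text \<open>Paths on an interval are total functions that are \<open>undefined\<close> outside of it.\<close>

definition H1_paths :: "real \<Rightarrow> real \<Rightarrow> (real \<Rightarrow> circle) set" where
  "H1_paths s t = {X \<in> extensional {s..t}. \<exists>g. weak_derivative s t X g}"

definition H1_loc_paths :: "real \<Rightarrow> (real \<Rightarrow> circle) set" where
  "H1_loc_paths t = {X \<in> extensional {..t}. \<forall>s<t. restrict X {s..t} \<in> H1_paths s t}"

section \<open>Forcing measures\<close>

definition msupp :: "'a::topological_space measure \<Rightarrow> 'a set" where
  "msupp \<mu> = {p. \<forall>U. open U \<longrightarrow> p \<in> U \<longrightarrow> emeasure \<mu> U > 0}"

definition atom :: "'a measure \<Rightarrow> 'a set \<Rightarrow> bool" where
  "atom \<mu> A \<longleftrightarrow> A \<in> sets \<mu> \<and> emeasure \<mu> A > 0 \<and>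
     (\<forall>B\<in>sets \<mu>. B \<subseteq> A \<longrightarrow> emeasure \<mu> B = 0 \<or> emeasure \<mu> B = emeasure \<mu> A)"

definition purely_atomic :: "'a measure \<Rightarrow> bool" where
  "purely_atomic \<mu> \<longleftrightarrow> (\<forall>A\<in>sets \<mu>. emeasure \<mu> A > 0 \<longrightarrow> (\<exists>B\<subseteq>A. atom \<mu> B))"

definition Omega :: "(real \<times> circle) measure set" where
  "Omega = {\<mu>. sets \<mu> = sets borel \<and> purely_atomic \<mu> \<and>
     (\<forall>A. atom \<mu> A \<longrightarrow> emeasure \<mu> A < \<infinity>) \<and> (\<forall>p. \<not> p islimpt msupp \<mu>)}"

definition Omega1 :: "(real \<times> circle) measure set" where
  "Omega1 = {\<mu> \<in> Omega. \<exists>M>0. \<exists>s :: real \<Rightarrow> real.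
     (\<forall>t. s t \<le> t - M \<and>
        (\<exists>y. msupp \<mu> \<inter> ({s t - M..s t + M} \<times> UNIV) = {(s t, y)} \<and>
             measure \<mu> {(s t, y)} > 1 / (4 * M))) \<and>
     filterlim s at_top at_top}"

section \<open>Minimizers\<close>

definition action :: "(real \<times> circle) measure \<Rightarrow> real \<Rightarrow> real \<Rightarrow> real \<Rightarrow> (real \<Rightarrow> circle) \<Rightarrow> real" where
  "action \<mu> \<theta> s t X =
     1 / 2 * (LINT r:{s..t}|lborel. (path_deriv s t X r - \<theta>)\<^sup>2)
       - measure \<mu> ((\<lambda>r. (r, X r)) ` {s..<t})"

definition p2p_minimizers ::
    "(real \<times> circle) measure \<Rightarrow> real \<Rightarrow> real \<Rightarrow> circle \<Rightarrow> real \<Rightarrow> circle \<Rightarrow> (real \<Rightarrow> circle) set" where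
  "p2p_minimizers \<mu> \<theta> s y t x =
     {X \<in> H1_paths s t. X s = y \<and> X t = x \<and>
        (\<forall>Y\<in>H1_paths s t. Y s = y \<longrightarrow> Y t = x \<longrightarrow> action \<mu> \<theta> s t X \<le> action \<mu> \<theta> s t Y)}"

definition minimizers_to_time ::
    "(real \<times> circle) measure \<Rightarrow> real \<Rightarrow> real \<Rightarrow> (real \<Rightarrow> circle) set" where
  "minimizers_to_time \<mu> \<theta> t =
     {X \<in> H1_loc_paths t. \<forall>s<t. restrict X {s..t} \<in> p2p_minimizers \<mu> \<theta> s (X s) t (X t)}"

definition minimizers ::
    "(real \<times> circle) measure \<Rightarrow> real \<Rightarrow> real \<Rightarrow> circle \<Rightarrow> (real \<Rightarrow> circle) set" where
  "minimizers \<mu> \<theta> t x = {X \<in> minimizers_to_time \<mu> \<theta> t. X t = x}"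

definition path_le :: "real \<Rightarrow> (real \<Rightarrow> circle) \<Rightarrow> (real \<Rightarrow> circle) \<Rightarrow> bool" where
  "path_le t X1 X2 \<longleftrightarrow> (\<forall>r\<le>t. displacement X1 r t \<ge> displacement X2 r t)"

datatype side = Lft | Rgt

fun extremal_path ::
    "(real \<times> circle) measure \<Rightarrow> side \<Rightarrow> real \<Rightarrow> real \<Rightarrow> circle \<Rightarrow> (real \<Rightarrow> circle)" where
  "extremal_path \<mu> Lft \<theta> t x =
     (THE X. X \<in> minimizers \<mu> \<theta> t x \<and> (\<forall>Y\<in>minimizers \<mu> \<theta> t x. path_le t Y X \<longrightarrow> Y = X))"
| "extremal_path \<mu> Rgt \<theta> t x =
     (THE X. X \<in> minimizers \<mu> \<theta> t x \<and> (\<forall>Y\<in>minimizers \<mu> \<theta> t x. path_le t X Y \<longrightarrow> Y = X))"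

definition velocity :: "(real \<times> circle) measure \<Rightarrow> side \<Rightarrow> real \<Rightarrow> real \<Rightarrow> circle \<Rightarrow> real" where
  "velocity \<mu> \<sigma> \<theta> t x = circle_deriv (extremal_path \<mu> \<sigma> \<theta> t x) t {..t}"

section \<open>Shocks and global shocks\<close>

definition shocks :: "(real \<times> circle) measure \<Rightarrow> (real \<times> real \<times> circle) set" where
  "shocks \<mu> = {(\<theta>, t, x). velocity \<mu> Lft \<theta> t x > velocity \<mu> Rgt \<theta> t x}"

definition T_vee :: "(real \<times> circle) measure \<Rightarrow> real \<Rightarrow> real \<Rightarrow> circle \<Rightarrow> real" where
  "T_vee \<mu> \<theta> t x = Sup {s. s < t \<and> extremal_path \<mu> Lft \<theta> t x s = extremal_path \<mu> Rgt \<theta> t x s}"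

definition global_shocks :: "(real \<times> circle) measure \<Rightarrow> (real \<times> real \<times> circle) set" where
  "global_shocks \<mu> = {(\<theta>, t, x) \<in> shocks \<mu>.
     displacement (extremal_path \<mu> Lft \<theta> t x) (T_vee \<mu> \<theta> t x) t >
     displacement (extremal_path \<mu> Rgt \<theta> t x) (T_vee \<mu> \<theta> t x) t}"

definition shocks_at :: "(real \<times> circle) measure \<Rightarrow> real \<Rightarrow> (real \<times> circle) set" where
  "shocks_at \<mu> \<theta> = {(t, x). (\<theta>, t, x) \<in> shocks \<mu>}"

definition global_shocks_at :: "(real \<times> circle) measure \<Rightarrow> real \<Rightarrow> (real \<times> circle) set" where
  "global_shocks_at \<mu> \<theta> = {(t, x). (\<theta>, t, x) \<in> global_shocks \<mu>}"

definition OmegaT :: "(real \<times> circle) measure set" where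
  "OmegaT = {\<mu> \<in> Omega1. \<forall>\<theta>.
     finite (global_shocks_at \<mu> \<theta> \<inter> msupp \<mu>) \<and> card (global_shocks_at \<mu> \<theta> \<inter> msupp \<mu>) \<le> 1 \<and>
     (shocks_at \<mu> \<theta> \<inter> msupp \<mu>) - global_shocks_at \<mu> \<theta> = {}}"

fun opposite :: "side \<Rightarrow> side" where
  "opposite Lft = Rgt"
| "opposite Rgt = Lft"

text \<open>A left global shock is one whose \<^emph>\<open>right\<close> path meets a global shock atom, and vice versa.\<close>

definition sided_global_shocks ::
    "(real \<times> circle) measure \<Rightarrow> side \<Rightarrow> (real \<times> real \<times> circle) set" where
  "sided_global_shocks \<mu> \<sigma> = {(\<theta>, t, x) \<in> global_shocks \<mu>.
     \<exists>s. T_vee \<mu> \<theta> t x < s \<and> s < t \<and>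
         (s, extremal_path \<mu> (opposite \<sigma>) \<theta> t x s) \<in> global_shocks_at \<mu> \<theta> \<inter> msupp \<mu>}"

definition shock_loc :: "(real \<times> circle) measure \<Rightarrow> side \<Rightarrow> real \<Rightarrow> real \<Rightarrow> circle" where
  "shock_loc \<mu> \<sigma> \<theta> t =
     (if \<exists>!x. (\<theta>, t, x) \<in> global_shocks \<mu>
      then THE x. (\<theta>, t, x) \<in> global_shocks \<mu>
      else THE x. (\<theta>, t, x) \<in> sided_global_shocks \<mu> \<sigma>)"

text \<open>The one-sided derivative in \<open>\<theta>\<close>: from the left for \<open>Lft\<close>, from the right for \<open>Rgt\<close>.\<close>

fun ray :: "side \<Rightarrow> real \<Rightarrow> real set" where
  "ray Lft \<theta> = {..\<theta>}"
| "ray Rgt \<theta> = {\<theta>..}"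

definition shock_loc_deriv :: "(real \<times> circle) measure \<Rightarrow> side \<Rightarrow> real \<Rightarrow> real \<Rightarrow> real" where
  "shock_loc_deriv \<mu> \<sigma> \<theta> t = circle_deriv (\<lambda>\<theta>'. shock_loc \<mu> \<sigma> \<theta>' t) \<theta> (ray \<sigma> \<theta>)"

fun param_interval :: "side \<Rightarrow> real \<Rightarrow> real \<Rightarrow> real set" where
  "param_interval Lft \<theta>1 \<theta>2 = {\<theta>1<..\<theta>2}"
| "param_interval Rgt \<theta>1 \<theta>2 = {\<theta>1..<\<theta>2}"

end

theory Submission
  imports Defs
begin

text \<open>
  Why the theorem holds. Fix a time "t" and a bottleneck, i.e. a heavy isolated atom, early enough
  before "t". Every minimizer passes through it, so on the remaining time interval a minimizer on the
  circle is the projection of a path on the line from a fixed lift "(s0, Y0)" of the bottleneck to some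
  lift "z" of its end point. Let "A t z" be the least untilted action of such a path. It is locally a
  minimum of finitely many parabolas, one for each candidate for the last visited atom; its one-sided
  derivatives are the final slopes of the leftmost and the rightmost optimal path. The tilt enters
  only through the choice of the lift: at tilt \<open>\<theta>\<close> one minimizes \<open>A t (z + n) - \<theta> (z + n)\<close> over the
  integers "n".

  The key object is the winding cost \<open>G t v = A t (v + 1) - A t v\<close>. As optimal paths can be exchanged
  at crossings, it is nondecreasing (\<open>G_mono\<close>), so the lifts that are optimal at tilt \<open>\<theta>\<close> are those with
  \<open>G t (v - 1) \<le> \<theta> \<le> G t v\<close>; they form an interval from \<open>a t \<theta>\<close> to \<open>b t \<theta> + 1\<close>, where
  \<open>{v. G t v = \<theta>}\<close> is the interval from \<open>a t \<theta>\<close> to \<open>b t \<theta>\<close>. The point is that "a" and "b" are lifts of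
  the left and the right global shock. Granting this, the first part is calculus: "a" is a right inverse
  of "G", so its left derivative is the reciprocal of that of "G", and the velocity at a fixed point
  of the circle changes by \<open>A' (v + 1) - A' v = G' v\<close> whenever \<open>\<theta>\<close> passes \<open>G t v\<close> for a lift "v"
  (\<open>a_left_deriv\<close>, \<open>left_jump_sum\<close>). In the second part "G" is flat on the interval from "a" to "b",
  so at "a" the right derivative of "G" vanishes while the left one does not, which leaves a jump
  of the slopes at the lift that is optimal for slightly larger tilts (\<open>shocks_persist\<close>). Statements
  about the right shock follow by reflecting space.

  It remains to identify the global shocks (\<open>global_shock_iff\<close>, \<open>source_sides\<close>). Two minimizers that
  meet strictly before their end agree nearby unless they meet at an atom. Along a flat piece of "G", neighbouring windings use the same last atom modulo 1
  (\<open>left_corner\<close>), so there is an atom which itself admits two windings, and tracing this back one finds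
  an atom that is a shock. By hypothesis it is a global shock and it is the only such atom, the source.
  Hence no atom admits more than two windings, flat pieces have length at most 1 (\<open>b_le_a\<close>), and both
  extremal paths to an interior point of the flat piece come through the source, which prevents them
  from forming a loop around the circle. At the two ends of the flat piece one of the extremal
  paths avoids the source, a loop is formed, and the side from which the source is seen distinguishes
  the left from the right global shock.
\<close>

section \<open>Energy of real-valued Sobolev paths\<close>

definition has_wderiv :: "(real \<Rightarrow> real) \<Rightarrow> (real \<Rightarrow> real) \<Rightarrow> real \<Rightarrow> real \<Rightarrow> bool" where
  "has_wderiv F g s t \<longleftrightarrow>
     set_integrable lborel {s..t} g \<and> set_integrable lborel {s..t} (\<lambda>r. (g r)\<^sup>2) \<and>
     (\<forall>r\<in>{s..t}. F r = F s + (LINT q:{s..r}|lborel. g q))"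

lemma has_wderivD:
  assumes "has_wderiv F g s t"
  shows "set_integrable lborel {s..t} g" "set_integrable lborel {s..t} (\<lambda>r. (g r)\<^sup>2)"
    "\<And>r. s \<le> r \<Longrightarrow> r \<le> t \<Longrightarrow> F r = F s + (LINT q:{s..r}|lborel. g q)"
  using assms unfolding has_wderiv_def by (blast, blast, metis atLeastAtMost_iff)

definition H1 :: "(real \<Rightarrow> real) \<Rightarrow> real \<Rightarrow> real \<Rightarrow> bool" where
  "H1 F s t \<longleftrightarrow> (\<exists>g. has_wderiv F g s t)"

definition energy :: "(real \<Rightarrow> real) \<Rightarrow> real \<Rightarrow> real \<Rightarrow> real" where
  "energy F s t = 1 / 2 * (LINT r:{s..t}|lborel. ((SOME g. has_wderiv F g s t) r)\<^sup>2)"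

lemma weak_derivative_iff_lift:
  "weak_derivative s t X g \<longleftrightarrow> (\<exists>F. has_wderiv F g s t \<and> (\<forall>r\<in>{s..t}. X r = to_circle (F r)))"
  unfolding weak_derivative_def has_wderiv_def by blast

lemma set_integrable_subinterval:
  fixes g :: "real \<Rightarrow> real"
  assumes "set_integrable lborel {s..t} g" "s \<le> s'" "t' \<le> t"
  shows "set_integrable lborel {s'..t'} g"
  by (rule set_integrable_subset[OF assms(1)]) (use assms in auto)

lemma set_integrable_const_interval [simp]: "set_integrable lborel {s..t::real} (\<lambda>_. c::real)"
  unfolding set_integrable_def
  by (simp add: integrable_real_indicator emeasure_lborel_Icc_eq)

lemma set_integral_split:
  fixes g :: "real \<Rightarrow> real"
  assumes "set_integrable lborel {s..t} g" "s \<le> r" "r \<le> t"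
  shows "(LINT q:{s..t}|lborel. g q) = (LINT q:{s..r}|lborel. g q) + (LINT q:{r..t}|lborel. g q)"
proof -
  have "{s..t} = {s..r} \<union> {r..t}" using assms by auto
  moreover have "AE q in lborel. \<not> (q \<in> {s..r} \<and> q \<in> {r..t})"
    by (rule AE_mp[OF AE_lborel_singleton[of r]]) auto
  ultimately show ?thesis
    using assms by (simp add: set_integral_Un_AE set_integrable_subset)
qed

lemma set_integrable_join:
  fixes g :: "real \<Rightarrow> real"
  assumes "set_integrable lborel {s..r} g" "set_integrable lborel {r..t} g" "s \<le> r" "r \<le> t"
  shows "set_integrable lborel {s..t} g"
proof -
  have "{s..t} = {s..r} \<union> {r..t}" using assms by auto
  then show ?thesis using assms by (simp add: set_integrable_Un)
qed

lemma set_integral_cong_AE_interval: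
  fixes f g :: "real \<Rightarrow> real"
  assumes "set_integrable lborel {s..t} f" "set_integrable lborel {s..t} g"
    and "AE q in lborel. q \<in> {s..t} \<longrightarrow> f q = g q"
  shows "(LINT q:{s..t}|lborel. f q) = (LINT q:{s..t}|lborel. g q)"
  unfolding set_lebesgue_integral_def
proof (rule integral_cong_AE)
  show "(\<lambda>q. indicator {s..t} q *\<^sub>R f q) \<in> borel_measurable lborel"
    "(\<lambda>q. indicator {s..t} q *\<^sub>R g q) \<in> borel_measurable lborel"
    using assms(1,2) by (auto simp: set_integrable_def dest!: borel_measurable_integrable)
  show "AE q in lborel. indicator {s..t} q *\<^sub>R f q = indicator {s..t} q *\<^sub>R g q"
    using assms(3) by eventually_elim (auto simp: indicator_def)
qed

lemma set_integral_singleton: "(LINT q:{s..s}|lborel. g q) = (0::real)" for g :: "real \<Rightarrow> real"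
proof -
  have "(LINT q:{s}|lborel. g q) = (LINT q:{s}|lborel. g s)"
    by (rule set_lebesgue_integral_cong) auto
  then show ?thesis by (simp add: set_integral_const)
qed

text \<open>
  The positive and the negative part of h are densities of two finite measures that agree on
  all half-lines, hence everywhere.
\<close>

lemma zero_integrals_imp_AE_zero:
  fixes h :: "real \<Rightarrow> real"
  assumes h: "set_integrable lborel {s..t} h"
    and z: "\<And>r. r \<in> {s..t} \<Longrightarrow> (LINT q:{s..r}|lborel. h q) = 0"
  shows "AE q in lborel. q \<in> {s..t} \<longrightarrow> h q = 0"
proof (cases "s \<le> t")
  case True
  define k where "k q = indicator {s..t} q * h q" for q
  have k: "integrable lborel k" using h unfolding k_def set_integrable_def by simp
  note [measurable] = borel_measurable_integrable[OF k]
  let ?M = "density lborel (\<lambda>q. ennreal (max 0 (k q)))"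
  let ?N = "density lborel (\<lambda>q. ennreal (max 0 (- k q)))"
  have kp: "integrable lborel (\<lambda>q. max 0 (k q))" and kn: "integrable lborel (\<lambda>q. max 0 (- k q))"
    using k by (auto intro!: integrable_max)
  have em: "emeasure (density lborel (\<lambda>q. ennreal (f q))) A = ennreal (LINT q:A|lborel. f q)"
    if "integrable lborel f" "\<And>q. f q \<ge> 0" "A \<in> sets borel" for f :: "real \<Rightarrow> real" and A
  proof -
    have "integrable lborel (\<lambda>q. f q * indicator A q)"
      using integrable_mult_indicator[of A lborel f] that by (simp add: mult.commute)
    then show ?thesis
      using that by (subst emeasure_density)
        (auto simp: set_lebesgue_integral_def nn_integral_eq_integral[symmetric] ennreal_mult'' ennreal_indicator mult.commute)
  qed
  have tail: "(LINT q:{x<..}|lborel. k q) = 0" for x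
  proof -
    have I: "(LINT q:{s..t}|lborel. h q) = 0" using z True by auto
    consider "x < s" | "x \<in> {s..t}" | "x > t" by fastforce
    then show ?thesis
    proof cases
      case 1
      have "(LINT q:{x<..}|lborel. k q) = (LINT q:{s..t}|lborel. h q)"
        unfolding set_lebesgue_integral_def k_def using 1
        by (intro Bochner_Integration.integral_cong) (auto simp: indicator_def)
      then show ?thesis using I by simp
    next
      case 2
      have "(LINT q:{x<..}|lborel. k q) = (LINT q:{x<..t}|lborel. h q)"
        unfolding set_lebesgue_integral_def k_def using 2
        by (intro Bochner_Integration.integral_cong) (auto simp: indicator_def)
      also have "\<dots> = (LINT q:{x..t}|lborel. h q)"
      proof (rule set_integral_cong_set)
        show "set_borel_measurable lborel {x..t} h" "set_borel_measurable lborel {x<..t} h"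
          using set_integrable_subset[OF h, of "{x..t}"] set_integrable_subset[OF h, of "{x<..t}"] 2
          by (auto simp: set_integrable_def set_borel_measurable_def subset_iff
            dest!: borel_measurable_integrable)
        show "AE q in lborel. (q \<in> {x..t}) = (q \<in> {x<..t})"
          by (rule AE_mp[OF AE_lborel_singleton[of x]]) auto
      qed
      also have "\<dots> = 0" using set_integral_split[OF h, of x] 2 I z[OF 2] by auto
      finally show ?thesis .
    next
      case 3
      show ?thesis
        unfolding set_lebesgue_integral_def k_def using 3
        by (intro integral_eq_zero_AE AE_I2) (auto simp: indicator_def)
    qed
  qed
  have diff: "(LINT q:A|lborel. k q) = (LINT q:A|lborel. max 0 (k q)) - (LINT q:A|lborel. max 0 (- k q))"
    if "A \<in> sets borel" for A
  proof -
    have "(LINT q:A|lborel. k q) = (LINT q:A|lborel. max 0 (k q) - max 0 (- k q))"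
      by (intro set_lebesgue_integral_cong) (use that in \<open>auto simp: max_def\<close>)
    also have "\<dots> = (LINT q:A|lborel. max 0 (k q)) - (LINT q:A|lborel. max 0 (- k q))"
      using that by (intro set_integral_diff(2))
        (auto simp: set_integrable_def intro!: integrable_mult_indicator[where 'b=real, simplified] kp kn)
    finally show ?thesis .
  qed
  have MN: "?M = ?N"
  proof (rule measure_eqI_lessThan)
    show "emeasure ?M {x<..} < \<infinity>" for x by (subst em) (auto simp: kp)
    show "emeasure ?M {x<..} = emeasure ?N {x<..}" for x
      using diff[of "{x<..}"] tail[of x] by (simp add: em kp kn)
  qed auto
  have "AE q in lborel. k q = 0"
  proof (rule density_unique_real[OF k])
    show "integrable lborel (\<lambda>_::real. 0::real)" by simp
    fix A :: "real set" assume A: "A \<in> sets lborel"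
    have "emeasure ?M A = emeasure ?N A" using MN by simp
    then have "ennreal (LINT q:A|lborel. max 0 (k q)) = ennreal (LINT q:A|lborel. max 0 (- k q))"
      using A by (simp add: em kp kn)
    then have "(LINT q:A|lborel. max 0 (k q)) = (LINT q:A|lborel. max 0 (- k q))"
      by (subst (asm) ennreal_inj) (auto simp: set_lebesgue_integral_def intro!: integral_nonneg_AE)
    then show "(LINT q:A|lborel. k q) = (LINT q:A|lborel. 0)" using diff A by simp
  qed
  then show ?thesis by (rule AE_mp) (auto simp: k_def intro!: AE_I2)
qed auto

lemma has_wderiv_integral:
  assumes "has_wderiv F g s t" "s \<le> r" "r \<le> q" "q \<le> t"
  shows "F q = F r + (LINT q:{r..q}|lborel. g q)"
proof -
  have "set_integrable lborel {s..q} g"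
    by (rule set_integrable_subinterval[OF has_wderivD(1)[OF assms(1)]]) (use assms(2-4) in auto)
  then have 1: "(LINT q:{s..q}|lborel. g q) = (LINT q:{s..r}|lborel. g q) + (LINT q:{r..q}|lborel. g q)"
    by (rule set_integral_split[OF _ assms(2,3)])
  have 2: "F q = F s + (LINT q:{s..q}|lborel. g q)"
    by (rule has_wderivD(3)[OF assms(1)]) (use assms(2-4) in linarith)+
  have 3: "F r = F s + (LINT q:{s..r}|lborel. g q)"
    by (rule has_wderivD(3)[OF assms(1)]) (use assms(2-4) in linarith)+
  show ?thesis using 1 2 3 by linarith
qed

lemma energy_eq_integral:
  assumes g: "has_wderiv F g s t"
  shows "energy F s t = 1 / 2 * (LINT r:{s..t}|lborel. (g r)\<^sup>2)"
proof -
  define g' where "g' = (SOME g. has_wderiv F g s t)"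
  have "\<exists>g. has_wderiv F g s t" using g by blast
  then have g': "has_wderiv F g' s t" unfolding g'_def by (rule someI_ex)
  have "AE q in lborel. q \<in> {s..t} \<longrightarrow> g' q - g q = 0"
  proof (rule zero_integrals_imp_AE_zero)
    show "set_integrable lborel {s..t} (\<lambda>q. g' q - g q)"
      using has_wderivD(1)[OF g] has_wderivD(1)[OF g'] by auto
    fix r assume r: "r \<in> {s..t}"
    have "set_integrable lborel {s..r} g" "set_integrable lborel {s..r} g'"
      using has_wderivD(1)[OF g] has_wderivD(1)[OF g'] r by (auto intro: set_integrable_subinterval)
    then have "(LINT q:{s..r}|lborel. g' q - g q)
        = (LINT q:{s..r}|lborel. g' q) - (LINT q:{s..r}|lborel. g q)" by auto
    also have "\<dots> = 0"
      using has_wderiv_integral[OF g, of s r] has_wderiv_integral[OF g', of s r] r by simp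
    finally show "(LINT q:{s..r}|lborel. g' q - g q) = 0" .
  qed
  then have "(LINT r:{s..t}|lborel. (g' r)\<^sup>2) = (LINT r:{s..t}|lborel. (g r)\<^sup>2)"
  proof (intro set_integral_cong_AE_interval has_wderivD[OF g] has_wderivD[OF g'])
    assume "AE q in lborel. q \<in> {s..t} \<longrightarrow> g' q - g q = 0"
    then show "AE q in lborel. q \<in> {s..t} \<longrightarrow> (g' q)\<^sup>2 = (g q)\<^sup>2"
      by eventually_elim auto
  qed
  then show ?thesis unfolding energy_def g'_def by simp
qed

lemma H1_cong:
  assumes "\<And>r. s \<le> r \<Longrightarrow> r \<le> t \<Longrightarrow> F r = F' r"
  shows "H1 F s t \<longleftrightarrow> H1 F' s t" and "energy F s t = energy F' s t"
proof -
  have *: "has_wderiv F g s t \<longleftrightarrow> has_wderiv F' g s t" for g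
  proof (cases "s \<le> t")
    case True
    have "(F r = F s + c) \<longleftrightarrow> (F' r = F' s + c)" if "r \<in> {s..t}" for r c
      using assms[of s] assms[of r] that by simp
    then show ?thesis unfolding has_wderiv_def by (intro conj_cong ball_cong refl)
  qed (simp add: has_wderiv_def)
  then show "H1 F s t \<longleftrightarrow> H1 F' s t" "energy F s t = energy F' s t"
    unfolding H1_def energy_def by auto
qed

lemma has_wderiv_sub:
  assumes "has_wderiv F g s t" "s \<le> s'" "t' \<le> t"
  shows "has_wderiv F g s' t'"
  unfolding has_wderiv_def
proof (intro conjI ballI)
  show "set_integrable lborel {s'..t'} g" "set_integrable lborel {s'..t'} (\<lambda>r. (g r)\<^sup>2)"
    using has_wderivD(1,2)[OF assms(1)] assms(2,3) by (auto intro: set_integrable_subinterval)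
  show "F r = F s' + (LINT q:{s'..r}|lborel. g q)" if "r \<in> {s'..t'}" for r
    using has_wderiv_integral[OF assms(1), of s' r] assms(2,3) that by auto
qed

lemma H1_sub: "H1 F s t \<Longrightarrow> s \<le> s' \<Longrightarrow> t' \<le> t \<Longrightarrow> H1 F s' t'"
  unfolding H1_def using has_wderiv_sub by blast

lemma has_wderiv_join:
  assumes 1: "has_wderiv F g s r" and 2: "has_wderiv F g' r t" and "s \<le> r" "r \<le> t"
  shows "has_wderiv F (\<lambda>q. if q < r then g q else g' q) s t" (is "has_wderiv F ?g s t")
proof -
  have AE1: "AE q in lborel. q \<in> {s..r} \<longrightarrow> ?g q = g q"
    by (rule AE_mp[OF AE_lborel_singleton[of r]]) auto
  have eq: "integrable lborel (\<lambda>q. indicator {s..r} q *\<^sub>R f (?g q)) \<longleftrightarrow>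
      integrable lborel (\<lambda>q. indicator {s..r} q *\<^sub>R f (g q))" for f :: "real \<Rightarrow> real"
    by (rule integrable_discrete_difference[where X="{r}"]) (auto simp: indicator_def)
  have eq': "(\<integral>q. indicator {s..r'} q *\<^sub>R f (?g q) \<partial>lborel) =
      (\<integral>q. indicator {s..r'} q *\<^sub>R f (g q) \<partial>lborel)" if "r' \<le> r" for f :: "real \<Rightarrow> real" and r'
    using that by (intro integral_discrete_difference[where X="{r}"]) (auto simp: indicator_def)
  have i1: "set_integrable lborel {s..r} ?g" "set_integrable lborel {s..r} (\<lambda>q. (?g q)\<^sup>2)"
    using has_wderivD(1,2)[OF 1] eq[of "\<lambda>x. x"] eq[of "\<lambda>x. x\<^sup>2"] by (auto simp: set_integrable_def)
  have i2: "set_integrable lborel {r..t} ?g" "set_integrable lborel {r..t} (\<lambda>q. (?g q)\<^sup>2)"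
    using has_wderivD(1,2)[OF 2] set_integrable_cong[of lborel lborel "{r..t}" "{r..t}" ?g g']
      set_integrable_cong[of lborel lborel "{r..t}" "{r..t}" "\<lambda>q. (?g q)\<^sup>2" "\<lambda>q. (g' q)\<^sup>2"]
    by simp_all
  have i3: "set_integrable lborel {s..t} ?g"
    by (rule set_integrable_join[OF i1(1) i2(1) assms(3,4)])
  have v1: "F q = F s + (LINT q:{s..q}|lborel. ?g q)" if "q \<in> {s..r}" for q
    using has_wderivD(3)[OF 1, of q] eq'[of q "\<lambda>x. x"] that by (simp add: set_lebesgue_integral_def)
  have v2: "F q = F s + (LINT q:{s..q}|lborel. ?g q)" if "q \<in> {r..t}" for q
  proof -
    have "set_integrable lborel {s..q} ?g" using i3 that by (auto intro: set_integrable_subinterval)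
    from set_integral_split[OF this, of r]
    have "(LINT q:{s..q}|lborel. ?g q) = (LINT q:{s..r}|lborel. ?g q) + (LINT q:{r..q}|lborel. ?g q)"
      using that assms(3,4) by auto
    also have "(LINT q:{r..q}|lborel. ?g q) = (LINT q:{r..q}|lborel. g' q)"
      by (rule set_lebesgue_integral_cong) auto
    also have "\<dots> = F q - F r" using has_wderivD(3)[OF 2, of q] that by simp
    finally show ?thesis using v1[of r] assms(3) by simp
  qed
  show ?thesis unfolding has_wderiv_def
  proof (intro conjI ballI i3 set_integrable_join[OF i1(2) i2(2) assms(3,4)])
    show "F q = F s + (LINT q:{s..q}|lborel. ?g q)" if "q \<in> {s..t}" for q
    proof (cases "q \<le> r")
      case True then show ?thesis using that by (intro v1) auto
    next
      case False then show ?thesis using that by (intro v2) auto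
    qed
  qed
qed

lemma H1_join:
  assumes "H1 F s r" "H1 F r t" "s \<le> r" "r \<le> t"
  shows "H1 F s t"
  using assms has_wderiv_join unfolding H1_def by blast

lemma energy_split:
  assumes "H1 F s t" "s \<le> r" "r \<le> t"
  shows "energy F s t = energy F s r + energy F r t"
proof -
  obtain g where g: "has_wderiv F g s t" using assms by (auto simp: H1_def)
  have "has_wderiv F g s r" "has_wderiv F g r t" using has_wderiv_sub[OF g] assms(2,3) by auto
  then show ?thesis using set_integral_split[OF has_wderivD(2)[OF g], of r] assms(2,3)
    by (simp only: energy_eq_integral[OF g] energy_eq_integral[of F g s r] energy_eq_integral[of F g r t])
      (simp add: field_simps)
qed

lemma energy_refl [simp]: "energy F s s = 0"
  unfolding energy_def using set_integral_singleton[of s] by simp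

lemma H1_refl [simp]: "H1 F s s"
  unfolding H1_def has_wderiv_def
  by (auto simp: set_integral_singleton intro!: exI[of _ "\<lambda>_. 0"])

lemma H1_continuous:
  assumes "H1 F s t" shows "continuous_on {s..t} F"
proof -
  obtain g where g: "has_wderiv F g s t" using assms by (auto simp: H1_def)
  note gi = has_wderivD(1)[OF g]
  have "g integrable_on {s..t}" using set_borel_integral_eq_integral[OF gi] by auto
  then have "continuous_on {s..t} (\<lambda>r. F s + integral {s..r} g)"
    by (intro continuous_intros indefinite_integral_continuous_1)
  moreover have "F r = F s + integral {s..r} g" if "r \<in> {s..t}" for r
  proof -
    have "set_integrable lborel {s..r} g" using gi that by (auto intro: set_integrable_subinterval)
    then show ?thesis using has_wderivD(3)[OF g, of r] that set_borel_integral_eq_integral(2) by simp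
  qed
  ultimately show ?thesis by (metis (no_types, lifting) continuous_on_cong)
qed

lemma has_wderiv_linear:
  assumes "\<And>r. s \<le> r \<Longrightarrow> r \<le> t \<Longrightarrow> F r = F s + c * (r - s)" "s \<le> t"
  shows "has_wderiv F (\<lambda>_. c) s t"
  unfolding has_wderiv_def
proof (intro conjI ballI)
  show "F r = F s + (LINT q:{s..r}|lborel. c)" if "r \<in> {s..t}" for r
    using assms(1)[of r] that by (simp add: set_integral_const)
qed auto

lemma H1_linear:
  assumes "\<And>r. s \<le> r \<Longrightarrow> r \<le> t \<Longrightarrow> F r = F s + c * (r - s)" "s \<le> t"
  shows "H1 F s t" and "energy F s t = c\<^sup>2 * (t - s) / 2"
  using has_wderiv_linear[of s t F c, OF assms] energy_eq_integral[OF has_wderiv_linear[of s t F c, OF assms]] \<open>s \<le> t\<close>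
  by (auto simp: H1_def set_integral_const)

text \<open>
  Expanding the square of the distance of the weak derivative from its mean gives Jensen's
  inequality together with its equality case.
\<close>

lemma energy_excess:
  assumes g: "has_wderiv F g s t" and "s < t"
  shows "energy F s t = (F t - F s)\<^sup>2 / (2 * (t - s)) +
    1 / 2 * (LINT r:{s..t}|lborel. (g r - (F t - F s) / (t - s))\<^sup>2)"
proof -
  define c where "c = (F t - F s) / (t - s)"
  note gi = has_wderivD(1,2)[OF g]
  have ci: "set_integrable lborel {s..t} (\<lambda>r. c\<^sup>2)" by simp
  have G: "(LINT r:{s..t}|lborel. g r) = c * (t - s)"
    using has_wderiv_integral[OF g, of s t] assms by (simp add: c_def)
  have "(LINT r:{s..t}|lborel. (g r - c)\<^sup>2) = (LINT r:{s..t}|lborel. ((g r)\<^sup>2 - (2 * c) * g r) + c\<^sup>2)"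
    by (rule set_lebesgue_integral_cong) (auto simp: power2_eq_square algebra_simps)
  also have "\<dots> = (LINT r:{s..t}|lborel. (g r)\<^sup>2) - 2 * c * (LINT r:{s..t}|lborel. g r) + c\<^sup>2 * (t - s)"
    using gi ci assms(2) by (simp add: set_integral_const)
  finally have "(LINT r:{s..t}|lborel. (g r - c)\<^sup>2) = (LINT r:{s..t}|lborel. (g r)\<^sup>2) - c\<^sup>2 * (t - s)"
    by (simp add: G power2_eq_square algebra_simps)
  moreover have "(F t - F s)\<^sup>2 / (2 * (t - s)) = c\<^sup>2 * (t - s) / 2"
    using assms by (simp add: c_def power2_eq_square)
  ultimately show ?thesis
    unfolding energy_eq_integral[OF g] c_def[symmetric] by linarith
qed

lemma energy_ge_chord:
  assumes "H1 F s t" "s < t"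
  shows "energy F s t \<ge> (F t - F s)\<^sup>2 / (2 * (t - s))"
proof -
  obtain g where g: "has_wderiv F g s t" using assms by (auto simp: H1_def)
  show ?thesis
    using energy_excess[OF g assms(2)] by (simp add: set_lebesgue_integral_def)
qed

lemma energy_nonneg: "energy F s t \<ge> 0"
  unfolding energy_def by (simp add: set_lebesgue_integral_def)

lemma energy_eq_chord_imp_linear:
  assumes "H1 F s t" "s < t" and le: "energy F s t \<le> (F t - F s)\<^sup>2 / (2 * (t - s))"
    and r: "s \<le> r" "r \<le> t"
  shows "F r = F s + (F t - F s) / (t - s) * (r - s)"
proof -
  obtain g where g: "has_wderiv F g s t" using assms by (auto simp: H1_def)
  define c where "c = (F t - F s) / (t - s)"
  let ?h = "\<lambda>r. indicator {s..t} r *\<^sub>R (g r - c)\<^sup>2"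
  note gi = has_wderivD(1,2)[OF g]
  have "set_integrable lborel {s..t} (\<lambda>r. ((g r)\<^sup>2 - (2 * c) * g r) + c\<^sup>2)"
    using gi by (intro set_integral_add set_integral_diff) auto
  then have hi: "integrable lborel ?h"
    unfolding set_integrable_def
  proof (rule back_subst[of "integrable lborel"])
    show "(\<lambda>x. indicat_real {s..t} x *\<^sub>R ((g x)\<^sup>2 - 2 * c * g x + c\<^sup>2)) = ?h"
      by (rule ext) (simp add: power2_diff)
  qed
  have "(LINT r|lborel. ?h r) \<le> 0"
    using energy_excess[OF g assms(2)] le by (simp add: c_def set_lebesgue_integral_def)
  then have "(LINT r|lborel. ?h r) = 0"
    by (intro antisym) (auto intro!: integral_nonneg_AE)
  then have "AE r in lborel. ?h r = 0"
    using integral_nonneg_eq_0_iff_AE[OF hi] by auto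
  then have ae: "AE q in lborel. q \<in> {s..t} \<longrightarrow> g q = c"
    by (rule AE_mp) (auto intro!: AE_I2)
  have "F r = F s + (LINT q:{s..r}|lborel. g q)" by (rule has_wderivD(3)[OF g r])
  also have "(LINT q:{s..r}|lborel. g q) = (LINT q:{s..r}|lborel. c)"
  proof (intro set_integral_cong_AE_interval set_integrable_subinterval[OF gi(1)])
    show "AE q in lborel. q \<in> {s..r} \<longrightarrow> g q = c"
      using ae by eventually_elim (use r in auto)
  qed (use r in auto)
  also have "(LINT q:{s..r}|lborel. c) = c * (r - s)" using r by (simp add: set_integral_const)
  finally show ?thesis unfolding c_def .
qed

lemma has_wderiv_shift:
  "has_wderiv (\<lambda>r. F r + c) g s t \<longleftrightarrow> has_wderiv F g s t"
  by (auto simp: has_wderiv_def)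

lemma energy_shift [simp]: "energy (\<lambda>r. F r + c) s t = energy F s t"
  and H1_shift [simp]: "H1 (\<lambda>r. F r + c) s t = H1 F s t"
  by (auto simp: energy_def H1_def has_wderiv_shift)

lemma has_wderiv_minus:
  assumes "has_wderiv F g s t" shows "has_wderiv (\<lambda>r. - F r) (\<lambda>r. - g r) s t"
  unfolding has_wderiv_def
proof (intro conjI ballI)
  show "set_integrable lborel {s..t} (\<lambda>r. - g r)"
    using has_wderivD(1)[OF assms] by (auto simp: set_integrable_def)
  show "set_integrable lborel {s..t} (\<lambda>r. (- g r)\<^sup>2)"
    using has_wderivD(2)[OF assms] by simp
  fix r assume r: "r \<in> {s..t}"
  have "set_integrable lborel {s..r} g" using r has_wderivD(1)[OF assms]
    by (auto intro: set_integrable_subinterval)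
  then show "- F r = - F s + (LINT q:{s..r}|lborel. - g q)"
    using has_wderivD(3)[OF assms, of r] r by (simp add: set_integral_uminus)
qed

lemma H1_minus [simp]: "H1 (\<lambda>r. - F r) s t = H1 F s t"
  using has_wderiv_minus[of F _ s t] has_wderiv_minus[of "\<lambda>r. - F r" _ s t]
  by (auto simp: H1_def)

lemma energy_minus [simp]: "energy (\<lambda>r. - F r) s t = energy F s t"
proof (cases "H1 F s t")
  case True
  then obtain g where "has_wderiv F g s t" by (auto simp: H1_def)
  then show ?thesis using energy_eq_integral[OF has_wderiv_minus, of F g s t] energy_eq_integral[of F g s t]
    by simp
next
  case False
  then have "\<not> H1 (\<lambda>r. - F r) s t" by simp
  with False have "(\<lambda>g. has_wderiv F g s t) = (\<lambda>g. has_wderiv (\<lambda>r. - F r) g s t)"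
    unfolding H1_def fun_eq_iff by blast
  then show ?thesis unfolding energy_def by simp
qed

section \<open>Periodic point environments and action minimizers on the line\<close>

definition glue :: "real \<Rightarrow> (real \<Rightarrow> real) \<Rightarrow> (real \<Rightarrow> real) \<Rightarrow> real \<Rightarrow> real" where
  "glue r F F' q = (if q \<le> r then F q else F' q)"

definition chord :: "real \<Rightarrow> real \<Rightarrow> real \<Rightarrow> real \<Rightarrow> real \<Rightarrow> real" where
  "chord r y t z q = y + (z - y) / (t - r) * (q - r)"

lemma chord_start [simp]: "chord r y t z r = y"
  and chord_end: "r < t \<Longrightarrow> chord r y t z t = z"
  by (auto simp: chord_def)

lemma chord_H1:
  assumes "r < t"
  shows "H1 (chord r y t z) r t" and "energy (chord r y t z) r t = (z - y)\<^sup>2 / (2 * (t - r))"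
proof -
  note lin = H1_linear[of r t "chord r y t z" "(z - y) / (t - r)"]
  show "H1 (chord r y t z) r t" by (rule lin(1)) (use assms in \<open>auto simp: chord_def\<close>)
  have "energy (chord r y t z) r t = ((z - y) / (t - r))\<^sup>2 * (t - r) / 2"
    by (rule lin(2)) (use assms in \<open>auto simp: chord_def\<close>)
  also have "\<dots> = (z - y)\<^sup>2 / (2 * (t - r))"
    using assms by (simp add: power_divide power2_eq_square[of "t - r"])
  finally show "energy (chord r y t z) r t = (z - y)\<^sup>2 / (2 * (t - r))" .
qed

lemma glue_H1:
  assumes "H1 F s r" "H1 F' r t" "F r = F' r" "s \<le> r" "r \<le> t"
  shows "H1 (glue r F F') s t"
proof (rule H1_join[of _ s r t])
  show "H1 (glue r F F') s r"
    using assms(1) H1_cong(1)[of s r "glue r F F'" F] by (simp add: glue_def)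
  show "H1 (glue r F F') r t"
    using assms(2,3) H1_cong(1)[of r t "glue r F F'" F'] by (simp add: glue_def)
qed (use assms in auto)

lemma abs_le_square_plus_one: "\<bar>x\<bar> \<le> x\<^sup>2 + (1::real)"
proof (cases "\<bar>x\<bar> \<le> 1")
  case True then show ?thesis using zero_le_power2[of x] by linarith
next
  case False
  then have "\<bar>x\<bar> * 1 \<le> \<bar>x\<bar> * \<bar>x\<bar>" by (intro mult_left_mono) auto
  then show ?thesis by (simp add: power2_eq_square)
qed

text \<open>
  The weight w r y is the mass of the forcing measure at the projection of (r, y) to the
  cylinder; the points of positive weight are the lifts of the atoms. Working with all lifts
  at once turns the circle-valued problem into a problem on the plane with a periodic
  environment.
\<close>

locale env =
  fixes w :: "real \<Rightarrow> real \<Rightarrow> real"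
  assumes w_nonneg: "0 \<le> w r y"
    and w_period1: "w r (y + 1) = w r y"
    and w_locfin: "finite {(r, y). r \<in> {a..b} \<and> y \<in> {c..d} \<and> w r y > 0}"
begin

lemma w_period: "w r (y + of_int k) = w r y"
proof (induction k arbitrary: y rule: int_induct[of _ 0])
  case (step1 i)
  have "w r (y + of_int (i + 1)) = w r ((y + of_int i) + 1)" by (simp add: add.assoc)
  also have "\<dots> = w r y" by (simp only: w_period1 step1.IH)
  finally show ?case .
next
  case (step2 i)
  have "w r (y + of_int i) = w r ((y + of_int (i - 1)) + 1)" by (simp add: algebra_simps)
  also have "\<dots> = w r (y + of_int (i - 1))" by (rule w_period1)
  finally show ?case by (simp only: step2.IH)
qed simp

lemma w_period_Ints: "x - y \<in> \<int> \<Longrightarrow> w r x = w r y"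
proof -
  assume "x - y \<in> \<int>"
  then obtain k where "x - y = of_int k" by (rule Ints_cases)
  then have "x = y + of_int k" by simp
  then show ?thesis by (simp add: w_period)
qed

definition T :: "real set" where
  "T = {r. \<exists>y. w r y > 0}"

lemma notin_T: "r \<notin> T \<Longrightarrow> w r y = 0"
  using w_nonneg[of r y] unfolding T_def by (auto simp: not_less intro: antisym)

lemma finite_T: "finite (T \<inter> {a..b})"
proof -
  have "T \<inter> {a..b} \<subseteq> fst ` {(r, y). r \<in> {a..b} \<and> y \<in> {0..1} \<and> w r y > 0}"
  proof
    fix r assume r: "r \<in> T \<inter> {a..b}"
    then obtain y where y: "w r y > 0" by (auto simp: T_def)
    have "w r (frac y) = w r y" by (rule w_period_Ints) (simp add: frac_def)
    moreover have "frac y \<in> {0..1}" using frac_lt_1[of y] by (simp add: less_imp_le)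
    ultimately show "r \<in> fst ` {(r, y). r \<in> {a..b} \<and> y \<in> {0..1} \<and> w r y > 0}"
      using r y by (intro image_eqI[of _ _ "(r, frac y)"]) auto
  qed
  then show ?thesis by (rule finite_subset) (intro finite_imageI w_locfin)
qed

lemma finite_T_sub: "A \<subseteq> {a..b} \<Longrightarrow> finite (T \<inter> A)"
  by (rule finite_subset[OF _ finite_T[of a b]]) auto

lemma finite_T_intervals [simp]:
  "finite (T \<inter> {a..<b})" "finite (T \<inter> {a<..<b})" "finite (T \<inter> {a<..b})"
  by (rule finite_T_sub[of _ a b]; auto)+

lemma w_bounded: "\<exists>B\<ge>0. \<forall>r\<in>{a..b}. \<forall>y. w r y \<le> B"
proof -
  let ?S = "{(r, y). r \<in> {a..b} \<and> y \<in> {0..1} \<and> w r y > 0}"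
  define B where "B = (\<Sum>p\<in>?S. w (fst p) (snd p))"
  have fin: "finite ?S" by (rule w_locfin)
  have B0: "B \<ge> 0" unfolding B_def by (rule sum_nonneg) (simp add: w_nonneg)
  have "w r y \<le> B" if r: "r \<in> {a..b}" for r y
  proof (cases "w r y > 0")
    case True
    have eq: "w r (frac y) = w r y" by (rule w_period_Ints) (simp add: frac_def)
    moreover have "frac y \<in> {0..1}" using frac_lt_1[of y] by (simp add: less_imp_le)
    ultimately have "(r, frac y) \<in> ?S" using True r by auto
    from member_le_sum[OF this _ fin, of "\<lambda>p. w (fst p) (snd p)"]
    show ?thesis using eq by (simp add: B_def w_nonneg)
  qed (use B0 in auto)
  then show ?thesis using B0 by blast
qed

text \<open>
  The sum is finite even for an arbitrary path, as only the times of atoms contribute.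
\<close>

definition mass :: "(real \<Rightarrow> real) \<Rightarrow> real \<Rightarrow> real \<Rightarrow> real" where
  "mass F s t = (\<Sum>r\<in>T \<inter> {s..<t}. w r (F r))"

lemma mass_nonneg: "0 \<le> mass F s t"
  unfolding mass_def by (intro sum_nonneg w_nonneg)

lemma mass_bounded: "\<exists>C\<ge>0. \<forall>F s t. a \<le> s \<longrightarrow> t \<le> b \<longrightarrow> mass F s t \<le> C"
proof -
  obtain B where B: "B \<ge> 0" "\<forall>r\<in>{a..b}. \<forall>y. w r y \<le> B" using w_bounded by blast
  have "mass F s t \<le> real (card (T \<inter> {a..b})) * B" if "a \<le> s" "t \<le> b" for F s t
  proof -
    have "mass F s t \<le> (\<Sum>r\<in>T \<inter> {s..<t}. B)"
      unfolding mass_def using that B by (intro sum_mono) auto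
    also have "\<dots> = real (card (T \<inter> {s..<t})) * B" by simp
    also have "\<dots> \<le> real (card (T \<inter> {a..b})) * B"
      using that B(1) by (intro mult_right_mono of_nat_mono card_mono finite_T) auto
    finally show ?thesis .
  qed
  then show ?thesis using B(1) by (intro exI[of _ "real (card (T \<inter> {a..b})) * B"]) auto
qed

lemma mass_split:
  assumes "s \<le> r" "r \<le> t"
  shows "mass F s t = mass F s r + mass F r t"
proof -
  have "T \<inter> {s..<t} = T \<inter> {s..<r} \<union> T \<inter> {r..<t}" using assms by auto
  moreover have "(T \<inter> {s..<r}) \<inter> (T \<inter> {r..<t}) = {}" by auto
  ultimately show ?thesis unfolding mass_def by (simp only: sum.union_disjoint finite_T_intervals)
qed

definition J :: "(real \<Rightarrow> real) \<Rightarrow> real \<Rightarrow> real \<Rightarrow> real" where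
  "J F s t = energy F s t - mass F s t"

lemma J_refl [simp]: "J F s s = 0"
  by (simp add: J_def mass_def)

lemma J_split: "H1 F s t \<Longrightarrow> s \<le> r \<Longrightarrow> r \<le> t \<Longrightarrow> J F s t = J F s r + J F r t"
  using energy_split[of F s t r] mass_split[of s r t F] by (simp add: J_def)

lemma J_cong:
  assumes "\<And>r. s \<le> r \<Longrightarrow> r \<le> t \<Longrightarrow> F r = F' r"
  shows "J F s t = J F' s t"
  unfolding J_def mass_def using H1_cong(2)[of s t F F'] assms
  by (auto intro!: sum.cong)

lemma J_shift: "J (\<lambda>r. F r + of_int k) s t = J F s t"
  by (simp add: J_def mass_def w_period)

lemma J_glue:
  assumes "H1 F s r" "H1 F' r t" "F r = F' r" "s \<le> r" "r \<le> t"
  shows "J (glue r F F') s t = J F s r + J F' r t"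
  using J_split[OF glue_H1[OF assms] assms(4,5)] J_cong[of s r "glue r F F'" F]
    J_cong[of r t "glue r F F'" F'] assms(3)
  by (simp add: glue_def)

lemma J_lower: "\<exists>C\<ge>0. \<forall>F s t. a \<le> s \<longrightarrow> t \<le> b \<longrightarrow> - C \<le> J F s t"
proof -
  obtain C where "C \<ge> 0" "\<forall>F s t. a \<le> s \<longrightarrow> t \<le> b \<longrightarrow> mass F s t \<le> C"
    using mass_bounded by blast
  moreover have "- C \<le> J F s t" if "mass F s t \<le> C" for F s t
    using that energy_nonneg[of F s t] by (simp add: J_def)
  ultimately show ?thesis by blast
qed

definition geod :: "(real \<Rightarrow> real) \<Rightarrow> real \<Rightarrow> real \<Rightarrow> bool" where
  "geod F s t \<longleftrightarrow> H1 F s t \<and>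
     (\<forall>F'. H1 F' s t \<longrightarrow> F' s = F s \<longrightarrow> F' t = F t \<longrightarrow> J F s t \<le> J F' s t)"

lemma geod_H1: "geod F s t \<Longrightarrow> H1 F s t"
  by (simp add: geod_def)

lemma geod_sub:
  assumes g: "geod F s t" and "s \<le> s'" "s' \<le> t'" "t' \<le> t"
  shows "geod F s' t'"
  unfolding geod_def
proof (intro conjI allI impI)
  have H: "H1 F s t" using g by (rule geod_H1)
  show "H1 F s' t'" using H1_sub[OF H] assms by auto
  fix F' assume F': "H1 F' s' t'" "F' s' = F s'" "F' t' = F t'"
  define G where "G = glue s' F (glue t' F' F)"
  have H1s: "H1 F s s'" "H1 F s' t'" "H1 F t' t" "H1 F s' t" using H1_sub[OF H] assms by auto
  have h: "H1 (glue t' F' F) s' t" using F' H1s assms by (intro glue_H1) auto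
  have "H1 G s t" unfolding G_def using F' H1s h assms by (intro glue_H1) (auto simp: glue_def)
  moreover have "G s = F s" "G t = F t" using assms F' by (auto simp: G_def glue_def)
  ultimately have "J F s t \<le> J G s t" using g unfolding geod_def by blast
  moreover have "J G s t = J F s s' + (J F' s' t' + J F t' t)"
    unfolding G_def using F' H1s h assms by (subst J_glue) (auto simp: J_glue, auto simp: glue_def)
  moreover have "J F s t = J F s s' + (J F s' t' + J F t' t)"
    using J_split[OF H, of s'] J_split[OF H1s(4), of t'] assms by auto
  ultimately show "J F s' t' \<le> J F' s' t'" by linarith
qed

lemma mass_no_visits:
  assumes "r < t" "\<forall>q\<in>T. r < q \<and> q < t \<longrightarrow> w q (F q) = 0"
  shows "mass F r t = w r (F r)"
proof (cases "r \<in> T")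
  case True
  then have "T \<inter> {r..<t} = insert r (T \<inter> {r<..<t})" using assms(1) by auto
  then show ?thesis unfolding mass_def using assms(2) by (auto intro!: sum.neutral)
next
  case False
  then show ?thesis unfolding mass_def
    using assms by (auto simp: notin_T intro!: sum.neutral) (metis le_less)
qed

lemma mass_ge_start:
  assumes "r < t"
  shows "w r (F r) \<le> mass F r t"
proof (cases "r \<in> T")
  case True
  then have "r \<in> T \<inter> {r..<t}" using assms(1) by auto
  then show ?thesis unfolding mass_def
    using member_le_sum[of r "T \<inter> {r..<t}" "\<lambda>r. w r (F r)"] by (auto simp: w_nonneg)
qed (use mass_nonneg in \<open>auto simp: notin_T\<close>)

lemma mass_ge_start_visit:
  assumes "r < q" "q < t"
  shows "w r (F r) + w q (F q) \<le> mass F r t"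
  using mass_split[of r q t F] mass_ge_start[of r q F] mass_ge_start[of q t F] assms by auto

text \<open>
  Replacing a piece without visits by its chord keeps the weight collected at the initial
  point and can only gain weight in between, so the equality case of Jensen's inequality
  applies.
\<close>

lemma geod_linear:
  assumes g: "geod F s t" and r: "s \<le> r1" "r1 < r2" "r2 \<le> t"
    and nv: "\<forall>q\<in>T. r1 < q \<and> q < r2 \<longrightarrow> w q (F q) = 0"
    and q: "r1 \<le> q" "q \<le> r2"
  shows "F q = chord r1 (F r1) r2 (F r2) q"
proof -
  have g': "geod F r1 r2" using geod_sub[OF g] r by auto
  let ?l = "chord r1 (F r1) r2 (F r2)"
  have "J F r1 r2 \<le> J ?l r1 r2"
    using g' chord_H1[OF r(2)] chord_end[OF r(2)] unfolding geod_def by auto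
  moreover have "w r1 (F r1) \<le> mass ?l r1 r2" using mass_ge_start[OF r(2), of ?l] by simp
  ultimately have "energy F r1 r2 \<le> (F r2 - F r1)\<^sup>2 / (2 * (r2 - r1))"
    using mass_no_visits[OF r(2) nv] chord_H1(2)[OF r(2), of "F r1" "F r2"] by (simp add: J_def)
  from energy_eq_chord_imp_linear[OF geod_H1[OF g'] r(2) this q]
  show ?thesis by (simp add: chord_def)
qed

end

text \<open>
  All paths start from the fixed point (s0, Y0).
\<close>

locale based_env = env +
  fixes s0 Y0 :: real
begin

definition path_to :: "(real \<Rightarrow> real) \<Rightarrow> real \<Rightarrow> real \<Rightarrow> bool" where
  "path_to F t z \<longleftrightarrow> H1 F s0 t \<and> F s0 = Y0 \<and> F t = z"

text \<open>
  The value function: the least action of a path from (s0, Y0) to (t, z).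
\<close>

definition A :: "real \<Rightarrow> real \<Rightarrow> real" where
  "A t z = (INF F\<in>{F. path_to F t z}. J F s0 t)"

definition fixed_min :: "real \<Rightarrow> real \<Rightarrow> (real \<Rightarrow> real) set" where
  "fixed_min t z = {F. path_to F t z \<and> (\<forall>F'. path_to F' t z \<longrightarrow> J F s0 t \<le> J F' s0 t)}"

lemma fixed_min_A: "F \<in> fixed_min t z \<Longrightarrow> J F s0 t = A t z"
proof -
  assume F: "F \<in> fixed_min t z"
  have "Inf ((\<lambda>F. J F s0 t) ` {F. path_to F t z}) = J F s0 t"
    by (rule cInf_eq_minimum) (use F in \<open>auto simp: fixed_min_def\<close>)
  then show ?thesis unfolding A_def by simp
qed

lemma A_le: "path_to F t z \<Longrightarrow> A t z \<le> J F s0 t"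
proof -
  assume F: "path_to F t z"
  obtain C where "\<forall>F s t'. s0 \<le> s \<longrightarrow> t' \<le> t \<longrightarrow> - C \<le> J F s t'" using J_lower by blast
  then have "bdd_below ((\<lambda>F. J F s0 t) ` {F. path_to F t z})" by (intro bdd_belowI[of _ "- C"]) auto
  then show ?thesis unfolding A_def using F by (intro cInf_lower) auto
qed

lemma fixed_min_iff:
  assumes "fixed_min t z \<noteq> {}"
  shows "F \<in> fixed_min t z \<longleftrightarrow> path_to F t z \<and> J F s0 t \<le> A t z"
proof
  assume F: "F \<in> fixed_min t z"
  then show "path_to F t z \<and> J F s0 t \<le> A t z" using fixed_min_A[OF F] by (simp add: fixed_min_def)
next
  assume F: "path_to F t z \<and> J F s0 t \<le> A t z"
  then show "F \<in> fixed_min t z" unfolding fixed_min_def using A_le[of _ t z] by fastforce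
qed

lemma fixed_min_start: "fixed_min s0 Y0 \<noteq> {}"
proof -
  have "(\<lambda>_. Y0) \<in> fixed_min s0 Y0" unfolding fixed_min_def path_to_def by simp
  then show ?thesis by blast
qed

text \<open>
  An optimal path is straight after the last point that it visits. These are the candidates
  for that point, and a candidate p contributes \<open>parabola p t\<close> to the value
  function.
\<close>

definition corners :: "real \<Rightarrow> (real \<times> real) set" where
  "corners t = insert (s0, Y0) {(r, y). s0 < r \<and> r < t \<and> w r y > 0}"

definition parabola :: "real \<times> real \<Rightarrow> real \<Rightarrow> real \<Rightarrow> real" where
  "parabola p t z = A (fst p) (snd p) - w (fst p) (snd p) + (z - snd p)\<^sup>2 / (2 * (t - fst p))"

lemma corners_time: "s0 < t \<Longrightarrow> (r, y) \<in> corners t \<Longrightarrow> s0 \<le> r \<and> r < t"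
  by (auto simp: corners_def)

lemma last_visit:
  assumes "s0 < t" "F s0 = Y0"
  obtains r where "s0 \<le> r" "r < t" "(r, F r) \<in> corners t"
    "\<forall>q\<in>T. r < q \<and> q < t \<longrightarrow> w q (F q) = 0"
proof -
  let ?V = "{q \<in> T \<inter> {s0<..<t}. w q (F q) > 0}"
  show ?thesis
  proof (cases "?V = {}")
    case True
    have "w q (F q) = 0" if "q \<in> T" "s0 < q" "q < t" for q
    proof (rule ccontr)
      assume "w q (F q) \<noteq> 0"
      then have "q \<in> ?V" using that w_nonneg[of q "F q"] by auto
      then show False using True by blast
    qed
    then show ?thesis using assms by (intro that[of s0]) (auto simp: corners_def)
  next
    case False
    have fin: "finite ?V" by (rule finite_subset[OF _ finite_T_intervals(2)[of s0 t]]) auto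
    define r where "r = Max ?V"
    have r: "r \<in> ?V" unfolding r_def using Max_in[OF fin False] .
    have "w q (F q) = 0" if "q \<in> T" "r < q" "q < t" for q
    proof (rule ccontr)
      assume "w q (F q) \<noteq> 0"
      then have "q \<in> ?V" using that r w_nonneg[of q "F q"] by auto
      then have "q \<le> r" unfolding r_def using Max_ge[OF fin] by auto
      then show False using that by auto
    qed
    then show ?thesis using r by (intro that[of r]) (auto simp: corners_def)
  qed
qed

lemma last_visit_ex:
  assumes "s0 < t" "F s0 = Y0"
  shows "\<exists>r. s0 \<le> r \<and> r < t \<and> (r, F r) \<in> corners t \<and> (\<forall>q\<in>T. r < q \<and> q < t \<longrightarrow> w q (F q) = 0)"
  by (rule last_visit[of t F, OF assms]) blast

lemma J_ge_parabola:
  assumes F: "path_to F t z" and r: "s0 \<le> r" "r < t"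
    and nv: "\<forall>q\<in>T. r < q \<and> q < t \<longrightarrow> w q (F q) = 0"
  shows "J F s0 t = parabola (r, F r) t z + (J F s0 r - A r (F r)) +
    (energy F r t - (z - F r)\<^sup>2 / (2 * (t - r)))"
    and "J F s0 r - A r (F r) \<ge> 0" and "energy F r t - (z - F r)\<^sup>2 / (2 * (t - r)) \<ge> 0"
proof -
  have H: "H1 F s0 t" and e: "F s0 = Y0" "F t = z" using F by (auto simp: path_to_def)
  show "J F s0 t = parabola (r, F r) t z + (J F s0 r - A r (F r)) +
    (energy F r t - (z - F r)\<^sup>2 / (2 * (t - r)))"
    using J_split[OF H, of r] r mass_no_visits[OF r(2) nv] by (simp add: J_def parabola_def)
  have "path_to F r (F r)" using H1_sub[OF H] r e by (auto simp: path_to_def)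
  from A_le[OF this] show "J F s0 r - A r (F r) \<ge> 0" by simp
  show "energy F r t - (z - F r)\<^sup>2 / (2 * (t - r)) \<ge> 0"
    using energy_ge_chord[OF H1_sub[OF H] r(2)] r e by auto
qed

lemma path_to_glue_chord:
  assumes "path_to F r y" "s0 \<le> r" "r < t"
  shows "path_to (glue r F (chord r y t z)) t z"
    and "J (glue r F (chord r y t z)) s0 t =
      J F s0 r + (z - y)\<^sup>2 / (2 * (t - r)) - mass (chord r y t z) r t"
proof -
  show "path_to (glue r F (chord r y t z)) t z"
    using assms chord_H1(1)[OF assms(3)] unfolding path_to_def
    by (auto intro!: glue_H1) (auto simp: glue_def chord_end)
  show "J (glue r F (chord r y t z)) s0 t =
      J F s0 r + (z - y)\<^sup>2 / (2 * (t - r)) - mass (chord r y t z) r t"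
    using assms chord_H1[OF assms(3)] unfolding path_to_def
    by (subst J_glue) (auto simp: J_def)
qed

text \<open>
  Coercivity: far away corners have high parabolas over a bounded interval, because the value
  function is bounded below and the atoms are locally finite.
\<close>

lemma finite_low:
  assumes ne: "\<And>p. p \<in> corners t \<Longrightarrow> fixed_min (fst p) (snd p) \<noteq> {}" and t: "s0 < t"
  shows "finite {p \<in> corners t. \<exists>z\<in>{c..d}. parabola p t z \<le> K}" (is "finite ?S")
proof -
  obtain C where C: "C \<ge> 0" "\<And>F s t'. s0 \<le> s \<Longrightarrow> t' \<le> t \<Longrightarrow> - C \<le> J F s t'" using J_lower by blast
  obtain B where B: "B \<ge> 0" "\<And>r y. s0 \<le> r \<Longrightarrow> r \<le> t \<Longrightarrow> w r y \<le> B"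
    using w_bounded[of s0 t] by auto
  define R where "R = 2 * (t - s0) * \<bar>K + C + B\<bar>"
  have "?S \<subseteq> insert (s0, Y0) {(r, y). r \<in> {s0..t} \<and> y \<in> {c - (R + 1)..d + (R + 1)} \<and> w r y > 0}"
  proof
    fix p assume p: "p \<in> ?S"
    obtain r y where ry: "p = (r, y)" by (cases p)
    obtain z where z: "z \<in> {c..d}" "parabola p t z \<le> K" using p by blast
    show "p \<in> insert (s0, Y0) {(r, y). r \<in> {s0..t} \<and> y \<in> {c - (R + 1)..d + (R + 1)} \<and> w r y > 0}"
    proof (cases "p = (s0, Y0)")
      case False
      have r: "s0 < r" "r < t" "w r y > 0" using p False by (auto simp: corners_def ry)
      obtain F where "F \<in> fixed_min r y" using ne[of p] p by (auto simp: ry)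
      then have "A r y \<ge> - C" using fixed_min_A C(2)[of s0 r F] r by fastforce
      moreover have "w r y \<le> B" using B(2) r by simp
      moreover have "A r y - w r y + (z - y)\<^sup>2 / (2 * (t - r)) \<le> K"
        using z(2) by (simp add: parabola_def ry)
      ultimately have "(z - y)\<^sup>2 / (2 * (t - r)) \<le> \<bar>K + C + B\<bar>" by linarith
      then have "(z - y)\<^sup>2 \<le> 2 * (t - r) * \<bar>K + C + B\<bar>"
        using r by (simp add: pos_divide_le_eq mult.commute)
      also have "\<dots> \<le> R" unfolding R_def using r by (intro mult_right_mono) auto
      finally have "\<bar>z - y\<bar> \<le> R + 1" using abs_le_square_plus_one[of "z - y"] by linarith
      then have "c - (R + 1) \<le> y" "y \<le> d + (R + 1)" using z(1) by auto
      then show ?thesis using r by (simp add: ry)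
    qed simp
  qed
  then show ?thesis by (rule finite_subset) (intro finite.insertI w_locfin)
qed

text \<open>
  Induction on the number of atom times before t: an arbitrary path does not beat the parabola
  of its last visited point, whose value is attained by induction, and by coercivity finitely
  many parabolas compete.
\<close>

lemma minimizer_exists:
  assumes "s0 < t"
  shows "fixed_min t z \<noteq> {} \<and> (\<forall>p\<in>corners t. fixed_min (fst p) (snd p) \<noteq> {})"
  using assms
proof (induction "card (T \<inter> {s0<..<t})" arbitrary: t z rule: less_induct)
  case less
  have ne: "fixed_min (fst p) (snd p) \<noteq> {}" if p: "p \<in> corners t" for p
  proof (cases "p = (s0, Y0)")
    case False
    obtain r y where ry: "p = (r, y)" by (cases p)
    have r: "s0 < r" "r < t" "w r y > 0" using p False by (auto simp: corners_def ry)
    then have rT: "r \<in> T" by (auto simp: T_def)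
    have "T \<inter> {s0<..<r} \<subset> T \<inter> {s0<..<t}" using r rT by auto
    then have "card (T \<inter> {s0<..<r}) < card (T \<inter> {s0<..<t})" by (intro psubset_card_mono) auto
    from less(1)[OF this r(1)] show ?thesis by (simp add: ry)
  qed (simp add: fixed_min_start)
  define K where "K = parabola (s0, Y0) t z"
  let ?S = "{p \<in> corners t. parabola p t z \<le> K}"
  have fin: "finite ?S" using finite_low[of t z z K, OF ne] less(2) by simp
  have "(s0, Y0) \<in> ?S" by (simp add: corners_def K_def)
  then have "?S \<noteq> {}" by blast
  then obtain p0 where p0: "p0 \<in> ?S" "\<And>p. p \<in> ?S \<Longrightarrow> parabola p0 t z \<le> parabola p t z"
    using ex_is_arg_min_if_finite[OF fin, of "\<lambda>p. parabola p t z"] unfolding is_arg_min_linorder by blast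
  have min: "parabola p0 t z \<le> parabola p t z" if "p \<in> corners t" for p
    using p0 that by (cases "parabola p t z \<le> K") auto
  obtain r y where ry: "p0 = (r, y)" by (cases p0)
  have p0P: "(r, y) \<in> corners t" using p0 ry by auto
  have r: "s0 \<le> r" "r < t" using corners_time[OF less(2) p0P] by auto
  obtain F where F: "F \<in> fixed_min r y" using ne[OF p0P] by auto
  then have Fp: "path_to F r y" by (simp add: fixed_min_def)
  define G where "G = glue r F (chord r y t z)"
  have G: "path_to G t z" "J G s0 t \<le> parabola p0 t z"
    using path_to_glue_chord[OF Fp r, of z] fixed_min_A[OF F] mass_ge_start[OF r(2), of "chord r y t z"]
    by (auto simp: G_def parabola_def ry)
  have "J G s0 t \<le> J F' s0 t" if F': "path_to F' t z" for F'
  proof -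
    have "F' s0 = Y0" using F' by (simp add: path_to_def)
    then obtain q where q: "s0 \<le> q" "q < t" "(q, F' q) \<in> corners t"
      "\<forall>u\<in>T. q < u \<and> u < t \<longrightarrow> w u (F' u) = 0" using last_visit_ex[of t F', OF less(2)] by blast
    show ?thesis using G(2) min[OF q(3)] J_ge_parabola[OF F' q(1,2,4)] by linarith
  qed
  then have "G \<in> fixed_min t z" using G by (simp add: fixed_min_def)
  then show ?case using ne by blast
qed

lemma fixed_min_nonempty: "s0 < t \<Longrightarrow> fixed_min t z \<noteq> {}"
  using minimizer_exists by blast

lemma corners_fixed_min_nonempty: "s0 < t \<Longrightarrow> (r, y) \<in> corners t \<Longrightarrow> fixed_min r y \<noteq> {}"
  using minimizer_exists by fastforce

text \<open>
  The corners whose parabola realizes the value function at (t, z).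
\<close>

definition active :: "real \<Rightarrow> real \<Rightarrow> real \<times> real \<Rightarrow> bool" where
  "active t z p \<longleftrightarrow> p \<in> corners t \<and> parabola p t z = A t z"

lemma A_le_parabola:
  assumes t: "s0 < t" and p: "(r, y) \<in> corners t"
  shows "A t z \<le> parabola (r, y) t z" 
    and "F \<in> fixed_min r y \<Longrightarrow> r < q \<Longrightarrow> q < t \<Longrightarrow> A t z + w q (chord r y t z q) \<le> parabola (r, y) t z"
    and "F \<in> fixed_min r y \<Longrightarrow> active t z (r, y) \<Longrightarrow> glue r F (chord r y t z) \<in> fixed_min t z"
proof -
  have r: "s0 \<le> r" "r < t" using corners_time[OF t p] by auto
  have *: "A t z + (mass (chord r y t z) r t - w r y) \<le> parabola (r, y) t z"
    "path_to (glue r F (chord r y t z)) t z" 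
    "J (glue r F (chord r y t z)) s0 t \<le> parabola (r, y) t z" if F: "F \<in> fixed_min r y" for F
  proof -
    have Fp: "path_to F r y" using F by (simp add: fixed_min_def)
    note G = path_to_glue_chord[OF Fp r, of z]
    show "A t z + (mass (chord r y t z) r t - w r y) \<le> parabola (r, y) t z"
      using A_le[OF G(1)] G(2) fixed_min_A[OF F] by (simp add: parabola_def)
    show "path_to (glue r F (chord r y t z)) t z" by fact
    show "J (glue r F (chord r y t z)) s0 t \<le> parabola (r, y) t z"
      using G(2) fixed_min_A[OF F] mass_ge_start[OF r(2), of "chord r y t z"] by (simp add: parabola_def)
  qed
  obtain F0 where "F0 \<in> fixed_min r y" using corners_fixed_min_nonempty[OF t p] by blast
  from *(1)[OF this] show "A t z \<le> parabola (r, y) t z" 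
    using mass_ge_start[OF r(2), of "chord r y t z"] by simp
  show "A t z + w q (chord r y t z q) \<le> parabola (r, y) t z" if "F \<in> fixed_min r y" "r < q" "q < t"
    using *(1)[OF that(1)] mass_ge_start_visit[OF that(2,3), of "chord r y t z"] by simp
  show "glue r F (chord r y t z) \<in> fixed_min t z" if "F \<in> fixed_min r y" "active t z (r, y)"
    using *(2,3)[OF that(1)] that(2) fixed_min_iff[OF fixed_min_nonempty[OF t]] by (simp add: active_def)
qed

text \<open>
  A weight on the way from the last corner would lower the action further.
\<close>

lemma active_no_visits:
  assumes t: "s0 < t" and a: "active t z (r, y)" and q: "r < q" "q < t"
  shows "w q (chord r y t z q) = 0"
proof -
  have p: "(r, y) \<in> corners t" using a by (simp add: active_def)
  obtain F where F: "F \<in> fixed_min r y" using corners_fixed_min_nonempty[OF t p] by blast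
  show ?thesis using A_le_parabola(2)[OF t p F q, of z] a w_nonneg[of q "chord r y t z q"]
    by (simp add: active_def)
qed

lemma fixed_min_last:
  assumes t: "s0 < t" and F: "F \<in> fixed_min t z"
  obtains r where "s0 \<le> r" "r < t" "active t z (r, F r)" "F \<in> fixed_min r (F r)"
    "\<And>q. r \<le> q \<Longrightarrow> q \<le> t \<Longrightarrow> F q = chord r (F r) t z q"
proof -
  have Fp: "path_to F t z" using F by (simp add: fixed_min_def)
  then have e: "F s0 = Y0" "F t = z" "H1 F s0 t" by (auto simp: path_to_def)
  obtain r where r: "s0 \<le> r" "r < t" "(r, F r) \<in> corners t"
    and nv: "\<forall>q\<in>T. r < q \<and> q < t \<longrightarrow> w q (F q) = 0" using last_visit_ex[of t F, OF t e(1)] by blast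
  note * = J_ge_parabola[OF Fp r(1,2) nv] fixed_min_A[OF F] A_le_parabola(1)[OF t r(3), of z]
  have "parabola (r, F r) t z = A t z" using * by linarith
  then have 1: "active t z (r, F r)" using r(3) unfolding active_def by blast
  have "J F s0 r \<le> A r (F r)" using * by linarith
  moreover have "path_to F r (F r)"
    using H1_sub[OF e(3), of s0 r] e(1) r(2) unfolding path_to_def by simp
  ultimately have 2: "F \<in> fixed_min r (F r)"
    using fixed_min_iff[OF corners_fixed_min_nonempty[OF t r(3)], of F] by blast
  have "energy F r t \<le> (z - F r)\<^sup>2 / (2 * (t - r))" using * by linarith
  then have le: "energy F r t \<le> (F t - F r)\<^sup>2 / (2 * (t - r))" by (simp only: e(2))
  have Hr: "H1 F r t" using H1_sub[OF e(3), of r t] r(1) by simp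
  have 3: "F q = chord r (F r) t z q" if q: "r \<le> q" "q \<le> t" for q
    using energy_eq_chord_imp_linear[OF Hr r(2) le q] by (simp only: chord_def e(2))
  show ?thesis by (rule that[OF r(1,2) 1 2 3])
qed

lemma active_exists:
  assumes "s0 < t" shows "\<exists>p. active t z p"
proof -
  obtain F where F: "F \<in> fixed_min t z" using fixed_min_nonempty[OF assms] by blast
  show ?thesis by (rule fixed_min_last[OF assms F]) blast
qed

end

section \<open>One-sided behaviour of the value function\<close>

context based_env begin

definition slope :: "real \<Rightarrow> real \<Rightarrow> real \<times> real \<Rightarrow> real" where
  "slope t z p = (z - snd p) / (t - fst p)"

lemma parabola_deriv:
  assumes "fst p < t"
  shows "((\<lambda>u. parabola p t u) has_real_derivative slope t z p) (at z)"
proof -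
  have "((\<lambda>u. (u - snd p)\<^sup>2) has_real_derivative (2 * (z - snd p))) (at z)"
    by (auto intro!: derivative_eq_intros)
  from DERIV_cdivide[OF this, of "2 * (t - fst p)"]
  have "((\<lambda>u. (u - snd p)\<^sup>2 / (2 * (t - fst p))) has_real_derivative slope t z p) (at z)"
    unfolding slope_def by (simp only: mult_divide_mult_cancel_left[OF zero_neq_numeral[symmetric]])
  from DERIV_add[OF DERIV_const[of "A (fst p) (snd p) - w (fst p) (snd p)"] this]
  show ?thesis unfolding parabola_def by simp
qed

lemma corners_int_shift: "(r, y) \<in> corners t \<Longrightarrow> r \<noteq> s0 \<Longrightarrow> (r, y + of_int k) \<in> corners t"
  by (auto simp: corners_def w_period)

text \<open>
  Two corners seen from the end point under the same slope lie on a common line, and an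
  optimal path through the earlier one would collect the later one on its way.
\<close>

lemma same_slope_aux:
  assumes t: "s0 < t" and a: "active t z p" "active t (z + of_int k) p'"
    and slope: "slope t z p = slope t (z + of_int k) p'"
  shows "\<not> fst p < fst p'"
proof
  assume lt: "fst p < fst p'"
  obtain r y r' y' where p: "p = (r, y)" "p' = (r', y')" by (cases p, cases p')
  have corners: "(r, y) \<in> corners t" "(r', y') \<in> corners t" using a by (auto simp: active_def p)
  have r: "s0 \<le> r" "r < r'" "r' < t" using corners_time[OF t corners(1)] corners_time[OF t corners(2)] lt by (auto simp: p)
  have w': "w r' y' > 0" using corners(2) r by (auto simp: corners_def)
  have "chord r y t z r' = y' - of_int k"
  proof -
    have *: "(z - y) / (t - r) = (z + of_int k - y') / (t - r')" using slope by (simp add: slope_def p)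
    have "m * (r' - r) = m * (t - r) - m * (t - r')" for m by (simp add: algebra_simps)
    then have "(z - y) / (t - r) * (r' - r) = (z - y) / (t - r) * (t - r) - (z - y) / (t - r) * (t - r')" .
    also have "(z - y) / (t - r) * (t - r) = z - y" using r by simp
    also have "(z - y) / (t - r) * (t - r') = z + of_int k - y'" unfolding * using r by simp
    finally show ?thesis by (simp add: chord_def)
  qed
  then have "w r' (y' - of_int k) = 0" using active_no_visits[OF t, of z r y r'] a(1) r by (simp add: p)
  then show False using w' w_period[of r' y' "- k"] by simp
qed

lemma same_slope:
  assumes t: "s0 < t" and a: "active t z p" "active t (z + of_int k) p'"
    and slope: "slope t z p = slope t (z + of_int k) p'"
  shows "fst p' = fst p" and "snd p' = snd p + of_int k"
proof -
  have "\<not> fst p < fst p'" by (rule same_slope_aux[OF t a slope])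
  moreover have "\<not> fst p' < fst p"
    by (rule same_slope_aux[OF t a(2), of "- k"]) (use a slope in auto)
  ultimately show e: "fst p' = fst p" by simp
  obtain r y where p: "p = (r, y)" by (cases p)
  have "(r, y) \<in> corners t" using a by (auto simp: active_def p)
  then have "r < t" using corners_time[OF t] by blast
  then show "snd p' = snd p + of_int k" using slope e by (simp add: slope_def p field_simps)
qed

lemma same_slope_time:
  assumes t: "s0 < t" and a: "active t z p" "active t (z + of_int k) p'"
    and slope: "slope t z p = slope t (z + of_int k) p'" and "k \<noteq> 0"
  shows "s0 < fst p" and "w (fst p) (snd p) > 0"
proof -
  obtain r y where p: "p = (r, y)" by (cases p)
  have corners: "(r, y) \<in> corners t" "(r, y + of_int k) \<in> corners t"
    using a same_slope[OF t a slope] by (auto simp: active_def p) (metis prod.collapse)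
  then show "s0 < fst p" "w (fst p) (snd p) > 0" using \<open>k \<noteq> 0\<close> by (auto simp: corners_def p)
qed

text \<open>
  The steepest active parabola governs the value function to the left of z, the flattest one
  to the right.
\<close>

definition left_active :: "real \<Rightarrow> real \<Rightarrow> real \<times> real \<Rightarrow> bool" where
  "left_active t z p \<longleftrightarrow> active t z p \<and> (\<forall>p'. active t z p' \<longrightarrow> slope t z p' \<le> slope t z p)"

definition right_active :: "real \<Rightarrow> real \<Rightarrow> real \<times> real \<Rightarrow> bool" where
  "right_active t z p \<longleftrightarrow> active t z p \<and> (\<forall>p'. active t z p' \<longrightarrow> slope t z p \<le> slope t z p')"

lemma active_unique_slope:
  assumes "s0 < t" "active t z p" "active t z p'" "slope t z p = slope t z p'"
  shows "p = p'"
  using same_slope[OF assms(1,2), of 0 p'] assms(3,4) by (simp add: prod_eq_iff)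

lemma left_active_unique: "s0 < t \<Longrightarrow> left_active t z p \<Longrightarrow> left_active t z p' \<Longrightarrow> p = p'"
  unfolding left_active_def by (meson active_unique_slope antisym)

lemma finite_active: "s0 < t \<Longrightarrow> finite {p. \<exists>z\<in>{c..d}. active t z p}"
proof -
  assume t: "s0 < t"
  define K where "K = A s0 Y0 + ((\<bar>c\<bar> + \<bar>d\<bar> + \<bar>Y0\<bar>)\<^sup>2) / (2 * (t - s0))"
  have "parabola p t z \<le> K" if z: "z \<in> {c..d}" and a: "active t z p" for z p
  proof -
    have "(s0, Y0) \<in> corners t" by (simp add: corners_def)
    from A_le_parabola(1)[OF t this, of z] have "A t z \<le> parabola (s0, Y0) t z" .
    also have "\<dots> \<le> A s0 Y0 + (z - Y0)\<^sup>2 / (2 * (t - s0))" by (simp add: parabola_def w_nonneg)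
    also have "\<dots> \<le> K"
    proof -
      have "\<bar>z - Y0\<bar> \<le> \<bar>c\<bar> + \<bar>d\<bar> + \<bar>Y0\<bar>" using z by auto
      then have "(z - Y0)\<^sup>2 \<le> (\<bar>c\<bar> + \<bar>d\<bar> + \<bar>Y0\<bar>)\<^sup>2"
        by (metis abs_ge_zero power2_abs power_mono)
      then show ?thesis unfolding K_def using t by (intro add_left_mono divide_right_mono) auto
    qed
    finally show ?thesis using a by (simp add: active_def)
  qed
  then have "{p. \<exists>z\<in>{c..d}. active t z p} \<subseteq> {p \<in> corners t. \<exists>z\<in>{c..d}. parabola p t z \<le> K}"
    unfolding active_def by blast
  moreover have "finite {p \<in> corners t. \<exists>z\<in>{c..d}. parabola p t z \<le> K}"
    by (rule finite_low[OF _ t]) (metis corners_fixed_min_nonempty[OF t] prod.collapse)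
  ultimately show ?thesis by (rule finite_subset)
qed

lemma left_active_exists:
  assumes t: "s0 < t" shows "\<exists>p. left_active t z p"
proof -
  let ?S = "{p. active t z p}"
  have "?S \<subseteq> {p. \<exists>z\<in>{z..z}. active t z p}" by auto
  then have fin: "finite ?S" by (rule finite_subset) (rule finite_active[OF t])
  have "?S \<noteq> {}" using active_exists[OF t] by auto
  then obtain p where p: "p \<in> ?S" "\<And>p'. p' \<in> ?S \<Longrightarrow> - slope t z p \<le> - slope t z p'"
    using ex_is_arg_min_if_finite[OF fin, of "\<lambda>p. - slope t z p"] unfolding is_arg_min_linorder by blast
  then have "left_active t z p" by (simp add: left_active_def)
  then show ?thesis by blast
qed

lemma left_active_le_right_active: "left_active t z p \<Longrightarrow> right_active t z q \<Longrightarrow> slope t z q \<le> slope t z p"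
  unfolding left_active_def right_active_def by blast

text \<open>
  Among parabolas that agree at z, a steeper one is lower just to the left of z; the inactive
  ones stay above by continuity.
\<close>

lemma left_active_local:
  assumes t: "s0 < t" and p: "left_active t z p"
  shows "\<exists>\<epsilon>>0. \<forall>u. z - \<epsilon> \<le> u \<longrightarrow> u \<le> z \<longrightarrow> active t u p"
proof -
  let ?S = "{q. \<exists>u\<in>{z-1..z}. active t u q}"
  have fin: "finite ?S" by (rule finite_active[OF t])
  have time: "fst q < t" if "q \<in> corners t" for q using corners_time[OF t, of "fst q" "snd q"] that by simp
  have ap: "active t z p" using p by (simp add: left_active_def)
  then have pP: "p \<in> corners t" by (simp add: active_def)
  have ev: "\<forall>\<^sub>F u in at_left z. parabola p t u \<le> parabola q t u" if q: "q \<in> ?S" for q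
  proof -
    have qP: "q \<in> corners t" using q by (auto simp: active_def)
    define f where "f u = parabola p t u - parabola q t u" for u
    have df: "(f has_real_derivative (slope t z p - slope t z q)) (at z)"
      unfolding f_def using parabola_deriv[OF time[OF pP]] parabola_deriv[OF time[OF qP]] by (rule DERIV_diff)
    have le: "parabola p t z \<le> parabola q t z"
      using A_le_parabola(1)[OF t, of "fst q" "snd q" z] qP ap by (simp add: active_def)
    consider "parabola p t z < parabola q t z" | "p = q" | "parabola p t z = parabola q t z" "p \<noteq> q" using le by fastforce
    then have "\<forall>\<^sub>F u in at_left z. f u \<le> 0"
    proof cases
      case 1
      have "(f \<longlongrightarrow> f z) (at z)" using DERIV_isCont[OF df] by (simp add: isCont_def)
      then have "(f \<longlongrightarrow> f z) (at_left z)" by (rule filterlim_mono) (auto simp: at_within_le_at)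
      moreover have "f z < 0" using 1 by (simp add: f_def)
      ultimately have "\<forall>\<^sub>F u in at_left z. f u < 0" by (rule order_tendstoD(2))
      then show ?thesis by eventually_elim simp
    next
      case 2 then show ?thesis by (simp add: f_def)
    next
      case 3
      have aq: "active t z q" using 3 ap qP by (simp add: active_def)
      then have "slope t z q \<le> slope t z p" using p unfolding left_active_def by blast
      moreover have "slope t z q \<noteq> slope t z p" using active_unique_slope[OF t ap aq] 3(2) by auto
      ultimately have "0 < slope t z p - slope t z q" by simp
      from DERIV_pos_inc_left[OF df this] obtain d where
        d: "d > 0" "\<And>h. 0 < h \<Longrightarrow> h < d \<Longrightarrow> f (z - h) < f z" by blast
      have "f u \<le> 0" if "z - d < u" "u < z" for u
        using d(2)[of "z - u"] that 3(1) by (simp add: f_def)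
      then show ?thesis unfolding eventually_at_left_field using d(1)
        by (intro exI[of _ "z - d"]) auto
    qed
    then show ?thesis by eventually_elim (simp add: f_def)
  qed
  have "\<forall>\<^sub>F u in at_left z. \<forall>q\<in>?S. parabola p t u \<le> parabola q t u"
    by (rule eventually_ball_finite[OF fin]) (use ev in blast)
  then obtain b where b: "b < z" "\<And>u. b < u \<Longrightarrow> u < z \<Longrightarrow> \<forall>q\<in>?S. parabola p t u \<le> parabola q t u"
    unfolding eventually_at_left_field by blast
  define e where "e = min 1 ((z - b) / 2)"
  have e: "e > 0" "e \<le> 1" "b < z - e" using b(1) by (auto simp: e_def min_def field_simps)
  have "active t u p" if u: "z - e \<le> u" "u \<le> z" for u
  proof (cases "u = z")
    case False
    obtain q where q: "active t u q" using active_exists[OF t] by blast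
    have "q \<in> ?S" using q u e by auto
    moreover have "b < u" "u < z" using u e False by auto
    ultimately have "parabola p t u \<le> parabola q t u" using b(2) by blast
    moreover have "A t u \<le> parabola p t u" using A_le_parabola(1)[OF t, of "fst p" "snd p" u] pP by simp
    ultimately show ?thesis using q pP by (simp add: active_def)
  qed (use ap in simp)
  then show ?thesis using e(1) by blast
qed

section \<open>The winding cost and its generalized inverses\<close>

text \<open>
  The cost, at tilt 0, of winding once more around the circle. Winding once more is profitable
  at tilt \<open>\<theta>\<close> exactly if it costs less than \<open>\<theta>\<close>.
\<close>

definition G :: "real \<Rightarrow> real \<Rightarrow> real" where
  "G t v = A t (v + 1) - A t v"

text \<open>
  The left and right generalized inverses of the nondecreasing winding cost. They turn out to
  be lifts of the left and the right global shock.
\<close>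

definition a :: "real \<Rightarrow> real \<Rightarrow> real" where "a t \<theta> = Inf {v. \<theta> \<le> G t v}"

definition b :: "real \<Rightarrow> real \<Rightarrow> real" where "b t \<theta> = Sup {v. G t v \<le> \<theta>}"

text \<open>
  Paths do not cross: an optimal path to \<open>v' + 1\<close>, shifted by -1, starts below
  and ends above an optimal path to v. Exchanging the two at a crossing yields competitors for
  \<open>v'\<close> and v + 1 of the same total action.
\<close>

lemma G_mono:
  assumes t: "s0 < t" and "v \<le> v'"
  shows "G t v \<le> G t v'"
proof (cases "v = v'")
  case False
  with assms have lt: "v < v'" by simp
  obtain F where F: "F \<in> fixed_min t (v' + 1)" using fixed_min_nonempty[OF t] by blast
  obtain F' where F': "F' \<in> fixed_min t v" using fixed_min_nonempty[OF t] by blast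
  have p: "path_to F t (v' + 1)" "path_to F' t v" using F F' by (auto simp: fixed_min_def)
  then have H: "H1 F s0 t" "H1 F' s0 t" and e: "F s0 = Y0" "F' s0 = Y0" "F t = v' + 1" "F' t = v"
    by (auto simp: path_to_def)
  have "continuous_on {s0..t} (\<lambda>q. F q - 1 - F' q)"
    using H by (intro continuous_intros H1_continuous)
  then have "\<exists>r\<ge>s0. r \<le> t \<and> F r - 1 - F' r = 0"
    using t e lt by (intro IVT') auto
  then obtain r where r: "s0 \<le> r" "r \<le> t" "F r = F' r + 1" by auto
  have sub: "H1 F s0 r" "H1 F r t" "H1 F' s0 r" "H1 F' r t"
    using H1_sub[OF H(1)] H1_sub[OF H(2)] r by auto
  have sub': "H1 (\<lambda>q. F q + of_int (- 1)) r t" "H1 (\<lambda>q. F' q + of_int 1) r t"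
    using sub by (simp_all only: H1_shift)
  have "path_to (glue r F' (\<lambda>q. F q + of_int (- 1))) t v'"
    unfolding path_to_def using r e glue_H1[OF sub(3) sub'(1) _ r(1,2)] lt
    by (auto simp: glue_def)
  from A_le[OF this] have 1: "A t v' \<le> J F' s0 r + J F r t"
    using J_glue[OF sub(3) sub'(1) _ r(1,2)] r(3) by (simp only: J_shift)
  have "path_to (glue r F (\<lambda>q. F' q + of_int 1)) t (v + 1)"
    unfolding path_to_def using r e glue_H1[OF sub(1) sub'(2) _ r(1,2)] lt
    by (auto simp: glue_def)
  from A_le[OF this] have 2: "A t (v + 1) \<le> J F s0 r + J F' r t"
    using J_glue[OF sub(1) sub'(2) _ r(1,2)] r(3) by (simp only: J_shift)
  show ?thesis using 1 2 fixed_min_A[OF F] fixed_min_A[OF F'] J_split[OF H(1) r(1,2)] J_split[OF H(2) r(1,2)]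
    by (simp add: G_def)
qed simp

text \<open>
  The kinetic energy grows quadratically with the winding number, which makes the winding cost
  unbounded in both directions.
\<close>

lemma square_beats_linear:
  fixes K c \<tau> :: real
  assumes "\<tau> > 0" shows "\<exists>n::nat. K + real n * c < (real n)\<^sup>2 / (2 * \<tau>)"
proof -
  obtain n :: nat where n: "real n > 2 * \<tau> * (\<bar>K\<bar> + \<bar>c\<bar>) + 1" using reals_Archimedean2 by blast
  have n1: "real n \<ge> 1" using n assms by (smt (verit) mult_nonneg_nonneg abs_ge_zero)
  have "K + real n * c \<le> real n * (\<bar>K\<bar> + \<bar>c\<bar>)"
  proof -
    have "K \<le> real n * \<bar>K\<bar>" using n1 mult_right_mono[of 1 "real n" "\<bar>K\<bar>"] by linarith
    moreover have "real n * c \<le> real n * \<bar>c\<bar>" by (intro mult_left_mono) auto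
    ultimately show ?thesis by (simp add: distrib_left)
  qed
  also have "\<dots> < (real n)\<^sup>2 / (2 * \<tau>)"
  proof -
    have "(\<bar>K\<bar> + \<bar>c\<bar>) * (2 * \<tau>) < real n" using n by (simp add: mult.commute mult.left_commute)
    then have "\<bar>K\<bar> + \<bar>c\<bar> < real n / (2 * \<tau>)" using assms by (simp add: pos_less_divide_eq)
    then have "real n * (\<bar>K\<bar> + \<bar>c\<bar>) < real n * (real n / (2 * \<tau>))" using n1 by (intro mult_strict_left_mono) auto
    then show ?thesis by (simp add: power2_eq_square)
  qed
  finally show ?thesis by blast
qed

lemma A_lower:
  assumes t: "s0 < t" shows "\<exists>C. \<forall>z. (z - Y0)\<^sup>2 / (2 * (t - s0)) - C \<le> A t z"
proof -
  obtain C where C: "\<And>F s t'. s0 \<le> s \<Longrightarrow> t' \<le> t \<Longrightarrow> mass F s t' \<le> C" using mass_bounded by blast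
  have "(z - Y0)\<^sup>2 / (2 * (t - s0)) - C \<le> A t z" for z
  proof -
    obtain F where F: "F \<in> fixed_min t z" using fixed_min_nonempty[OF t] by blast
    then have p: "H1 F s0 t" "F s0 = Y0" "F t = z" by (auto simp: fixed_min_def path_to_def)
    show ?thesis using fixed_min_A[OF F] energy_ge_chord[OF p(1) t] C[of s0 t F] p by (simp add: J_def)
  qed
  then show ?thesis by blast
qed

lemma G_unbounded_above:
  assumes t: "s0 < t" shows "\<exists>v. c < G t v"
proof (rule ccontr)
  assume "\<not> ?thesis"
  then have le: "G t v \<le> c" for v by (auto simp: not_less)
  have A: "A t (Y0 + real n) \<le> A t Y0 + real n * c" for n
  proof (induction n)
    case (Suc n)
    show ?case using Suc le[of "Y0 + real n"] by (simp add: G_def algebra_simps)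
  qed simp
  obtain C where C: "\<And>z. (z - Y0)\<^sup>2 / (2 * (t - s0)) - C \<le> A t z" using A_lower[OF t] by blast
  obtain n :: nat where n: "(A t Y0 + C) + real n * c < (real n)\<^sup>2 / (2 * (t - s0))"
    using square_beats_linear[of "t - s0" "A t Y0 + C" c] t by auto
  show False using n A[of n] C[of "Y0 + real n"] by simp
qed

text \<open>
  Reflection of space exchanges left and right, and the sign of the tilt. Facts about
  rightmost objects are obtained from their leftmost counterparts in the reflected
  environment.
\<close>

lemma neg_env: "based_env (\<lambda>r y. w r (- y))"
proof
  fix r y :: real and a b c d :: real
  show "0 \<le> w r (- y)" by (rule w_nonneg)
  show "w r (- (y + 1)) = w r (- y)" using w_period1[of r "- y - 1"] by simp
  have "{(r, y). r \<in> {a..b} \<and> y \<in> {c..d} \<and> 0 < w r (- y)} \<subseteq>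
      (\<lambda>(r, y). (r, - y)) ` {(r, y). r \<in> {a..b} \<and> y \<in> {- d..- c} \<and> 0 < w r y}"
  proof
    fix p assume "p \<in> {(r, y). r \<in> {a..b} \<and> y \<in> {c..d} \<and> 0 < w r (- y)}"
    then show "p \<in> (\<lambda>(r, y). (r, - y)) ` {(r, y). r \<in> {a..b} \<and> y \<in> {- d..- c} \<and> 0 < w r y}"
      by (intro image_eqI[of _ _ "(fst p, - snd p)"]) auto
  qed
  then show "finite {(r, y). r \<in> {a..b} \<and> y \<in> {c..d} \<and> 0 < w r (- y)}"
    by (rule finite_subset) (intro finite_imageI w_locfin)
qed

end

context based_env begin

interpretation neg: based_env "\<lambda>r y. w r (- y)" s0 "- Y0" by (rule neg_env)

lemma neg_T: "neg.T = T"
  unfolding T_def neg.T_def by (metis minus_minus)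

lemma neg_J: "neg.J F s t = J (\<lambda>r. - F r) s t"
  unfolding J_def neg.J_def mass_def neg.mass_def neg_T by simp

lemma neg_path_to: "neg.path_to F t z \<longleftrightarrow> path_to (\<lambda>r. - F r) t (- z)"
  unfolding path_to_def neg.path_to_def by auto

lemma neg_A: "neg.A t (- z) = A t z"
proof -
  have "(\<lambda>F. neg.J F s0 t) ` {F. neg.path_to F t (- z)} = (\<lambda>F. J F s0 t) ` {F. path_to F t z}"
  proof (intro equalityI subsetI)
    fix x assume "x \<in> (\<lambda>F. neg.J F s0 t) ` {F. neg.path_to F t (- z)}"
    then obtain F where "x = neg.J F s0 t" "neg.path_to F t (- z)" by blast
    then show "x \<in> (\<lambda>F. J F s0 t) ` {F. path_to F t z}"
      by (intro image_eqI[of _ _ "\<lambda>r. - F r"]) (auto simp: neg_J neg_path_to)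
  next
    fix x assume "x \<in> (\<lambda>F. J F s0 t) ` {F. path_to F t z}"
    then obtain F where "x = J F s0 t" "path_to F t z" by blast
    then show "x \<in> (\<lambda>F. neg.J F s0 t) ` {F. neg.path_to F t (- z)}"
      by (intro image_eqI[of _ _ "\<lambda>r. - F r"]) (auto simp: neg_J neg_path_to)
  qed
  then show ?thesis unfolding A_def neg.A_def by simp
qed

lemma neg_corners: "(r, - y) \<in> neg.corners t \<longleftrightarrow> (r, y) \<in> corners t"
  by (simp add: corners_def neg.corners_def)

lemma neg_parabola: "neg.parabola (r, - y) t (- z) = parabola (r, y) t z"
  by (simp add: parabola_def neg.parabola_def neg_A power2_commute[of z])

lemma neg_active: "neg.active t (- z) (r, - y) \<longleftrightarrow> active t z (r, y)"
  by (simp add: active_def neg.active_def neg_corners neg_parabola neg_A)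

lemma neg_slope: "neg.slope t (- z) (r, - y) = - slope t z (r, y)"
  by (simp add: slope_def neg.slope_def minus_divide_left)

lemma neg_left_active: "neg.left_active t (- z) (r, - y) \<longleftrightarrow> right_active t z (r, y)"
proof -
  have "(\<forall>p'. neg.active t (- z) p' \<longrightarrow> neg.slope t (- z) p' \<le> neg.slope t (- z) (r, - y)) \<longleftrightarrow>
    (\<forall>p'. active t z p' \<longrightarrow> slope t z (r, y) \<le> slope t z p')"
  proof (intro iffI allI impI)
    fix p' assume *: "\<forall>p'. neg.active t (- z) p' \<longrightarrow> neg.slope t (- z) p' \<le> neg.slope t (- z) (r, - y)"
      and a: "active t z p'"
    obtain r' y' where p': "p' = (r', y')" by (cases p')
    show "slope t z (r, y) \<le> slope t z p'"
      using *[rule_format, of "(r', - y')"] a by (simp add: p' neg_active neg_slope)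
  next
    fix p' assume *: "\<forall>p'. active t z p' \<longrightarrow> slope t z (r, y) \<le> slope t z p'"
      and a: "neg.active t (- z) p'"
    obtain r' y' where p': "p' = (r', - y')" by (metis prod.collapse minus_minus)
    show "neg.slope t (- z) p' \<le> neg.slope t (- z) (r, - y)"
      using *[rule_format, of "(r', y')"] a by (simp add: p' neg_active neg_slope)
  qed
  then show ?thesis by (simp add: left_active_def neg.left_active_def right_active_def neg_active)
qed

lemma right_active_exists:
  assumes t: "s0 < t" shows "\<exists>p. right_active t z p"
proof -
  obtain p where p: "neg.left_active t (- z) p" using neg.left_active_exists[OF t] by blast
  obtain r y where ry: "p = (r, - y)" by (metis prod.collapse minus_minus)
  show ?thesis using p unfolding ry neg_left_active by blast
qed

lemma right_active_local:
  assumes t: "s0 < t" and p: "right_active t z p"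
  shows "\<exists>\<epsilon>>0. \<forall>u. z \<le> u \<longrightarrow> u \<le> z + \<epsilon> \<longrightarrow> active t u p"
proof -
  obtain r y where ry: "p = (r, y)" by (cases p)
  have "neg.left_active t (- z) (r, - y)" using p by (simp add: ry neg_left_active)
  from neg.left_active_local[OF t this] obtain e where
    e: "e > 0" "\<And>u. - z - e \<le> u \<Longrightarrow> u \<le> - z \<Longrightarrow> neg.active t u (r, - y)" by blast
  have "active t u p" if "z \<le> u" "u \<le> z + e" for u
    using e(2)[of "- u"] that by (simp add: ry neg_active)
  then show ?thesis using e(1) by blast
qed

lemma A_continuous: "s0 < t \<Longrightarrow> isCont (A t) z"
proof -
  assume t: "s0 < t"
  have time: "fst q < t" if "active t z q" for q
    using corners_time[OF t, of "fst q" "snd q"] that by (simp add: active_def)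
  obtain p where p: "left_active t z p" using left_active_exists[OF t] by blast
  obtain q where q: "right_active t z q" using right_active_exists[OF t] by blast
  have az: "active t z p" "active t z q" using p q by (auto simp: left_active_def right_active_def)
  obtain e where e: "e > 0" "\<And>u. z - e \<le> u \<Longrightarrow> u \<le> z \<Longrightarrow> active t u p" using left_active_local[OF t p] by blast
  obtain e' where e': "e' > 0" "\<And>u. z \<le> u \<Longrightarrow> u \<le> z + e' \<Longrightarrow> active t u q"
    using right_active_local[OF t q] by blast
  have "(parabola p t \<longlongrightarrow> parabola p t z) (at_left z)"
    using DERIV_isCont[OF parabola_deriv[OF time[OF az(1)]], of z]
    by (auto simp: isCont_def intro: filterlim_mono at_within_le_at)
  moreover have "\<forall>\<^sub>F u in at_left z. parabola p t u = A t u"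
    unfolding eventually_at_left_field using e by (intro exI[of _ "z - e"]) (auto simp: active_def)
  ultimately have l: "(A t \<longlongrightarrow> A t z) (at_left z)"
    using az by (simp add: active_def tendsto_cong[of "parabola p t" "A t"])
  have "(parabola q t \<longlongrightarrow> parabola q t z) (at_right z)"
    using DERIV_isCont[OF parabola_deriv[OF time[OF az(2)]], of z]
    by (auto simp: isCont_def intro: filterlim_mono at_within_le_at)
  moreover have "\<forall>\<^sub>F u in at_right z. parabola q t u = A t u"
    unfolding eventually_at_right_field using e' by (intro exI[of _ "z + e'"]) (auto simp: active_def)
  ultimately have r: "(A t \<longlongrightarrow> A t z) (at_right z)"
    using az by (simp add: active_def tendsto_cong[of "parabola q t" "A t"])
  show ?thesis unfolding isCont_def using l r by (simp add: filterlim_split_at)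
qed

lemma G_continuous: "s0 < t \<Longrightarrow> isCont (G t) v"
proof -
  assume t: "s0 < t"
  have "isCont (\<lambda>v. v + 1) v" by (intro continuous_intros)
  then have "isCont (\<lambda>v. A t (v + 1)) v" by (rule isCont_o2) (rule A_continuous[OF t])
  then show ?thesis unfolding G_def by (intro continuous_intros A_continuous[OF t])
qed

lemma neg_G: "neg.G t (- v - 1) = - G t v"
  using neg_A[of t v] neg_A[of t "v + 1"] by (simp add: G_def neg.G_def)

lemma G_unbounded_below:
  assumes t: "s0 < t" shows "\<exists>v. G t v < c"
proof -
  obtain v where v: "- c < neg.G t v" using neg.G_unbounded_above[OF t] by blast
  have "neg.G t v = - G t (- v - 1)" using neg_G[of t "- v - 1"] by simp
  then have "G t (- v - 1) < c" using v by simp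
  then show ?thesis by blast
qed

lemma a_le_iff:
  assumes t: "s0 < t" shows "a t \<theta> \<le> v \<longleftrightarrow> \<theta> \<le> G t v"
proof -
  let ?S = "{v. \<theta> \<le> G t v}"
  obtain v1 where v1: "\<theta> < G t v1" using G_unbounded_above[OF t] by blast
  obtain v0 where v0: "G t v0 < \<theta>" using G_unbounded_below[OF t] by blast
  have bdd: "bdd_below ?S"
  proof (rule bdd_belowI[of _ v0])
    fix v assume "v \<in> ?S"
    then show "v0 \<le> v" using G_mono[OF t, of v v0] v0 by (cases "v0 \<le> v") auto
  qed
  have "closed ?S"
    by (intro closed_Collect_le continuous_intros continuous_at_imp_continuous_on ballI G_continuous t)
  then have "Inf ?S \<in> ?S" using v1 bdd by (intro closed_contains_Inf) (auto intro: less_imp_le)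
  then have 1: "\<theta> \<le> G t (a t \<theta>)" by (simp add: a_def)
  show ?thesis
  proof
    assume "a t \<theta> \<le> v" then show "\<theta> \<le> G t v" using G_mono[OF t, of "a t \<theta>" v] 1 by simp
  next
    assume "\<theta> \<le> G t v" then show "a t \<theta> \<le> v" unfolding a_def by (intro cInf_lower bdd) auto
  qed
qed

lemma le_b_iff:
  assumes t: "s0 < t" shows "v \<le> b t \<theta> \<longleftrightarrow> G t v \<le> \<theta>"
proof -
  let ?S = "{v. G t v \<le> \<theta>}"
  obtain v1 where v1: "\<theta> < G t v1" using G_unbounded_above[OF t] by blast
  obtain v0 where v0: "G t v0 < \<theta>" using G_unbounded_below[OF t] by blast
  have bdd: "bdd_above ?S"
  proof (rule bdd_aboveI[of _ v1])
    fix v assume "v \<in> ?S"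
    then show "v \<le> v1" using G_mono[OF t, of v1 v] v1 by (cases "v \<le> v1") auto
  qed
  have "closed ?S"
    by (intro closed_Collect_le continuous_intros continuous_at_imp_continuous_on ballI G_continuous t)
  then have "Sup ?S \<in> ?S" using v0 bdd by (intro closed_contains_Sup) (auto intro: less_imp_le)
  then have 1: "G t (b t \<theta>) \<le> \<theta>" by (simp add: b_def)
  show ?thesis
  proof
    assume "v \<le> b t \<theta>" then show "G t v \<le> \<theta>" using G_mono[OF t, of v "b t \<theta>"] 1 by simp
  next
    assume "G t v \<le> \<theta>" then show "v \<le> b t \<theta>" unfolding b_def by (intro cSup_upper bdd) auto
  qed
qed

lemma G_attains: "s0 < t \<Longrightarrow> \<exists>v. G t v = \<theta>"
proof -
  assume t: "s0 < t"
  obtain v1 where v1: "\<theta> < G t v1" using G_unbounded_above[OF t] by blast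
  obtain v0 where v0: "G t v0 < \<theta>" using G_unbounded_below[OF t] by blast
  have "v0 \<le> v1" using G_mono[OF t, of v1 v0] v0 v1 by (cases "v0 \<le> v1") auto
  have "\<exists>v\<ge>v0. v \<le> v1 \<and> G t v = \<theta>"
    using v0 v1 \<open>v0 \<le> v1\<close> G_continuous[OF t] by (intro IVT) auto
  then show ?thesis by blast
qed

lemma G_eq_iff: "s0 < t \<Longrightarrow> G t v = \<theta> \<longleftrightarrow> a t \<theta> \<le> v \<and> v \<le> b t \<theta>"
  using a_le_iff le_b_iff by auto

lemma G_a [simp]: "s0 < t \<Longrightarrow> G t (a t \<theta>) = \<theta>"
  and G_b [simp]: "s0 < t \<Longrightarrow> G t (b t \<theta>) = \<theta>"
  and a_le_b: "s0 < t \<Longrightarrow> a t \<theta> \<le> b t \<theta>"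
proof -
  assume t: "s0 < t"
  obtain v where "G t v = \<theta>" using G_attains[OF t] by blast
  then have "a t \<theta> \<le> v" "v \<le> b t \<theta>" using G_eq_iff[OF t] by auto
  then show ab: "a t \<theta> \<le> b t \<theta>" by simp
  show "G t (a t \<theta>) = \<theta>" "G t (b t \<theta>) = \<theta>" using G_eq_iff[OF t] ab by auto
qed

end

context based_env begin

interpretation neg: based_env "\<lambda>r y. w r (- y)" s0 "- Y0" by (rule neg_env)

lemma neg_a: "s0 < t \<Longrightarrow> neg.a t (- \<theta>) = - 1 - b t \<theta>"
proof -
  assume t: "s0 < t"
  have *: "neg.a t (- \<theta>) \<le> v \<longleftrightarrow> - 1 - b t \<theta> \<le> v" for v
  proof -
    have "neg.a t (- \<theta>) \<le> v \<longleftrightarrow> - \<theta> \<le> neg.G t v" by (rule neg.a_le_iff[OF t])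
    also have "\<dots> \<longleftrightarrow> G t (- v - 1) \<le> \<theta>" using neg_G[of t "- v - 1"] by simp
    also have "\<dots> \<longleftrightarrow> - v - 1 \<le> b t \<theta>" by (rule le_b_iff[OF t, symmetric])
    finally show ?thesis by linarith
  qed
  show ?thesis using *[of "neg.a t (- \<theta>)"] *[of "- 1 - b t \<theta>"] by simp
qed

lemma neg_b: "s0 < t \<Longrightarrow> neg.b t (- \<theta>) = - 1 - a t \<theta>"
proof -
  assume t: "s0 < t"
  have *: "v \<le> neg.b t (- \<theta>) \<longleftrightarrow> v \<le> - 1 - a t \<theta>" for v
  proof -
    have "v \<le> neg.b t (- \<theta>) \<longleftrightarrow> neg.G t v \<le> - \<theta>" by (rule neg.le_b_iff[OF t])
    also have "\<dots> \<longleftrightarrow> \<theta> \<le> G t (- v - 1)" using neg_G[of t "- v - 1"] by simp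
    also have "\<dots> \<longleftrightarrow> a t \<theta> \<le> - v - 1" by (rule a_le_iff[OF t, symmetric])
    finally show ?thesis by linarith
  qed
  show ?thesis using *[of "neg.b t (- \<theta>)"] *[of "- 1 - a t \<theta>"] by simp
qed

end

section \<open>Slopes of the value function and the jump sum\<close>

context based_env begin

text \<open>
  The one-sided derivatives of the value function in its end point.
\<close>

definition left_slope :: "real \<Rightarrow> real \<Rightarrow> real" where "left_slope t v = slope t v (THE p. left_active t v p)"

definition right_slope :: "real \<Rightarrow> real \<Rightarrow> real" where "right_slope t v = slope t v (THE p. right_active t v p)"

lemma left_slope_eq: "s0 < t \<Longrightarrow> left_active t v p \<Longrightarrow> left_slope t v = slope t v p"
  unfolding left_slope_def using left_active_unique by (metis the_equality)

lemma active_time: "s0 < t \<Longrightarrow> active t v p \<Longrightarrow> s0 \<le> fst p \<and> fst p < t"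
  using corners_time[of t "fst p" "snd p"] by (simp add: active_def)

lemma left_active_active: "left_active t v p \<Longrightarrow> active t v p"
  by (simp add: left_active_def)

lemma G_left_parabola:
  assumes t: "s0 < t" and p: "left_active t v p" and p': "left_active t (v + 1) p'"
  shows "\<exists>e>0. \<forall>u. v - e \<le> u \<longrightarrow> u \<le> v \<longrightarrow> G t u = parabola p' t (u + 1) - parabola p t u"
proof -
  obtain e1 where e1: "e1 > 0" "\<And>u. v - e1 \<le> u \<Longrightarrow> u \<le> v \<Longrightarrow> active t u p"
    using left_active_local[OF t p] by blast
  obtain e2 where e2: "e2 > 0" "\<And>u. v + 1 - e2 \<le> u \<Longrightarrow> u \<le> v + 1 \<Longrightarrow> active t u p'"
    using left_active_local[OF t p'] by blast
  have "G t u = parabola p' t (u + 1) - parabola p t u" if "v - min e1 e2 \<le> u" "u \<le> v" for u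
    using e1(2)[of u] e2(2)[of "u + 1"] that by (simp add: G_def active_def)
  then show ?thesis using e1(1) e2(1) by (intro exI[of _ "min e1 e2"]) auto
qed

lemma parabola_diff_deriv:
  assumes t: "s0 < t" and p: "left_active t v p" and p': "left_active t (v + 1) p'"
  shows "((\<lambda>u. parabola p' t (u + 1) - parabola p t u) has_real_derivative (left_slope t (v + 1) - left_slope t v)) (at v)"
proof -
  have time: "fst p < t" "fst p' < t"
    using active_time[OF t left_active_active[OF p]] active_time[OF t left_active_active[OF p']] by auto
  have "((\<lambda>u. parabola p' t (u + 1)) has_real_derivative left_slope t (v + 1)) (at v)"
    using parabola_deriv[OF time(2), of "v + 1"] DERIV_shift[of "parabola p' t" _ v 1]
    by (simp add: left_slope_eq[OF t p'])
  from DERIV_diff[OF this parabola_deriv[OF time(1), of v]] show ?thesis by (simp add: left_slope_eq[OF t p])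
qed

lemma G_left_deriv:
  assumes t: "s0 < t"
  shows "(G t has_real_derivative (left_slope t (v + 1) - left_slope t v)) (at v within {..v})"
proof -
  obtain p p' where p: "left_active t v p" "left_active t (v + 1) p'" using left_active_exists[OF t] by metis
  obtain e where e: "e > 0" "\<And>u. v - e \<le> u \<Longrightarrow> u \<le> v \<Longrightarrow> G t u = parabola p' t (u + 1) - parabola p t u"
    using G_left_parabola[OF t p] by blast
  have "((\<lambda>u. parabola p' t (u + 1) - parabola p t u) has_real_derivative (left_slope t (v + 1) - left_slope t v)) (at v within {..v})"
    by (rule has_field_derivative_at_within[OF parabola_diff_deriv[OF t p]])
  then show ?thesis
    by (rule has_field_derivative_transform_within[OF _ e(1)]) (auto simp: dist_real_def e(2))
qed

lemma left_slope_step_mono: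
  assumes t: "s0 < t" shows "left_slope t v \<le> left_slope t (v + 1)"
proof (rule ccontr)
  assume "\<not> ?thesis"
  then have lt: "0 < - (left_slope t (v + 1) - left_slope t v)" by simp
  obtain p p' where p: "left_active t v p" "left_active t (v + 1) p'" using left_active_exists[OF t] by metis
  obtain e where e: "e > 0" "\<And>u. v - e \<le> u \<Longrightarrow> u \<le> v \<Longrightarrow> G t u = parabola p' t (u + 1) - parabola p t u"
    using G_left_parabola[OF t p] by blast
  from DERIV_pos_inc_left[OF DERIV_minus[OF parabola_diff_deriv[OF t p]] lt] obtain d where
    d: "d > 0" "\<And>h. 0 < h \<Longrightarrow> h < d \<Longrightarrow>
      - (parabola p' t (v - h + 1) - parabola p t (v - h)) < - (parabola p' t (v + 1) - parabola p t v)" by blast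
  define h where "h = min e (d / 2)"
  have h: "0 < h" "h < d" "h \<le> e" using e d by (auto simp: h_def min_def)
  have "G t v < G t (v - h)" using d(2)[OF h(1,2)] e(2)[of v] e(2)[of "v - h"] h e(1) by simp
  then show False using G_mono[OF t, of "v - h" v] h by simp
qed

text \<open>
  A difference of the two slopes would be the left derivative of the winding cost.
\<close>

lemma flat_left_imp_slopes:
  assumes t: "s0 < t" and u: "u < v" "G t u = G t v"
  shows "left_slope t (v + 1) = left_slope t v"
proof (rule ccontr)
  assume "\<not> ?thesis"
  then have lt: "0 < left_slope t (v + 1) - left_slope t v" using left_slope_step_mono[OF t, of v] by simp
  obtain p p' where p: "left_active t v p" "left_active t (v + 1) p'" using left_active_exists[OF t] by metis
  obtain e where e: "e > 0" "\<And>u. v - e \<le> u \<Longrightarrow> u \<le> v \<Longrightarrow> G t u = parabola p' t (u + 1) - parabola p t u"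
    using G_left_parabola[OF t p] by blast
  from DERIV_pos_inc_left[OF parabola_diff_deriv[OF t p] lt] obtain d where
    d: "d > 0" "\<And>h. 0 < h \<Longrightarrow> h < d \<Longrightarrow>
      parabola p' t (v - h + 1) - parabola p t (v - h) < parabola p' t (v + 1) - parabola p t v" by blast
  define h where "h = min (min e (d / 2)) (v - u)"
  have h: "0 < h" "h < d" "h \<le> e" "h \<le> v - u" using e d u by (auto simp: h_def min_def)
  have "G t (v - h) < G t v" using d(2)[OF h(1,2)] e(2)[of v] e(2)[of "v - h"] h e(1) by simp
  moreover have "G t u \<le> G t (v - h)" using h by (intro G_mono t) auto
  ultimately show False using u by simp
qed

text \<open>
  Equal slopes put the two last corners on a common line modulo 1, hence make them equal
  modulo 1; in particular the corner is not the base point.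
\<close>

lemma slopes_imp_shift:
  assumes t: "s0 < t" and p: "left_active t v p" and p': "left_active t (v + 1) p'"
    and eq: "left_slope t (v + 1) = left_slope t v"
  shows "p' = (fst p, snd p + 1)" and "s0 < fst p" and "w (fst p) (snd p) > 0"
proof -
  have a: "active t v p" "active t (v + of_int 1) p'" using p p' by (auto simp: left_active_def)
  have slope: "slope t v p = slope t (v + of_int 1) p'" using eq left_slope_eq[OF t p] left_slope_eq[OF t p'] by simp
  show "p' = (fst p, snd p + 1)" using same_slope[OF t a slope] by (simp add: prod_eq_iff)
  show "s0 < fst p" "w (fst p) (snd p) > 0" using same_slope_time[OF t a slope] by auto
qed

lemma slopes_imp_flat_left:
  assumes t: "s0 < t" and eq: "left_slope t (v + 1) = left_slope t v"
  shows "\<exists>u<v. G t u = G t v"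
proof -
  obtain p p' where p: "left_active t v p" "left_active t (v + 1) p'" using left_active_exists[OF t] by metis
  have sh: "p' = (fst p, snd p + 1)" by (rule slopes_imp_shift(1)[OF t p eq])
  obtain e where e: "e > 0" "\<And>u. v - e \<le> u \<Longrightarrow> u \<le> v \<Longrightarrow> G t u = parabola p' t (u + 1) - parabola p t u"
    using G_left_parabola[OF t p] by blast
  have "parabola p' t (u + 1) - parabola p t u =
      A (fst p) (snd p + 1) - w (fst p) (snd p + 1) - (A (fst p) (snd p) - w (fst p) (snd p))" for u
    by (simp add: sh parabola_def)
  then have "G t (v - e) = G t v" using e(2)[of "v - e"] e(2)[of v] e(1) by simp
  then show ?thesis using e(1) by (intro exI[of _ "v - e"]) auto
qed

lemma a_mono: "s0 < t \<Longrightarrow> \<theta> \<le> \<theta>' \<Longrightarrow> a t \<theta> \<le> a t \<theta>'"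
  by (simp add: a_le_iff)

lemma a_less: "s0 < t \<Longrightarrow> \<theta> < \<theta>' \<Longrightarrow> a t \<theta> < a t \<theta>'"
  using a_mono[of t \<theta> \<theta>'] G_a[of t \<theta>] G_a[of t \<theta>'] by (metis less_le)

text \<open>
  Since a is the least point of its level set, the winding cost is not constant to its left.
\<close>

lemma a_slope_pos:
  assumes t: "s0 < t" shows "left_slope t (a t \<theta>) < left_slope t (a t \<theta> + 1)"
proof -
  have "left_slope t (a t \<theta> + 1) \<noteq> left_slope t (a t \<theta>)"
  proof
    assume "left_slope t (a t \<theta> + 1) = left_slope t (a t \<theta>)"
    then obtain u where u: "u < a t \<theta>" "G t u = \<theta>" using slopes_imp_flat_left[OF t] G_a[OF t] by metis
    then show False using G_eq_iff[OF t, of u \<theta>] by simp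
  qed
  then show ?thesis using left_slope_step_mono[OF t, of "a t \<theta>"] by simp
qed

text \<open>
  The derivative of an inverse function; only values of the winding cost to the left of the
  point matter.
\<close>

lemma a_left_deriv:
  assumes t: "s0 < t"
  shows "(a t has_real_derivative 1 / (left_slope t (a t \<theta> + 1) - left_slope t (a t \<theta>))) (at \<theta> within {..\<theta>})"
proof -
  define v where "v = a t \<theta>"
  define D where "D = left_slope t (v + 1) - left_slope t v"
  have D: "D > 0" using a_slope_pos[OF t, of \<theta>] by (simp add: D_def v_def)
  have at_le: "at (x::real) within {..x} = at_left x" for x
  proof -
    have "{..x} - {x} = {..<x} - {x}" by auto
    then show ?thesis unfolding at_within_def by simp
  qed
  have "((\<lambda>u. (G t u - G t v) / (u - v)) \<longlongrightarrow> D) (at_left v)"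
    using G_left_deriv[OF t, of v] unfolding has_field_derivative_iff at_le D_def .
  moreover have "filterlim (a t) (at_left v) (at_left \<theta>)"
    unfolding filterlim_at
  proof
    show "\<forall>\<^sub>F x in at_left \<theta>. a t x \<in> {..<v} \<and> a t x \<noteq> v"
      unfolding eventually_at_left_field using a_less[OF t, of _ \<theta>]
      by (intro exI[of _ "\<theta> - 1"]) (fastforce simp: v_def)
    show "(a t \<longlongrightarrow> v) (at_left \<theta>)"
    proof (rule order_tendstoI)
      fix c assume "v < c"
      then show "\<forall>\<^sub>F x in at_left \<theta>. a t x < c"
        unfolding eventually_at_left_field using a_less[OF t, of _ \<theta>]
        by (intro exI[of _ "\<theta> - 1"]) (auto simp: v_def intro: less_trans)
    next
      fix c assume c: "c < v"
      then have "G t c < \<theta>" using a_le_iff[OF t, of \<theta> c] by (simp add: v_def)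
      moreover have "c < a t x" if "G t c < x" for x using a_le_iff[OF t, of x c] that by linarith
      ultimately show "\<forall>\<^sub>F x in at_left \<theta>. c < a t x"
        unfolding eventually_at_left_field by (intro exI[of _ "G t c"]) auto
    qed
  qed
  ultimately have "((\<lambda>x. (G t (a t x) - G t v) / (a t x - v)) \<longlongrightarrow> D) (at_left \<theta>)"
    by (rule filterlim_compose)
  then have "((\<lambda>x. (x - \<theta>) / (a t x - v)) \<longlongrightarrow> D) (at_left \<theta>)"
    using G_a[OF t] by (simp add: v_def)
  from tendsto_inverse[OF this] D
  have "((\<lambda>x. (a t x - v) / (x - \<theta>)) \<longlongrightarrow> 1 / D) (at_left \<theta>)"
    by (simp add: inverse_eq_divide)
  then show ?thesis unfolding has_field_derivative_iff at_le D_def v_def .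
qed

text \<open>
  The largest lift of the end point that is optimal for the tilted action, i.e. the unique
  lift v of z with \<open>G t (v - 1) \<le> \<theta> < G t v\<close>. The leftmost minimizer,
  shifted to start in (s0, Y0), ends there.
\<close>

definition left_end :: "real \<Rightarrow> real \<Rightarrow> real \<Rightarrow> real" where
  "left_end t \<theta> z = z + of_int (\<lfloor>b t \<theta> - z\<rfloor> + 1)"

lemma left_end_unique:
  assumes "b t \<theta> < v" "v \<le> b t \<theta> + 1" "v - z \<in> \<int>"
  shows "left_end t \<theta> z = v"
proof -
  obtain k where k: "v - z = of_int k" using assms(3) by (rule Ints_cases)
  then have "v = z + of_int k" by simp
  moreover have "\<lfloor>b t \<theta> - z\<rfloor> = k - 1" using assms k by (intro floor_unique) auto
  ultimately show ?thesis by (simp add: left_end_def)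
qed

lemma sum_telescope_int:
  fixes f :: "int \<Rightarrow> real"
  assumes "k \<le> m" shows "(\<Sum>i\<in>{k..<m}. f (i + 1) - f i) = f m - f k"
  using assms
proof (induction m rule: int_ge_induct)
  case (step i)
  then have "{k..<i + 1} = insert i {k..<i}" by auto
  then show ?case using step by simp
qed simp

text \<open>
  As the tilt increases, the optimal lift of a fixed circle point moves up by one whenever the
  winding cost of that lift is passed. The slope then changes by the left derivative of the
  winding cost, which is the reciprocal of the speed of a. The lifts that are not of the form
  \<open>a t \<theta>\<close> lie at the right of a flat piece and contribute 0.
\<close>

theorem left_jump_sum:
  assumes t: "s0 < t" and le: "\<theta>1 < \<theta>2"
  shows "((\<lambda>\<theta>. left_slope t (a t \<theta> + 1) - left_slope t (a t \<theta>)) has_sum (left_slope t (left_end t \<theta>2 z) - left_slope t (left_end t \<theta>1 z)))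
     {\<theta> \<in> {\<theta>1<..\<theta>2}. a t \<theta> - z \<in> \<int>}"
proof -
  let ?S = "{\<theta> \<in> {\<theta>1<..\<theta>2}. a t \<theta> - z \<in> \<int>}"
  define k1 where "k1 = \<lfloor>b t \<theta>1 - z\<rfloor> + 1"
  define k2 where "k2 = \<lfloor>b t \<theta>2 - z\<rfloor> + 1"
  have kle: "k \<le> \<lfloor>b t \<theta> - z\<rfloor> \<longleftrightarrow> G t (z + of_int k) \<le> \<theta>" for k \<theta>
    using le_b_iff[OF t, of "z + of_int k" \<theta>] by (simp add: le_floor_iff algebra_simps)
  have k12: "k1 \<le> k2"
  proof -
    have "G t (z + of_int \<lfloor>b t \<theta>1 - z\<rfloor>) \<le> \<theta>1" using kle by blast
    then have "\<lfloor>b t \<theta>1 - z\<rfloor> \<le> \<lfloor>b t \<theta>2 - z\<rfloor>" using kle le by fastforce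
    then show ?thesis by (simp add: k1_def k2_def)
  qed
  define f where "f k = left_slope t (z + of_int k)" for k :: int
  let ?K = "{k \<in> {k1..<k2}. a t (G t (z + of_int k)) = z + of_int k}"
  let ?g = "\<lambda>k :: int. G t (z + of_int k)"
  have range: "k \<in> {k1..<k2} \<longleftrightarrow> G t (z + of_int k) \<in> {\<theta>1<..\<theta>2}" for k
    using kle[of k \<theta>1] kle[of k \<theta>2] by (auto simp: k1_def k2_def)
  have bij: "bij_betw ?g ?K ?S"
    unfolding bij_betw_def
  proof
    show "inj_on ?g ?K"
    proof (rule inj_onI)
      fix x y assume "x \<in> ?K" "y \<in> ?K" "?g x = ?g y"
      then have "z + of_int x = z + (of_int y :: real)" by (metis (mono_tags, lifting) mem_Collect_eq)
      then show "x = y" by simp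
    qed
    show "?g ` ?K = ?S"
    proof (intro equalityI subsetI)
      fix \<theta> assume "\<theta> \<in> ?g ` ?K"
      then obtain k where k: "k \<in> ?K" "\<theta> = ?g k" by blast
      then have "a t \<theta> = z + of_int k" by simp
      then have "a t \<theta> - z \<in> \<int>" by simp
      then show "\<theta> \<in> ?S" using range[of k] k by simp
    next
      fix \<theta> assume th: "\<theta> \<in> ?S"
      then have "a t \<theta> - z \<in> \<int>" by simp
      then obtain k where "a t \<theta> - z = of_int k" by (rule Ints_cases)
      then have k: "a t \<theta> = z + of_int k" by simp
      then have g: "?g k = \<theta>" using G_a[OF t, of \<theta>] by simp
      then have "k \<in> ?K" using range[of k] th k by simp
      then show "\<theta> \<in> ?g ` ?K" using g by blast
    qed
  qed
  have finK: "finite ?K" by (rule finite_subset[of _ "{k1..<k2}"]) auto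
  have "(\<Sum>\<theta>\<in>?S. left_slope t (a t \<theta> + 1) - left_slope t (a t \<theta>)) = (\<Sum>k\<in>?K. left_slope t (a t (?g k) + 1) - left_slope t (a t (?g k)))"
    by (rule sum.reindex_bij_betw[OF bij, symmetric])
  also have "\<dots> = (\<Sum>k\<in>?K. f (k + 1) - f k)"
    by (rule sum.cong) (auto simp: f_def algebra_simps)
  also have "\<dots> = (\<Sum>k\<in>{k1..<k2}. f (k + 1) - f k)"
  proof (rule sum.mono_neutral_left)
    show "\<forall>k\<in>{k1..<k2} - ?K. f (k + 1) - f k = 0"
    proof
      fix k assume "k \<in> {k1..<k2} - ?K"
      then have "a t (?g k) \<noteq> z + of_int k" by simp
      moreover have "a t (?g k) \<le> z + of_int k" using a_le_iff[OF t, of "?g k"] by simp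
      ultimately have lt: "a t (?g k) < z + of_int k" by simp
      have "left_slope t (z + of_int k + 1) = left_slope t (z + of_int k)"
        by (rule flat_left_imp_slopes[OF t lt G_a[OF t]])
      then show "f (k + 1) - f k = 0" by (simp add: f_def add.assoc)
    qed
  qed auto
  also have "\<dots> = f k2 - f k1" by (rule sum_telescope_int[OF k12])
  finally have "(\<Sum>\<theta>\<in>?S. left_slope t (a t \<theta> + 1) - left_slope t (a t \<theta>)) = left_slope t (left_end t \<theta>2 z) - left_slope t (left_end t \<theta>1 z)"
    by (simp add: f_def left_end_def k1_def k2_def)
  moreover have "finite ?S" using bij_betw_finite[OF bij] finK by simp
  ultimately show ?thesis using has_sum_finite[of ?S "\<lambda>\<theta>. left_slope t (a t \<theta> + 1) - left_slope t (a t \<theta>)"] by simp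
qed

section \<open>Minimizers of the tilted action with free winding\<close>

text \<open>
  The tilted action of a lift with prescribed end point, up to a constant: the term \<open>-
  \<theta> (F t - F s0)\<close> only matters through the starting point.
\<close>

definition cost :: "real \<Rightarrow> (real \<Rightarrow> real) \<Rightarrow> real \<Rightarrow> real" where
  "cost \<theta> F t = J F s0 t + \<theta> * F s0"

definition adm :: "(real \<Rightarrow> real) \<Rightarrow> real \<Rightarrow> real \<Rightarrow> bool" where
  "adm F t z \<longleftrightarrow> H1 F s0 t \<and> F t = z \<and> F s0 - Y0 \<in> \<int>"

definition tilted_min :: "real \<Rightarrow> real \<Rightarrow> real \<Rightarrow> (real \<Rightarrow> real) set" where
  "tilted_min \<theta> t z = {F. adm F t z \<and> (\<forall>F'. adm F' t z \<longrightarrow> cost \<theta> F t \<le> cost \<theta> F' t)}"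

text \<open>
  The pointwise bounds of the finitely many minimizers; they are minimizers themselves.
\<close>

definition leftmost :: "real \<Rightarrow> real \<Rightarrow> real \<Rightarrow> real \<Rightarrow> real" where
  "leftmost \<theta> t z r = (INF F\<in>tilted_min \<theta> t z. F r)"

definition rightmost :: "real \<Rightarrow> real \<Rightarrow> real \<Rightarrow> real \<Rightarrow> real" where
  "rightmost \<theta> t z r = (SUP F\<in>tilted_min \<theta> t z. F r)"

text \<open>
  The lifts of the end point whose winding is optimal at tilt \<open>\<theta>\<close>.
\<close>

definition optimal_end :: "real \<Rightarrow> real \<Rightarrow> real \<Rightarrow> bool" where
  "optimal_end \<theta> t v \<longleftrightarrow> a t \<theta> \<le> v \<and> v \<le> b t \<theta> + 1"

text \<open>
  Monotonicity of the winding cost reduces the comparison with all windings to the comparison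
  with the two neighbouring ones.
\<close>

lemma optimal_end_le:
  assumes t: "s0 < t" and v: "optimal_end \<theta> t v"
  shows "A t v - \<theta> * v \<le> A t (v + of_int k) - \<theta> * (v + of_int k)"
proof (cases "k \<ge> 0")
  case True
  have G: "\<theta> \<le> G t v" using v a_le_iff[OF t] by (simp add: optimal_end_def)
  show ?thesis using True
  proof (induction k rule: int_ge_induct)
    case (step i)
    have "\<theta> \<le> G t (v + of_int i)" using G G_mono[OF t, of v "v + of_int i"] step by simp
    then show ?case using step by (simp add: G_def algebra_simps)
  qed simp
next
  case False
  have G: "G t (v - 1) \<le> \<theta>" using v le_b_iff[OF t, of "v - 1" \<theta>] by (simp add: optimal_end_def)
  have "k \<le> 0" using False by simp
  then show ?thesis
  proof (induction k rule: int_le_induct)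
    case (step i)
    have "G t (v + of_int i - 1) \<le> \<theta>" using G G_mono[OF t, of "v + of_int i - 1" "v - 1"] step by simp
    then show ?case using step by (simp add: G_def algebra_simps)
  qed simp
qed

lemma optimal_endI:
  assumes t: "s0 < t" and le: "\<And>k. A t v - \<theta> * v \<le> A t (v + of_int k) - \<theta> * (v + of_int k)"
  shows "optimal_end \<theta> t v"
proof -
  have "\<theta> \<le> G t v" using le[of 1] by (simp add: G_def algebra_simps)
  moreover have "G t (v - 1) \<le> \<theta>" using le[of "- 1"] by (simp add: G_def algebra_simps)
  ultimately show ?thesis using a_le_iff[OF t, of \<theta> v] le_b_iff[OF t, of "v - 1" \<theta>]
    by (simp add: optimal_end_def)
qed

lemma adm_shift: "adm (\<lambda>r. F r + of_int k) t (z + of_int k) \<longleftrightarrow> adm F t z"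
proof -
  have "F s0 + of_int k - Y0 \<in> \<int> \<longleftrightarrow> F s0 - Y0 \<in> \<int>"
    using Ints_add[of "F s0 - Y0" "of_int k"] Ints_diff[of "F s0 + of_int k - Y0" "of_int k"]
    by (auto simp: algebra_simps)
  then show ?thesis by (simp add: adm_def)
qed

lemma cost_shift: "cost \<theta> (\<lambda>r. F r + of_int k) t = cost \<theta> F t + \<theta> * of_int k"
  unfolding cost_def J_shift by (simp add: distrib_left)

lemma adm_shift_minus: "adm F t (z + of_int k) \<longleftrightarrow> adm (\<lambda>r. F r + of_int (- k)) t z"
  using adm_shift[of F "- k" t "z + of_int k"] by simp

lemma tilted_min_shift:
  assumes "F \<in> tilted_min \<theta> t z" shows "(\<lambda>r. F r + of_int k) \<in> tilted_min \<theta> t (z + of_int k)"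
  unfolding tilted_min_def
proof (intro CollectI conjI allI impI)
  show "adm (\<lambda>r. F r + of_int k) t (z + of_int k)" using assms adm_shift by (simp add: tilted_min_def)
  fix F' assume "adm F' t (z + of_int k)"
  then have "adm (\<lambda>r. F' r + of_int (- k)) t z" using adm_shift_minus by blast
  then have "cost \<theta> F t \<le> cost \<theta> (\<lambda>r. F' r + of_int (- k)) t" using assms by (simp add: tilted_min_def)
  then show "cost \<theta> (\<lambda>r. F r + of_int k) t \<le> cost \<theta> F' t" unfolding cost_shift by simp
qed

lemma adm_iff_path_to: "adm F t z \<longleftrightarrow> (\<exists>k. path_to (\<lambda>r. F r + of_int (- k)) t (z - of_int k))"
proof
  assume F: "adm F t z"
  then have "F s0 - Y0 \<in> \<int>" by (simp add: adm_def)
  then obtain k where "F s0 - Y0 = of_int k" by (rule Ints_cases)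
  moreover have "H1 (\<lambda>r. F r + of_int (- k)) s0 t" using F by (simp only: H1_shift adm_def)
  ultimately have "path_to (\<lambda>r. F r + of_int (- k)) t (z - of_int k)"
    using F unfolding path_to_def adm_def by simp
  then show "\<exists>k. path_to (\<lambda>r. F r + of_int (- k)) t (z - of_int k)" by blast
next
  assume "\<exists>k. path_to (\<lambda>r. F r + of_int (- k)) t (z - of_int k)"
  then obtain k where k: "path_to (\<lambda>r. F r + of_int (- k)) t (z - of_int k)" by blast
  then have "H1 F s0 t" unfolding path_to_def using H1_shift[of F "of_int (- k)"] by simp
  moreover have "F s0 - Y0 = of_int k" "F t = z" using k by (simp_all add: path_to_def)
  ultimately show "adm F t z" by (simp add: adm_def)
qed

lemma tilted_min_iff:
  assumes t: "s0 < t"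
  shows "F \<in> tilted_min \<theta> t z \<longleftrightarrow>
    (\<exists>k. (\<lambda>r. F r + of_int (- k)) \<in> fixed_min t (z - of_int k) \<and> optimal_end \<theta> t (z - of_int k))"
proof
  assume F: "F \<in> tilted_min \<theta> t z"
  then obtain k where k: "path_to (\<lambda>r. F r + of_int (- k)) t (z - of_int k)"
    using adm_iff_path_to by (auto simp: tilted_min_def)
  have F0: "F s0 = Y0 + of_int k" using k by (simp add: path_to_def)
  have le: "J F s0 t + \<theta> * of_int k \<le> J H s0 t + \<theta> * of_int m" if H: "path_to H t (z - of_int m)" for H m
  proof -
    have "adm (\<lambda>r. H r + of_int m) t z"
      unfolding adm_iff_path_to using H by (intro exI[of _ m]) simp
    then have "cost \<theta> F t \<le> cost \<theta> (\<lambda>r. H r + of_int m) t" using F by (simp add: tilted_min_def)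
    then show ?thesis using H F0 unfolding cost_shift by (simp add: cost_def path_to_def algebra_simps)
  qed
  have JF: "J (\<lambda>r. F r + of_int (- k)) s0 t = J F s0 t" by (rule J_shift)
  have 1: "(\<lambda>r. F r + of_int (- k)) \<in> fixed_min t (z - of_int k)"
    unfolding fixed_min_def
  proof (intro CollectI conjI allI impI k)
    fix H assume "path_to H t (z - of_int k)"
    from le[OF this] show "J (\<lambda>r. F r + of_int (- k)) s0 t \<le> J H s0 t" unfolding JF by simp
  qed
  have "A t (z - of_int k) - \<theta> * (z - of_int k) \<le>
      A t (z - of_int k + of_int m) - \<theta> * (z - of_int k + of_int m)" for m
  proof -
    obtain H where H: "H \<in> fixed_min t (z - of_int (k - m))" using fixed_min_nonempty[OF t] by blast
    then have "path_to H t (z - of_int (k - m))" by (simp add: fixed_min_def)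
    from le[OF this] have "J F s0 t + \<theta> * of_int k \<le> A t (z - of_int (k - m)) + \<theta> * of_int (k - m)"
      using fixed_min_A[OF H] by simp
    then show ?thesis using fixed_min_A[OF 1] JF by (simp add: algebra_simps)
  qed
  then have "optimal_end \<theta> t (z - of_int k)" by (rule optimal_endI[OF t])
  then show "\<exists>k. (\<lambda>r. F r + of_int (- k)) \<in> fixed_min t (z - of_int k) \<and> optimal_end \<theta> t (z - of_int k)"
    using 1 by blast
next
  assume "\<exists>k. (\<lambda>r. F r + of_int (- k)) \<in> fixed_min t (z - of_int k) \<and> optimal_end \<theta> t (z - of_int k)"
  then obtain k where k: "(\<lambda>r. F r + of_int (- k)) \<in> fixed_min t (z - of_int k)" "optimal_end \<theta> t (z - of_int k)"
    by blast
  then have p: "path_to (\<lambda>r. F r + of_int (- k)) t (z - of_int k)" by (simp add: fixed_min_def)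
  have F0: "F s0 = Y0 + of_int k" using p by (simp add: path_to_def)
  have JF: "J (\<lambda>r. F r + of_int (- k)) s0 t = J F s0 t" by (rule J_shift)
  have "cost \<theta> F t \<le> cost \<theta> F' t" if F': "adm F' t z" for F'
  proof -
    obtain m where m: "path_to (\<lambda>r. F' r + of_int (- m)) t (z - of_int m)"
      using F' adm_iff_path_to by blast
    have F0': "F' s0 = Y0 + of_int m" using m by (simp add: path_to_def)
    have JF': "J (\<lambda>r. F' r + of_int (- m)) s0 t = J F' s0 t" by (rule J_shift)
    have "A t (z - of_int m) \<le> J F' s0 t" using A_le[OF m] JF' by simp
    moreover have "A t (z - of_int k) - \<theta> * (z - of_int k) \<le> A t (z - of_int m) - \<theta> * (z - of_int m)"
      using optimal_end_le[OF t k(2), of "k - m"] by simp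
    ultimately show ?thesis using fixed_min_A[OF k(1)] JF F0 F0' by (simp add: cost_def algebra_simps)
  qed
  then show "F \<in> tilted_min \<theta> t z" unfolding tilted_min_def using p adm_iff_path_to by blast
qed

lemma left_end_props:
  assumes t: "s0 < t"
  shows "b t \<theta> < left_end t \<theta> z" "left_end t \<theta> z \<le> b t \<theta> + 1" "left_end t \<theta> z - z \<in> \<int>" "optimal_end \<theta> t (left_end t \<theta> z)"
proof -
  have "left_end t \<theta> z = z + of_int (\<lfloor>b t \<theta> - z\<rfloor> + 1)" by (rule left_end_def)
  then show 1: "b t \<theta> < left_end t \<theta> z" "left_end t \<theta> z \<le> b t \<theta> + 1" by linarith+
  show "left_end t \<theta> z - z \<in> \<int>" by (simp add: left_end_def)
  show "optimal_end \<theta> t (left_end t \<theta> z)" using 1 a_le_b[OF t, of \<theta>] by (simp add: optimal_end_def)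
qed

lemma tilted_min_nonempty: "s0 < t \<Longrightarrow> tilted_min \<theta> t z \<noteq> {}"
proof -
  assume t: "s0 < t"
  obtain F where F: "F \<in> fixed_min t (left_end t \<theta> z)" using fixed_min_nonempty[OF t] by blast
  define k where "k = - (\<lfloor>b t \<theta> - z\<rfloor> + 1)"
  have k: "left_end t \<theta> z = z - of_int k" by (simp add: left_end_def k_def)
  have "(\<lambda>r. F r + of_int k) \<in> tilted_min \<theta> t z"
    unfolding tilted_min_iff[OF t] using F left_end_props(4)[OF t, of \<theta> z] by (intro exI[of _ k]) (simp add: k)
  then show ?thesis by blast
qed

lemma tilted_min_geod: "F \<in> tilted_min \<theta> t z \<Longrightarrow> geod F s0 t"
  unfolding geod_def
proof (intro conjI allI impI)
  assume F: "F \<in> tilted_min \<theta> t z"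
  then have a: "H1 F s0 t" "F t = z" "F s0 - Y0 \<in> \<int>" by (auto simp: tilted_min_def adm_def)
  show "H1 F s0 t" by (rule a(1))
  fix F' assume F': "H1 F' s0 t" "F' s0 = F s0" "F' t = F t"
  then have "adm F' t z" using a by (simp add: adm_def)
  then have "cost \<theta> F t \<le> cost \<theta> F' t" using F by (simp add: tilted_min_def)
  then show "J F s0 t \<le> J F' s0 t" using F' by (simp add: cost_def)
qed

lemma tilted_min_H1: "F \<in> tilted_min \<theta> t z \<Longrightarrow> H1 F s0 t"
  by (simp add: tilted_min_def adm_def)

lemma tilted_min_end: "F \<in> tilted_min \<theta> t z \<Longrightarrow> F t = z"
  by (simp add: tilted_min_def adm_def)

lemma tilted_min_start: "F \<in> tilted_min \<theta> t z \<Longrightarrow> F s0 - Y0 \<in> \<int>"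
  by (simp add: tilted_min_def adm_def)

lemma tilted_min_cong:
  assumes "F \<in> tilted_min \<theta> t z" "s0 \<le> t" "\<And>r. s0 \<le> r \<Longrightarrow> r \<le> t \<Longrightarrow> F' r = F r"
  shows "F' \<in> tilted_min \<theta> t z"
proof -
  have "H1 F' s0 t" using H1_cong(1)[of s0 t F' F] assms tilted_min_H1[OF assms(1)] by blast
  moreover have "cost \<theta> F' t = cost \<theta> F t"
    unfolding cost_def using J_cong[of s0 t F' F] assms(2,3) by simp
  moreover have "F' t = F t" "F' s0 = F s0" using assms(2,3) by auto
  ultimately show ?thesis using assms(1) unfolding tilted_min_def adm_def by simp
qed

lemma glue_cost:
  assumes "H1 F s0 r" "H1 F' r t" "F r = F' r" "s0 \<le> r" "r \<le> t"
  shows "cost \<theta> (glue r F F') t = cost \<theta> F r + J F' r t"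
  unfolding cost_def using J_glue[OF assms] assms(4) by (simp add: glue_def)

lemma tilted_min_sub:
  assumes F: "F \<in> tilted_min \<theta> t z" and r: "s0 \<le> r" "r \<le> t"
  shows "F \<in> tilted_min \<theta> r (F r)"
  unfolding tilted_min_def
proof (intro CollectI conjI allI impI)
  have a: "H1 F s0 t" "F t = z" "F s0 - Y0 \<in> \<int>" using F by (auto simp: tilted_min_def adm_def)
  have H: "H1 F s0 r" "H1 F r t" using H1_sub[OF a(1)] r by auto
  show "adm F r (F r)" using a H by (simp add: adm_def)
  fix F' assume F': "adm F' r (F r)"
  then have H': "H1 F' s0 r" "F' r = F r" "F' s0 - Y0 \<in> \<int>" by (auto simp: adm_def)
  have "adm (glue r F' F) t z"
    using glue_H1[OF H'(1) H(2) H'(2) r] a(2) H' r by (auto simp: adm_def glue_def)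
  then have "cost \<theta> F t \<le> cost \<theta> (glue r F' F) t" using F by (simp add: tilted_min_def)
  also have "\<dots> = cost \<theta> F' r + J F r t" by (rule glue_cost[OF H'(1) H(2) H'(2) r])
  finally show "cost \<theta> F r \<le> cost \<theta> F' r" using J_split[OF a(1) r] by (simp add: cost_def)
qed

text \<open>
  Any minimizer to a common point may be used before that point. All exchange arguments rest
  on this and on integer shifts.
\<close>

lemma tilted_min_glue:
  assumes F: "F \<in> tilted_min \<theta> t z" and F': "F' \<in> tilted_min \<theta> r (F r)" and r: "s0 \<le> r" "r \<le> t"
  shows "glue r F' F \<in> tilted_min \<theta> t z"
  unfolding tilted_min_def
proof (intro CollectI conjI allI impI)
  have a: "H1 F s0 t" "F t = z" "F s0 - Y0 \<in> \<int>" using F by (auto simp: tilted_min_def adm_def)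
  have H: "H1 F s0 r" "H1 F r t" using H1_sub[OF a(1)] r by auto
  have H': "H1 F' s0 r" "F' r = F r" "F' s0 - Y0 \<in> \<int>" using F' by (auto simp: tilted_min_def adm_def)
  show "adm (glue r F' F) t z"
    using glue_H1[OF H'(1) H(2) H'(2) r] a(2) H' r by (auto simp: adm_def glue_def)
  fix K assume K: "adm K t z"
  have "adm F r (F r)" using a H by (simp add: adm_def)
  then have "cost \<theta> F' r \<le> cost \<theta> F r" using F' by (simp add: tilted_min_def)
  moreover have "cost \<theta> F t = cost \<theta> F r + J F r t" using J_split[OF a(1) r] by (simp add: cost_def)
  moreover have "cost \<theta> F t \<le> cost \<theta> K t" using F K by (simp add: tilted_min_def)
  ultimately show "cost \<theta> (glue r F' F) t \<le> cost \<theta> K t"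
    using glue_cost[OF H'(1) H(2) H'(2) r, of \<theta>] by linarith
qed

end

section \<open>Extremal minimizers\<close>

lemma first_zero:
  fixes h :: "real \<Rightarrow> real"
  assumes c: "continuous_on {r..t} h" and "r \<le> t" "h r < 0" "0 \<le> h t"
  shows "\<exists>c. r < c \<and> c \<le> t \<and> h c = 0 \<and> (\<forall>q. r \<le> q \<longrightarrow> q < c \<longrightarrow> h q < 0)"
proof -
  let ?S = "{r..t} \<inter> h -` {0..}"
  have S: "closed ?S" by (rule continuous_closed_preimage[OF c]) auto
  have ne: "t \<in> ?S" using assms by simp
  have bdd: "bdd_below ?S" by (rule bdd_belowI[of _ r]) auto
  define c where "c = Inf ?S"
  have cS: "c \<in> ?S" unfolding c_def using ne bdd S by (intro closed_contains_Inf) auto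
  have neg: "h q < 0" if "r \<le> q" "q < c" for q
  proof (rule ccontr)
    assume "\<not> h q < 0"
    then have "q \<in> ?S" using that cS by auto
    then have "c \<le> q" unfolding c_def using bdd by (rule cInf_lower)
    then show False using that by simp
  qed
  have "r < c" using cS assms(3) by (cases "r = c") auto
  have "\<exists>q\<ge>r. q \<le> c \<and> h q = 0"
    using cS assms(3) continuous_on_subset[OF c, of "{r..c}"] by (intro IVT') auto
  then obtain q where q: "r \<le> q" "q \<le> c" "h q = 0" by blast
  then have "q = c" using neg[of q] by (cases "q < c") auto
  then show ?thesis using q cS neg \<open>r < c\<close> by auto
qed

lemma last_zero:
  fixes h :: "real \<Rightarrow> real"
  assumes c: "continuous_on {s..r} h" and "s \<le> r" "h r < 0" "0 \<le> h s"
  shows "\<exists>c. s \<le> c \<and> c < r \<and> h c = 0 \<and> (\<forall>q. c < q \<longrightarrow> q \<le> r \<longrightarrow> h q < 0)"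
proof -
  have "continuous_on {- r..- s} (\<lambda>q. h (- q))"
    by (rule continuous_on_compose2[OF c]) (auto intro!: continuous_intros)
  from first_zero[OF this] assms obtain c where c: "- r < c" "c \<le> - s" "h (- c) = 0"
    "\<And>q. - r \<le> q \<Longrightarrow> q < c \<Longrightarrow> h (- q) < 0" by auto
  have "h q < 0" if "- c < q" "q \<le> r" for q using c(4)[of "- q"] that by simp
  then show ?thesis using c(1-3) by (intro exI[of _ "- c"]) auto
qed

lemma chord_from_end:
  assumes "r < t" shows "chord r y t z q = z - (z - y) / (t - r) * (t - q)"
proof -
  have "m * (q - r) = m * (t - r) - m * (t - q)" for m :: real by (simp add: algebra_simps)
  from this[of "(z - y) / (t - r)"] show ?thesis using assms by (simp add: chord_def)
qed

lemma affine_two_points: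
  fixes m :: real
  assumes "p \<noteq> p'" "y + m * (p - c) = y' + m' * (p - c')" "y + m * (p' - c) = y' + m' * (p' - c')"
  shows "y + m * (q - c) = y' + m' * (q - c')"
proof -
  have "(m - m') * (p - p') = 0" using assms(2,3) by (simp add: algebra_simps)
  then have "m = m'" using assms(1) by simp
  then show ?thesis using assms(2) by (simp add: algebra_simps)
qed

context based_env begin

lemma fixed_min_last_ex:
  assumes "s0 < t" "F \<in> fixed_min t z"
  shows "\<exists>r y. s0 \<le> r \<and> r < t \<and> F r = y \<and> active t z (r, y) \<and> F \<in> fixed_min r y \<and>
    (\<forall>q. r \<le> q \<longrightarrow> q \<le> t \<longrightarrow> F q = chord r y t z q)"
proof (rule fixed_min_last[OF assms])
  fix r assume r: "s0 \<le> r" "r < t" "active t z (r, F r)" "F \<in> fixed_min r (F r)"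
    and ch: "\<And>q. r \<le> q \<Longrightarrow> q \<le> t \<Longrightarrow> F q = chord r (F r) t z q"
  show ?thesis
    by (intro exI[of _ r] exI[of _ "F r"] conjI allI impI r ch refl)
qed

text \<open>
  Induction on the number of atom times: a minimizer is determined by its last corner, one of
  finitely many, and its restriction to the time before.
\<close>

lemma finite_fixed_min:
  assumes "s0 \<le> t" shows "finite ((\<lambda>F. restrict F {s0..t}) ` fixed_min t z)"
  using assms
proof (induction "card (T \<inter> {s0<..<t})" arbitrary: t z rule: less_induct)
  case less
  have start: "finite ((\<lambda>F. restrict F {s0..s0}) ` fixed_min s0 z)" for z
  proof (rule finite_subset)
    show "(\<lambda>F. restrict F {s0..s0}) ` fixed_min s0 z \<subseteq> {restrict (\<lambda>_. Y0) {s0..s0}}"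
    proof
      fix f assume "f \<in> (\<lambda>F. restrict F {s0..s0}) ` fixed_min s0 z"
      then obtain F where F: "F \<in> fixed_min s0 z" "f = restrict F {s0..s0}" by blast
      then have "F s0 = Y0" by (simp add: fixed_min_def path_to_def)
      then have "f = restrict (\<lambda>_. Y0) {s0..s0}" unfolding F(2) by (intro ext) (simp add: restrict_def)
      then show "f \<in> {restrict (\<lambda>_. Y0) {s0..s0}}" by simp
    qed
  qed simp
  show ?case
  proof (cases "t = s0")
    case False
    with less have t: "s0 < t" by simp
    let ?g = "\<lambda>p f. restrict (glue (fst p) f (chord (fst p) (snd p) t z)) {s0..t}"
    let ?X = "\<Union>p\<in>{p. active t z p}. ?g p ` ((\<lambda>F. restrict F {s0..fst p}) ` fixed_min (fst p) (snd p))"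
    have "{p. active t z p} \<subseteq> {p. \<exists>u\<in>{z..z}. active t u p}" by auto
    then have fa: "finite {p. active t z p}" by (rule finite_subset) (rule finite_active[OF t])
    have finp: "finite ((\<lambda>F. restrict F {s0..fst p}) ` fixed_min (fst p) (snd p))" if p: "active t z p" for p
    proof (cases "fst p = s0")
      case True then show ?thesis using start by simp
    next
      case False
      obtain r y where ry: "p = (r, y)" by (cases p)
      have r: "s0 < r" "r < t" "w r y > 0" using p False by (auto simp: active_def corners_def ry)
      then have rT: "r \<in> T" by (auto simp: T_def)
      have "T \<inter> {s0<..<r} \<subset> T \<inter> {s0<..<t}" using r rT by auto
      then have "card (T \<inter> {s0<..<r}) < card (T \<inter> {s0<..<t})" by (intro psubset_card_mono) auto
      from less(1)[OF this] r(1) show ?thesis by (simp add: ry)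
    qed
    then have fX: "finite ?X" by (intro finite_UN_I[OF fa] finite_imageI[OF finp]) simp
    have "(\<lambda>F. restrict F {s0..t}) ` fixed_min t z \<subseteq> ?X"
    proof
      fix f assume "f \<in> (\<lambda>F. restrict F {s0..t}) ` fixed_min t z"
      then obtain F where F: "F \<in> fixed_min t z" "f = restrict F {s0..t}" by blast
      obtain r y where r: "s0 \<le> r" "r < t" "active t z (r, y)" "F \<in> fixed_min r y" "F r = y"
        and ch: "\<And>q. r \<le> q \<Longrightarrow> q \<le> t \<Longrightarrow> F q = chord r y t z q"
        using fixed_min_last_ex[OF t F(1)] by blast
      have eq: "f = ?g (r, y) (restrict F {s0..r})"
      proof (rule ext)
        fix q
        show "f q = ?g (r, y) (restrict F {s0..r}) q"
          unfolding F(2) using ch[of q] r(1,2)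
          by (cases "q < s0"; cases "q \<le> r"; cases "q \<le> t") (simp_all add: restrict_def glue_def)
      qed
      have "restrict F {s0..r} \<in> (\<lambda>F. restrict F {s0..fst (r, y)}) ` fixed_min (fst (r, y)) (snd (r, y))"
        using r(4) by simp
      then have "f \<in> ?g (r, y) ` (\<lambda>F. restrict F {s0..fst (r, y)}) ` fixed_min (fst (r, y)) (snd (r, y))"
        by (rule image_eqI[where f="?g (r, y)" and x="restrict F {s0..r}", OF eq])
      then show "f \<in> ?X" using r(3) by (intro UN_I[of "(r, y)"]) simp_all
    qed
    then show ?thesis using fX by (rule finite_subset)
  qed (use start in simp)
qed

lemma finite_tilted_min:
  assumes t: "s0 < t" shows "finite ((\<lambda>F. restrict F {s0..t}) ` tilted_min \<theta> t z)"
proof -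
  let ?K = "{k::int. optimal_end \<theta> t (z - of_int k)}"
  let ?X = "\<Union>k\<in>?K. (\<lambda>f. restrict (\<lambda>r. f r + of_int k) {s0..t}) `
     ((\<lambda>F. restrict F {s0..t}) ` fixed_min t (z - of_int k))"
  have "?K \<subseteq> {\<lceil>z - b t \<theta>\<rceil> - 1..\<lfloor>z - a t \<theta>\<rfloor>}"
  proof
    fix k assume "k \<in> ?K"
    then have "a t \<theta> \<le> z - of_int k" "z - of_int k \<le> b t \<theta> + 1" by (auto simp: optimal_end_def)
    then have "\<lceil>z - b t \<theta>\<rceil> - 1 \<le> k" "k \<le> \<lfloor>z - a t \<theta>\<rfloor>" by linarith+
    then show "k \<in> {\<lceil>z - b t \<theta>\<rceil> - 1..\<lfloor>z - a t \<theta>\<rfloor>}" by simp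
  qed
  then have fK: "finite ?K" by (rule finite_subset) simp
  have fX: "finite ?X" using t by (intro finite_UN_I[OF fK] finite_imageI[OF finite_fixed_min]) simp
  have "(\<lambda>F. restrict F {s0..t}) ` tilted_min \<theta> t z \<subseteq> ?X"
  proof
    fix f assume "f \<in> (\<lambda>F. restrict F {s0..t}) ` tilted_min \<theta> t z"
    then obtain F where F: "F \<in> tilted_min \<theta> t z" "f = restrict F {s0..t}" by blast
    then obtain k where k: "(\<lambda>r. F r + of_int (- k)) \<in> fixed_min t (z - of_int k)"
      "optimal_end \<theta> t (z - of_int k)" using tilted_min_iff[OF t] by blast
    have eq: "f = restrict (\<lambda>r. restrict (\<lambda>r. F r + of_int (- k)) {s0..t} r + of_int k) {s0..t}"
      unfolding F(2) by (rule ext) (simp add: restrict_def)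
    have "f \<in> (\<lambda>f. restrict (\<lambda>r. f r + of_int k) {s0..t}) `
        ((\<lambda>F. restrict F {s0..t}) ` fixed_min t (z - of_int k))"
      by (rule image_eqI[where f="\<lambda>f. restrict (\<lambda>r. f r + of_int k) {s0..t}" and
          x="restrict (\<lambda>r. F r + of_int (- k)) {s0..t}", OF eq]) (rule imageI[OF k(1)])
    then show "f \<in> ?X" using k(2) by (intro UN_I[of k]) simp_all
  qed
  then show ?thesis using fX by (rule finite_subset)
qed

text \<open>
  A minimal element of the finite set of minimizers is a least element: where another
  minimizer is smaller, insert it between the two neighbouring meeting times.
\<close>

lemma leftmost_exists:
  assumes t: "s0 < t"
  shows "\<exists>F\<in>tilted_min \<theta> t z. \<forall>F'\<in>tilted_min \<theta> t z. \<forall>r\<in>{s0..t}. F r \<le> F' r"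
proof -
  let ?R = "(\<lambda>F. restrict F {s0..t}) ` tilted_min \<theta> t z"
  have "?R \<noteq> {}" using tilted_min_nonempty[OF t] by blast
  from finite_has_minimal[OF finite_tilted_min[OF t] this] obtain f where
    f: "f \<in> ?R" "\<And>g. g \<in> ?R \<Longrightarrow> g \<le> f \<Longrightarrow> f = g" by blast
  then obtain F where F: "F \<in> tilted_min \<theta> t z" "f = restrict F {s0..t}" by blast
  have min: False if H: "H \<in> tilted_min \<theta> t z" "\<And>q. s0 \<le> q \<Longrightarrow> q \<le> t \<Longrightarrow> H q \<le> F q"
    and r: "s0 \<le> r" "r \<le> t" "H r < F r" for H r
  proof -
    have "restrict H {s0..t} \<le> f" unfolding F(2) le_fun_def using H(2) by (auto simp: restrict_def)
    moreover have "restrict H {s0..t} \<in> ?R" using H(1) by blast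
    ultimately have "f r = restrict H {s0..t} r" using f(2) by metis
    then show False using r unfolding F(2) by simp
  qed
  have "F r \<le> F' r" if F': "F' \<in> tilted_min \<theta> t z" and r: "s0 \<le> r" "r \<le> t" for F' r
  proof (rule ccontr)
    assume "\<not> F r \<le> F' r"
    then have lt: "F' r < F r" by simp
    have cont: "continuous_on {s0..t} (\<lambda>q. F' q - F q)"
      by (intro continuous_intros H1_continuous tilted_min_H1[OF F'] tilted_min_H1[OF F(1)])
    have "\<exists>c. r < c \<and> c \<le> t \<and> F' c - F c = 0 \<and> (\<forall>q. r \<le> q \<longrightarrow> q < c \<longrightarrow> F' q - F q < 0)"
      by (rule first_zero) (use r lt tilted_min_end[OF F'] tilted_min_end[OF F(1)] in
        \<open>auto intro: continuous_on_subset[OF cont]\<close>)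
    then obtain T2 where T2: "r < T2" "T2 \<le> t" "F' T2 = F T2" "\<And>q. r \<le> q \<Longrightarrow> q < T2 \<Longrightarrow> F' q < F q"
      by auto
    have "F' \<in> tilted_min \<theta> T2 (F T2)" using tilted_min_sub[OF F', of T2] T2 r by simp
    then have H1: "glue T2 F' F \<in> tilted_min \<theta> t z" using T2 r by (intro tilted_min_glue F) auto
    show False
    proof (cases "\<exists>q. s0 \<le> q \<and> q \<le> r \<and> F q \<le> F' q")
      case False
      have "glue T2 F' F q \<le> F q" if q: "s0 \<le> q" "q \<le> t" for q
      proof (cases "q \<le> r")
        case True then show ?thesis using False q T2 by (auto simp: glue_def)
      next
        case nle: False
        show ?thesis using T2(4)[of q] T2(3) nle
          by (cases "q < T2") (auto simp: glue_def)
      qed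
      then show False using min[OF H1 _ r] lt T2 by (auto simp: glue_def)
    next
      case True
      then obtain s where s: "s0 \<le> s" "s \<le> r" "F s \<le> F' s" by blast
      have "\<exists>c. s \<le> c \<and> c < r \<and> F' c - F c = 0 \<and> (\<forall>q. c < q \<longrightarrow> q \<le> r \<longrightarrow> F' q - F q < 0)"
        by (rule last_zero) (use r s lt in \<open>auto intro: continuous_on_subset[OF cont]\<close>)
      then obtain T1 where T1: "s \<le> T1" "T1 < r" "F' T1 = F T1"
        "\<And>q. T1 < q \<Longrightarrow> q \<le> r \<Longrightarrow> F' q < F q" by auto
      let ?H = "glue T1 F (glue T2 F' F)"
      have "F \<in> tilted_min \<theta> T1 (glue T2 F' F T1)" using tilted_min_sub[OF F(1), of T1] T1 T2 r s by (simp add: glue_def)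
      then have H: "?H \<in> tilted_min \<theta> t z" using T1 r s by (intro tilted_min_glue H1) auto
      have "?H q \<le> F q" if "s0 \<le> q" "q \<le> t" for q
        using T1(4)[of q] T2(3) T2(4)[of q] by (cases "q \<le> r"; cases "q < T2") (auto simp: glue_def)
      then show False using min[OF H _ r] lt T1 T2 by (auto simp: glue_def)
    qed
  qed
  then show ?thesis using F(1) by (intro bexI[of _ F]) auto
qed

lemma leftmost_eq:
  assumes "F \<in> tilted_min \<theta> t z" "\<forall>F'\<in>tilted_min \<theta> t z. \<forall>r\<in>{s0..t}. F r \<le> F' r" "s0 \<le> r" "r \<le> t"
  shows "leftmost \<theta> t z r = F r"
  unfolding leftmost_def by (rule cInf_eq_minimum) (use assms in auto)

lemma leftmost_tilted_min: "s0 < t \<Longrightarrow> leftmost \<theta> t z \<in> tilted_min \<theta> t z"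
  using leftmost_exists[of t \<theta> z] tilted_min_cong[of _ \<theta> t z "leftmost \<theta> t z"] leftmost_eq[of _ \<theta> t z]
  by (metis less_imp_le)

lemma leftmost_le: "s0 < t \<Longrightarrow> F \<in> tilted_min \<theta> t z \<Longrightarrow> s0 \<le> r \<Longrightarrow> r \<le> t \<Longrightarrow> leftmost \<theta> t z r \<le> F r"
  using leftmost_exists[of t \<theta> z] leftmost_eq[of _ \<theta> t z r] by (metis atLeastAtMost_iff)

text \<open>
  Being leftmost at the start means having the largest winding, and being leftmost just before
  t means having the steepest final slope.
\<close>

lemma leftmost_last:
  assumes t: "s0 < t"
  shows "\<exists>r y k. left_active t (left_end t \<theta> z) (r, y) \<and> z = left_end t \<theta> z + of_int k \<and> s0 \<le> r \<and> r < t \<and>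
    leftmost \<theta> t z r = y + of_int k \<and> leftmost \<theta> t z s0 = Y0 + of_int k \<and>
    (\<forall>q. r \<le> q \<longrightarrow> q \<le> t \<longrightarrow> leftmost \<theta> t z q = z - left_slope t (left_end t \<theta> z) * (t - q))"
proof -
  let ?L = "leftmost \<theta> t z"
  obtain k where k: "(\<lambda>r. ?L r + of_int (- k)) \<in> fixed_min t (z - of_int k)" "optimal_end \<theta> t (z - of_int k)"
    using leftmost_tilted_min[OF t, of \<theta> z] tilted_min_iff[OF t] by blast
  define H where "H = (\<lambda>r. ?L r + of_int (- k))"
  define v where "v = z - of_int k"
  have H: "H \<in> fixed_min t v" and o: "optimal_end \<theta> t v" using k by (simp_all add: H_def v_def)
  have LH: "?L q = H q + of_int k" for q by (simp add: H_def)
  have H0: "H s0 = Y0" "H t = v" using H by (auto simp: fixed_min_def path_to_def)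
  have shiftM: "(\<lambda>r. K r + of_int m) \<in> tilted_min \<theta> t z"
    if "K \<in> fixed_min t (z - of_int m)" "optimal_end \<theta> t (z - of_int m)" for K m
    unfolding tilted_min_iff[OF t] using that by (intro exI[of _ m]) simp
  have "b t \<theta> < v"
  proof (rule ccontr)
    assume "\<not> b t \<theta> < v"
    then have "optimal_end \<theta> t (z - of_int (k - 1))" using o by (simp add: optimal_end_def v_def)
    moreover obtain K where K: "K \<in> fixed_min t (z - of_int (k - 1))" using fixed_min_nonempty[OF t] by blast
    ultimately have "(\<lambda>r. K r + of_int (k - 1)) \<in> tilted_min \<theta> t z" by (rule shiftM[rotated])
    from leftmost_le[OF t this, of s0] have "?L s0 \<le> K s0 + of_int (k - 1)" using t by simp
    moreover have "K s0 = Y0" using K by (simp add: fixed_min_def path_to_def)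
    ultimately show False using LH[of s0] H0 by simp
  qed
  moreover have "v \<le> b t \<theta> + 1" using o by (simp add: optimal_end_def)
  moreover have "v - z \<in> \<int>" by (simp add: v_def)
  ultimately have zLv: "left_end t \<theta> z = v" by (rule left_end_unique)
  obtain r y where r: "s0 \<le> r" "r < t" "active t v (r, y)" "H \<in> fixed_min r y" "H r = y"
    and ch: "\<And>q. r \<le> q \<Longrightarrow> q \<le> t \<Longrightarrow> H q = chord r y t v q"
    using fixed_min_last_ex[OF t H] by blast
  obtain p where p: "left_active t v p" using left_active_exists[OF t] by blast
  obtain r' y' where p': "p = (r', y')" by (cases p)
  have ap: "active t v (r', y')" using left_active_active[OF p] p' by simp
  then have pP: "(r', y') \<in> corners t" by (simp add: active_def)
  have r': "s0 \<le> r'" "r' < t" using corners_time[OF t pP] by auto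
  obtain K where K: "K \<in> fixed_min r' y'" using corners_fixed_min_nonempty[OF t pP] by blast
  have "glue r' K (chord r' y' t v) \<in> fixed_min t (z - of_int k)"
    using A_le_parabola(3)[OF t pP K ap] by (simp add: v_def)
  from shiftM[OF this k(2)] have "(\<lambda>q. glue r' K (chord r' y' t v) q + of_int k) \<in> tilted_min \<theta> t z" .
  from leftmost_le[OF t this] have le: "H q \<le> glue r' K (chord r' y' t v) q" if "s0 \<le> q" "q \<le> t" for q
    using that LH[of q] by fastforce
  \<comment> \<open>A time after the last corners of both paths, where both are on their final straight pieces.\<close>
  define q where "q = (max r r' + t) / 2"
  have q: "r < q" "r' < q" "q < t" using r r' by (auto simp: q_def max_def)
  have "chord r y t v q \<le> chord r' y' t v q"
    using le[of q] ch[of q] q r(1) by (simp add: glue_def)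
  then have "slope t v (r', y') * (t - q) \<le> slope t v (r, y) * (t - q)"
    using chord_from_end[OF r(2), of y v q] chord_from_end[OF r'(2), of y' v q] by (simp add: slope_def)
  then have "slope t v (r', y') \<le> slope t v (r, y)" using q by simp
  then have lr: "left_active t v (r, y)" using p r(3) unfolding left_active_def p' by (meson order_trans)
  show ?thesis
  proof (rule exI[of _ r], rule exI[of _ y], rule exI[of _ k], intro conjI allI impI)
    show "left_active t (left_end t \<theta> z) (r, y)" using lr zLv by simp
    show "z = left_end t \<theta> z + of_int k" using zLv by (simp add: v_def)
    show "leftmost \<theta> t z r = y + of_int k" "leftmost \<theta> t z s0 = Y0 + of_int k" using LH H0 r(5) by auto
    show "leftmost \<theta> t z q = z - left_slope t (left_end t \<theta> z) * (t - q)" if "r \<le> q" "q \<le> t" for q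
      using LH[of q] ch[OF that] chord_from_end[OF r(2), of y v q] left_slope_eq[OF t lr] zLv
      by (simp add: slope_def v_def)
  qed (use r in auto)
qed

lemma leftmost_sub:
  assumes r: "s0 < r" "r \<le> t" and q: "s0 \<le> q" "q \<le> r"
  shows "leftmost \<theta> r (leftmost \<theta> t z r) q = leftmost \<theta> t z q"
proof (rule antisym)
  have t: "s0 < t" using r by simp
  have "leftmost \<theta> t z \<in> tilted_min \<theta> r (leftmost \<theta> t z r)" using tilted_min_sub[OF leftmost_tilted_min[OF t]] r by simp
  then show "leftmost \<theta> r (leftmost \<theta> t z r) q \<le> leftmost \<theta> t z q" by (rule leftmost_le[OF r(1) _ q])
  have "glue r (leftmost \<theta> r (leftmost \<theta> t z r)) (leftmost \<theta> t z) \<in> tilted_min \<theta> t z"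
    using r by (intro tilted_min_glue leftmost_tilted_min t) auto
  from leftmost_le[OF t this q(1)] show "leftmost \<theta> t z q \<le> leftmost \<theta> r (leftmost \<theta> t z r) q"
    using q r by (simp add: glue_def)
qed

lemma leftmost_shift:
  assumes t: "s0 < t" and q: "s0 \<le> q" "q \<le> t"
  shows "leftmost \<theta> t (z + of_int k) q = leftmost \<theta> t z q + of_int k"
proof (rule antisym)
  show "leftmost \<theta> t (z + of_int k) q \<le> leftmost \<theta> t z q + of_int k"
    using leftmost_le[OF t tilted_min_shift[OF leftmost_tilted_min[OF t, of \<theta> z], of k] q] .
  have "(\<lambda>r. leftmost \<theta> t (z + of_int k) r + of_int (- k)) \<in> tilted_min \<theta> t (z + of_int k + of_int (- k))"
    by (rule tilted_min_shift[OF leftmost_tilted_min[OF t]])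
  then have "(\<lambda>r. leftmost \<theta> t (z + of_int k) r + of_int (- k)) \<in> tilted_min \<theta> t z" by simp
  from leftmost_le[OF t this q] show "leftmost \<theta> t z q + of_int k \<le> leftmost \<theta> t (z + of_int k) q" by simp
qed

text \<open>
  The smallest optimal lift of the end point, reached by the rightmost minimizer.
\<close>

definition right_end :: "real \<Rightarrow> real \<Rightarrow> real \<Rightarrow> real" where
  "right_end t \<theta> z = z - of_int \<lfloor>z - a t \<theta>\<rfloor>"

lemma right_end_props:
  shows "a t \<theta> \<le> right_end t \<theta> z" "right_end t \<theta> z < a t \<theta> + 1" "right_end t \<theta> z - z \<in> \<int>"
  unfolding right_end_def by (linarith, linarith, simp)

lemma right_end_unique:
  assumes "a t \<theta> \<le> v" "v < a t \<theta> + 1" "v - z \<in> \<int>"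
  shows "right_end t \<theta> z = v"
proof -
  obtain k where k: "v - z = of_int k" using assms(3) by (rule Ints_cases)
  then have "v = z + of_int k" by simp
  moreover have "\<lfloor>z - a t \<theta>\<rfloor> = - k" using assms k by (intro floor_unique) auto
  ultimately show ?thesis by (simp add: right_end_def)
qed

end

context based_env begin

interpretation neg: based_env "\<lambda>r y. w r (- y)" s0 "- Y0" by (rule neg_env)

lemma neg_adm: "neg.adm F t (- z) \<longleftrightarrow> adm (\<lambda>r. - F r) t z"
proof -
  have "F s0 - - Y0 \<in> \<int> \<longleftrightarrow> - F s0 - Y0 \<in> \<int>"
  proof -
    have "- F s0 - Y0 = - (F s0 - - Y0)" by simp
    then show ?thesis by (metis minus_in_Ints_iff)
  qed
  then show ?thesis unfolding adm_def neg.adm_def by auto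
qed

lemma neg_tilted_min: "F \<in> neg.tilted_min (- \<theta>) t (- z) \<longleftrightarrow> (\<lambda>r. - F r) \<in> tilted_min \<theta> t z"
proof -
  have cost: "neg.cost (- \<theta>) F t = cost \<theta> (\<lambda>r. - F r) t" for F
    by (simp add: cost_def neg.cost_def neg_J)
  have "(\<forall>F'. neg.adm F' t (- z) \<longrightarrow> neg.cost (- \<theta>) F t \<le> neg.cost (- \<theta>) F' t) \<longleftrightarrow>
    (\<forall>F'. adm F' t z \<longrightarrow> cost \<theta> (\<lambda>r. - F r) t \<le> cost \<theta> F' t)" (is "?a \<longleftrightarrow> ?b")
  proof
    assume a: ?a
    show ?b
    proof (intro allI impI)
      fix F' assume "adm F' t z"
      then have "neg.adm (\<lambda>r. - F' r) t (- z)" by (simp add: neg_adm)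
      then show "cost \<theta> (\<lambda>r. - F r) t \<le> cost \<theta> F' t" using a unfolding cost by fastforce
    qed
  next
    assume ?b then show ?a unfolding cost neg_adm by blast
  qed
  then show ?thesis unfolding tilted_min_def neg.tilted_min_def neg_adm by blast
qed

lemma neg_tilted_min_image: "(\<lambda>F. F r) ` neg.tilted_min (- \<theta>) t (- z) = uminus ` (\<lambda>F. F r) ` tilted_min \<theta> t z"
proof (intro equalityI subsetI)
  fix x assume "x \<in> (\<lambda>F. F r) ` neg.tilted_min (- \<theta>) t (- z)"
  then obtain F where F: "F \<in> neg.tilted_min (- \<theta>) t (- z)" "x = F r" by blast
  then have "(\<lambda>r. - F r) \<in> tilted_min \<theta> t z" using neg_tilted_min by blast
  then have "- F r \<in> (\<lambda>F. F r) ` tilted_min \<theta> t z" by (rule image_eqI[where x="\<lambda>r. - F r", rotated]) simp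
  then show "x \<in> uminus ` (\<lambda>F. F r) ` tilted_min \<theta> t z" using F by (intro image_eqI[of _ _ "- F r"]) auto
next
  fix x assume "x \<in> uminus ` (\<lambda>F. F r) ` tilted_min \<theta> t z"
  then obtain F where F: "F \<in> tilted_min \<theta> t z" "x = - F r" by blast
  then have "(\<lambda>r. - F r) \<in> neg.tilted_min (- \<theta>) t (- z)" by (simp add: neg_tilted_min)
  then show "x \<in> (\<lambda>F. F r) ` neg.tilted_min (- \<theta>) t (- z)"
    by (rule image_eqI[where x="\<lambda>r. - F r", rotated]) (use F in simp)
qed

lemma neg_leftmost: "neg.leftmost (- \<theta>) t (- z) r = - rightmost \<theta> t z r"
  unfolding neg.leftmost_def rightmost_def neg_tilted_min_image Inf_real_def by (simp add: image_image)

lemma neg_rightmost: "neg.rightmost (- \<theta>) t (- z) r = - leftmost \<theta> t z r"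
  unfolding neg.rightmost_def leftmost_def neg_tilted_min_image Inf_real_def by simp

lemma rightmost_tilted_min: "s0 < t \<Longrightarrow> rightmost \<theta> t z \<in> tilted_min \<theta> t z"
  using neg.leftmost_tilted_min[of t "- \<theta>" "- z"] unfolding neg_tilted_min neg_leftmost by simp

lemma rightmost_ge:
  assumes "s0 < t" "F \<in> tilted_min \<theta> t z" "s0 \<le> r" "r \<le> t" shows "F r \<le> rightmost \<theta> t z r"
proof -
  have "(\<lambda>r. - F r) \<in> neg.tilted_min (- \<theta>) t (- z)" using assms(2) by (simp add: neg_tilted_min)
  from neg.leftmost_le[OF assms(1) this assms(3,4)] show ?thesis unfolding neg_leftmost by simp
qed

lemma rightmost_sub:
  assumes "s0 < r" "r \<le> t" "s0 \<le> q" "q \<le> r"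
  shows "rightmost \<theta> r (rightmost \<theta> t z r) q = rightmost \<theta> t z q"
  using neg.leftmost_sub[OF assms, of "- \<theta>" "- z"] unfolding neg_leftmost by simp

lemma rightmost_shift:
  assumes "s0 < t" "s0 \<le> q" "q \<le> t"
  shows "rightmost \<theta> t (z + of_int k) q = rightmost \<theta> t z q + of_int k"
proof -
  have "- z + of_int (- k) = - (z + of_int k)" by simp
  then have "neg.leftmost (- \<theta>) t (- (z + of_int k)) q = neg.leftmost (- \<theta>) t (- z) q + of_int (- k)"
    using neg.leftmost_shift[OF assms, of "- \<theta>" "- z" "- k"] by metis
  then show ?thesis unfolding neg_leftmost by simp
qed

lemma right_active_unique:
  assumes "s0 < t" "right_active t z p" "right_active t z p'" shows "p = p'"
proof -
  obtain r y r' y' where p: "p = (r, y)" "p' = (r', y')" by (cases p, cases p')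
  have "neg.left_active t (- z) (r, - y)" "neg.left_active t (- z) (r', - y')"
    using assms(2,3) by (simp_all add: p neg_left_active)
  from neg.left_active_unique[OF assms(1) this] show ?thesis by (simp add: p)
qed

lemma right_slope_eq: "s0 < t \<Longrightarrow> right_active t v p \<Longrightarrow> right_slope t v = slope t v p"
  unfolding right_slope_def using right_active_unique by (metis the_equality)

lemma right_active_active: "right_active t v p \<Longrightarrow> active t v p"
  by (simp add: right_active_def)

lemma right_slope_le_left_slope: "s0 < t \<Longrightarrow> right_slope t v \<le> left_slope t v"
  using left_active_exists[of t v] right_active_exists[of t v] left_active_le_right_active right_slope_eq left_slope_eq by metis

lemma neg_left_slope: "s0 < t \<Longrightarrow> neg.left_slope t (- v) = - right_slope t v"
proof -
  assume t: "s0 < t"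
  obtain p where p: "right_active t v p" using right_active_exists[OF t] by blast
  obtain r y where ry: "p = (r, y)" by (cases p)
  have "neg.left_active t (- v) (r, - y)" using p by (simp add: ry neg_left_active)
  from neg.left_slope_eq[OF t this] show ?thesis using right_slope_eq[OF t p] by (simp add: ry neg_slope)
qed

lemma neg_left_end: "s0 < t \<Longrightarrow> neg.left_end t (- \<theta>) (- z) = - right_end t \<theta> z"
proof -
  assume t: "s0 < t"
  have "- right_end t \<theta> z - - z \<in> \<int>" using Ints_minus[OF right_end_props(3)[of t \<theta> z]] by simp
  then show ?thesis
    using right_end_props(1,2)[of t \<theta> z] by (intro neg.left_end_unique) (auto simp: neg_b[OF t])
qed

lemma rightmost_last:
  assumes t: "s0 < t"
  shows "\<exists>r y k. right_active t (right_end t \<theta> z) (r, y) \<and> z = right_end t \<theta> z + of_int k \<and> s0 \<le> r \<and> r < t \<and>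
    rightmost \<theta> t z r = y + of_int k \<and> rightmost \<theta> t z s0 = Y0 + of_int k \<and>
    (\<forall>q. r \<le> q \<longrightarrow> q \<le> t \<longrightarrow> rightmost \<theta> t z q = z - right_slope t (right_end t \<theta> z) * (t - q))"
proof -
  obtain r y k where *: "neg.left_active t (- right_end t \<theta> z) (r, y)" "- z = - right_end t \<theta> z + of_int k" "s0 \<le> r" "r < t"
    "- rightmost \<theta> t z r = y + of_int k" "- rightmost \<theta> t z s0 = - Y0 + of_int k"
    and lin: "\<And>q. r \<le> q \<Longrightarrow> q \<le> t \<Longrightarrow> - rightmost \<theta> t z q = - z - neg.left_slope t (- right_end t \<theta> z) * (t - q)"
    using neg.leftmost_last[OF t, of "- \<theta>" "- z"] unfolding neg_leftmost neg_left_end[OF t] by blast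
  show ?thesis
  proof (rule exI[of _ r], rule exI[of _ "- y"], rule exI[of _ "- k"], intro conjI allI impI)
    show "right_active t (right_end t \<theta> z) (r, - y)" using *(1) neg_left_active[of t "right_end t \<theta> z" r "- y"] by simp
    show "rightmost \<theta> t z q = z - right_slope t (right_end t \<theta> z) * (t - q)" if "r \<le> q" "q \<le> t" for q
      using lin[OF that] neg_left_slope[OF t, of "right_end t \<theta> z"] by simp
  qed (use * in auto)
qed

end

section \<open>Branching and coalescence of the extremal minimizers\<close>

context based_env begin

text \<open>
  As the end point is prescribed, the starting point at time s0 records the winding; this is
  the number of extra windings of the leftmost minimizer.
\<close>

definition winding_gap :: "real \<Rightarrow> real \<Rightarrow> real \<Rightarrow> real" where
  "winding_gap \<theta> t z = rightmost \<theta> t z s0 - leftmost \<theta> t z s0"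

definition shock :: "real \<Rightarrow> real \<Rightarrow> real \<Rightarrow> bool" where
  "shock \<theta> t z \<longleftrightarrow> right_slope t (right_end t \<theta> z) < left_slope t (left_end t \<theta> z)"

text \<open>
  The last time before t at which the two extremal paths meet on the circle.
\<close>

definition meeting_time :: "real \<Rightarrow> real \<Rightarrow> real \<Rightarrow> real" where
  "meeting_time \<theta> t z = Sup {r. s0 \<le> r \<and> r < t \<and> rightmost \<theta> t z r - leftmost \<theta> t z r \<in> \<int>}"

definition global_shock :: "real \<Rightarrow> real \<Rightarrow> real \<Rightarrow> bool" where
  "global_shock \<theta> t z \<longleftrightarrow> shock \<theta> t z \<and> leftmost \<theta> t z (meeting_time \<theta> t z) < rightmost \<theta> t z (meeting_time \<theta> t z)"

lemma leftmost_le_rightmost: "s0 < t \<Longrightarrow> s0 \<le> r \<Longrightarrow> r \<le> t \<Longrightarrow> leftmost \<theta> t z r \<le> rightmost \<theta> t z r"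
  by (rule leftmost_le[OF _ rightmost_tilted_min])

lemma winding_gap_eq: "s0 < t \<Longrightarrow> winding_gap \<theta> t z = left_end t \<theta> z - right_end t \<theta> z"
proof -
  assume t: "s0 < t"
  obtain k where "z = left_end t \<theta> z + of_int k" "leftmost \<theta> t z s0 = Y0 + of_int k" using leftmost_last[OF t, of \<theta> z] by blast
  moreover obtain k where "z = right_end t \<theta> z + of_int k" "rightmost \<theta> t z s0 = Y0 + of_int k" using rightmost_last[OF t, of \<theta> z] by blast
  ultimately show ?thesis by (simp add: winding_gap_def)
qed

lemma winding_gap_Ints: "s0 < t \<Longrightarrow> winding_gap \<theta> t z \<in> \<int>"
  using tilted_min_start[OF leftmost_tilted_min, of t \<theta> z] tilted_min_start[OF rightmost_tilted_min, of t \<theta> z] Ints_diff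
  unfolding winding_gap_def by fastforce

lemma winding_gap_nonneg: "s0 < t \<Longrightarrow> 0 \<le> winding_gap \<theta> t z"
  using leftmost_le_rightmost[of t s0 \<theta> z] by (simp add: winding_gap_def)

lemma winding_gap_shift: "s0 < t \<Longrightarrow> winding_gap \<theta> t (z + of_int k) = winding_gap \<theta> t z"
  by (simp add: winding_gap_def leftmost_shift rightmost_shift)

lemma winding_gap_mono:
  assumes F: "F \<in> tilted_min \<theta> t z" and r: "s0 < r" "r \<le> t"
  shows "winding_gap \<theta> r (F r) \<le> winding_gap \<theta> t z"
proof -
  have t: "s0 < t" using r by simp
  have "glue r (leftmost \<theta> r (F r)) F \<in> tilted_min \<theta> t z" "glue r (rightmost \<theta> r (F r)) F \<in> tilted_min \<theta> t z"
    using r by (auto intro!: tilted_min_glue F leftmost_tilted_min rightmost_tilted_min)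
  from leftmost_le[OF t this(1), of s0] rightmost_ge[OF t this(2), of s0] show ?thesis
    using r by (simp add: winding_gap_def glue_def)
qed

text \<open>
  Equal final slopes with different windings force a common last corner, by
  \<open>same_slope\<close>; so the ambiguity of the winding is already present there.
\<close>

lemma branch:
  assumes t: "s0 < t" and ns: "\<not> shock \<theta> t z" and d: "0 < winding_gap \<theta> t z"
  obtains r where "s0 < r" "r < t" "0 < w r (leftmost \<theta> t z r)" "rightmost \<theta> t z r = leftmost \<theta> t z r"
    "winding_gap \<theta> r (leftmost \<theta> t z r) = winding_gap \<theta> t z"
proof -
  obtain r y k where L: "left_active t (left_end t \<theta> z) (r, y)" "z = left_end t \<theta> z + of_int k" "s0 \<le> r" "r < t"
    "leftmost \<theta> t z r = y + of_int k" "leftmost \<theta> t z s0 = Y0 + of_int k"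
    and Ll: "\<And>q. r \<le> q \<Longrightarrow> q \<le> t \<Longrightarrow> leftmost \<theta> t z q = z - left_slope t (left_end t \<theta> z) * (t - q)"
    using leftmost_last[OF t, of \<theta> z] by blast
  obtain r' y' k' where R: "right_active t (right_end t \<theta> z) (r', y')" "z = right_end t \<theta> z + of_int k'" "s0 \<le> r'" "r' < t"
    "rightmost \<theta> t z r' = y' + of_int k'" "rightmost \<theta> t z s0 = Y0 + of_int k'"
    and Rl: "\<And>q. r' \<le> q \<Longrightarrow> q \<le> t \<Longrightarrow> rightmost \<theta> t z q = z - right_slope t (right_end t \<theta> z) * (t - q)"
    using rightmost_last[OF t, of \<theta> z] by blast
  \<comment> \<open>A time after the last corners of both paths, where both are on their final straight pieces.\<close>
  define q where "q = (max r r' + t) / 2"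
  have q: "r < q" "r' < q" "q < t" using L R by (auto simp: q_def max_def)
  have "leftmost \<theta> t z q \<le> rightmost \<theta> t z q" using q L(3) by (intro leftmost_le_rightmost t) auto
  then have "right_slope t (right_end t \<theta> z) * (t - q) \<le> left_slope t (left_end t \<theta> z) * (t - q)" using Ll[of q] Rl[of q] q by simp
  then have "right_slope t (right_end t \<theta> z) \<le> left_slope t (left_end t \<theta> z)" using q by simp
  then have eq: "right_slope t (right_end t \<theta> z) = left_slope t (left_end t \<theta> z)" using ns by (simp add: shock_def)
  have right_end: "right_end t \<theta> z = left_end t \<theta> z + of_int (k - k')" using L(2) R(2) by simp
  have kk: "k - k' \<noteq> 0" using d L(6) R(6) by (auto simp: winding_gap_def)
  have a: "active t (left_end t \<theta> z) (r, y)" "active t (left_end t \<theta> z + of_int (k - k')) (r', y')"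
    using left_active_active[OF L(1)] right_active_active[OF R(1)] right_end by auto
  have slope: "slope t (left_end t \<theta> z) (r, y) = slope t (left_end t \<theta> z + of_int (k - k')) (r', y')"
    using eq left_slope_eq[OF t L(1)] right_slope_eq[OF t R(1)] right_end by simp
  have s: "r' = r" "y' = y + of_int (k - k')" using same_slope[OF t a slope] by auto
  have w: "s0 < r" "0 < w r y" using same_slope_time[OF t a slope kk] by auto
  have RL: "rightmost \<theta> t z r = leftmost \<theta> t z r" using R(5) L(5) s by simp
  show ?thesis
  proof (rule that[of r, OF w(1) L(4) _ RL])
    show "0 < w r (leftmost \<theta> t z r)" using w(2) L(5) w_period[of r y k] by simp
    show "winding_gap \<theta> r (leftmost \<theta> t z r) = winding_gap \<theta> t z"
      using leftmost_sub[of r t s0 \<theta> z] rightmost_sub[of r t s0 \<theta> z] w(1) L(4) RL by (simp add: winding_gap_def)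
  qed
qed

lemma isolated_time: "\<exists>\<delta>>0. T \<inter> {r - \<delta><..<r + \<delta>} \<subseteq> {r}"
proof -
  obtain d where d: "d > 0" "\<forall>x\<in>T \<inter> {r - 1..r + 1}. x \<noteq> r \<longrightarrow> d \<le> dist r x"
    using finite_set_avoid[OF finite_T] by blast
  have "T \<inter> {r - min d 1<..<r + min d 1} \<subseteq> {r}"
  proof
    fix x assume x: "x \<in> T \<inter> {r - min d 1<..<r + min d 1}"
    then have "x \<in> T \<inter> {r - 1..r + 1}" by auto
    moreover have "dist r x < d" using x by (auto simp: dist_real_def)
    ultimately show "x \<in> {r}" using d(2) by force
  qed
  then show ?thesis using d(1) by (intro exI[of _ "min d 1"]) auto
qed

text \<open>
  Switching from one path to the other at the meeting point gives a minimizer again, which has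
  to be straight where there is no weight. Hence the two paths agree around that point.
\<close>

lemma meeting_without_weight:
  assumes F: "F \<in> tilted_min \<theta> t z" and F': "F' \<in> tilted_min \<theta> t z'" and r: "s0 < r" "r < t" "F' r = F r"
    and w0: "w r (F r) = 0"
  shows "\<exists>q. r < q \<and> q < t \<and> F' q = F q"
proof -
  obtain d where d: "d > 0" "T \<inter> {r - d<..<r + d} \<subseteq> {r}" using isolated_time by blast
  define r1 where "r1 = max s0 (r - d / 2)"
  define r2 where "r2 = (r + min t (r + d)) / 2"
  have b: "s0 \<le> r1" "r1 < r" "r < r2" "r2 < t" "r - d < r1" "r2 < r + d"
    using r d(1) by (auto simp: r1_def r2_def min_def max_def field_simps)
  let ?K = "glue r F' F"
  have "F' \<in> tilted_min \<theta> r (F r)" using tilted_min_sub[OF F', of r] r by simp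
  then have K: "?K \<in> tilted_min \<theta> t z" using r by (intro tilted_min_glue F) auto
  have lin: "H q = H r1 + (H r2 - H r1) / (r2 - r1) * (q - r1)"
    if H: "H \<in> tilted_min \<theta> t y" "H r = F r" and q: "r1 \<le> q" "q \<le> r2" for H y q
  proof -
    have "\<forall>q\<in>T. r1 < q \<and> q < r2 \<longrightarrow> w q (H q) = 0"
    proof (intro ballI impI)
      fix q assume "q \<in> T" "r1 < q \<and> q < r2"
      then have "q \<in> T \<inter> {r - d<..<r + d}" using b by auto
      then have "q = r" using d(2) by blast
      then show "w q (H q) = 0" using H(2) w0 by simp
    qed
    from geod_linear[OF tilted_min_geod[OF H(1)] b(1) _ _ this q] show ?thesis using b by (simp add: chord_def)
  qed
  have K': "?K r = F r" using r by (simp add: glue_def)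
  have rr: "r \<noteq> r2" "r \<noteq> r1" using b by auto
  have rb: "r1 \<le> r" "r \<le> r2" "r1 \<le> r1" "r1 \<le> r2" "r2 \<le> r2" using b by auto
  have FK: "F q = ?K q" if q: "r1 \<le> q" "q \<le> r2" for q
  proof -
    have e1: "F r1 + (F r2 - F r1) / (r2 - r1) * (r - r1) = ?K r1 + (?K r2 - ?K r1) / (r2 - r1) * (r - r1)"
      using lin[OF F refl, of r] lin[OF K K', of r] rb K' by linarith
    have e2: "F r1 + (F r2 - F r1) / (r2 - r1) * (r2 - r1) = ?K r1 + (?K r2 - ?K r1) / (r2 - r1) * (r2 - r1)"
      using lin[OF F refl, of r2] lin[OF K K', of r2] rb b by (simp add: glue_def)
    show ?thesis
      using affine_two_points[OF rr(1) e1 e2, of q] lin[OF F refl q] lin[OF K K' q] by linarith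
  qed
  have FF1: "F' r1 = F r1" using FK[of r1] b by (simp add: glue_def)
  have e1: "F r1 + (F r2 - F r1) / (r2 - r1) * (r - r1) = F' r1 + (F' r2 - F' r1) / (r2 - r1) * (r - r1)"
    using lin[OF F refl, of r] lin[OF F' r(3), of r] rb r(3) by linarith
  have e2: "F r1 + (F r2 - F r1) / (r2 - r1) * (r1 - r1) = F' r1 + (F' r2 - F' r1) / (r2 - r1) * (r1 - r1)"
    using FF1 by simp
  have "F' r2 = F r2"
    using affine_two_points[OF rr(2) e1 e2, of r2] lin[OF F refl, of r2] lin[OF F' r(3), of r2] rb by linarith
  then show ?thesis using b by blast
qed

text \<open>
  Going back from a shock the two paths separate at once, so their difference runs through (0,
  1) until it first becomes 0 or 1. The shock is global in the second case. The meeting point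
  carries weight unless it is the base point.
\<close>

lemma coalesce:
  assumes t: "s0 < t" and sh: "shock \<theta> t z"
  defines "e \<equiv> rightmost \<theta> t z (meeting_time \<theta> t z) - leftmost \<theta> t z (meeting_time \<theta> t z)"
  shows "s0 \<le> meeting_time \<theta> t z" "meeting_time \<theta> t z < t" "e = 0 \<or> e = 1"
    and "\<And>q. meeting_time \<theta> t z < q \<Longrightarrow> q < t \<Longrightarrow> rightmost \<theta> t z q - leftmost \<theta> t z q \<notin> \<int>"
    and "s0 < meeting_time \<theta> t z \<Longrightarrow> 0 < w (meeting_time \<theta> t z) (leftmost \<theta> t z (meeting_time \<theta> t z))"
    and "winding_gap \<theta> t z = e + (if s0 < meeting_time \<theta> t z then winding_gap \<theta> (meeting_time \<theta> t z) (leftmost \<theta> t z (meeting_time \<theta> t z)) else 0)"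
proof -
  obtain r where L: "s0 \<le> r" "r < t"
    and Ll: "\<And>q. r \<le> q \<Longrightarrow> q \<le> t \<Longrightarrow> leftmost \<theta> t z q = z - left_slope t (left_end t \<theta> z) * (t - q)"
    using leftmost_last[OF t, of \<theta> z] by blast
  obtain r' where R: "s0 \<le> r'" "r' < t"
    and Rl: "\<And>q. r' \<le> q \<Longrightarrow> q \<le> t \<Longrightarrow> rightmost \<theta> t z q = z - right_slope t (right_end t \<theta> z) * (t - q)"
    using rightmost_last[OF t, of \<theta> z] by blast
  define h where "h q = rightmost \<theta> t z q - leftmost \<theta> t z q" for q
  define c where "c = left_slope t (left_end t \<theta> z) - right_slope t (right_end t \<theta> z)"
  have c: "c > 0" using sh by (simp add: shock_def c_def)
  \<comment> \<open>From this time on the two paths differ by less than 1.\<close>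
  define q1 where "q1 = max (max r r') (t - 1 / (2 * c))"
  have q1: "s0 \<le> q1" "q1 < t" using L R c by (auto simp: q1_def)
  have h1: "0 < h q \<and> h q < 1" if q: "q1 \<le> q" "q < t" for q
  proof -
    have "h q = c * (t - q)" using Ll[of q] Rl[of q] q by (simp add: h_def c_def q1_def algebra_simps)
    moreover have "t - q \<le> 1 / (2 * c)" using q by (simp add: q1_def)
    then have "c * (t - q) \<le> c * (1 / (2 * c))" using c by (intro mult_left_mono) auto
    ultimately show ?thesis using c q by simp
  qed
  have nonint: "x \<notin> \<int>" if "0 < x" "x < 1" for x :: real
  proof
    assume "x \<in> \<int>" then obtain i where "x = of_int i" by (rule Ints_cases)
    then show False using that by simp
  qed
  have cont: "continuous_on {s0..t} h"
    unfolding h_def by (intro continuous_intros H1_continuous tilted_min_H1[OF leftmost_tilted_min[OF t]] tilted_min_H1[OF rightmost_tilted_min[OF t]])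
  let ?S = "{s0..q1} \<inter> h -` \<int>"
  have cont1: "continuous_on {s0..q1} h" using q1 by (intro continuous_on_subset[OF cont]) auto
  have clo: "closed ?S" by (rule continuous_closed_preimage[OF cont1]) auto
  have s0S: "s0 \<in> ?S" using winding_gap_Ints[OF t, of \<theta> z] q1 by (simp add: winding_gap_def h_def)
  have bdd: "bdd_above ?S" by (rule bdd_aboveI[of _ q1]) auto
  have "{r. s0 \<le> r \<and> r < t \<and> rightmost \<theta> t z r - leftmost \<theta> t z r \<in> \<int>} = ?S"
  proof (intro equalityI subsetI)
    fix x assume x: "x \<in> {r. s0 \<le> r \<and> r < t \<and> rightmost \<theta> t z r - leftmost \<theta> t z r \<in> \<int>}"
    then have "h x \<in> \<int>" by (simp add: h_def)
    then have "x \<le> q1" using h1[of x] nonint[of "h x"] x by (cases "x \<le> q1") auto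
    then show "x \<in> ?S" using x by (simp add: h_def)
  qed (use q1 in \<open>auto simp: h_def\<close>)
  then have mS: "meeting_time \<theta> t z = Sup ?S" by (simp add: meeting_time_def)
  define m where "m = meeting_time \<theta> t z"
  have mm: "m \<in> ?S" unfolding m_def mS using s0S bdd clo by (intro closed_contains_Sup) auto
  have gt: "h q \<notin> \<int>" if q: "m < q" "q < t" for q
  proof
    assume hq: "h q \<in> \<int>"
    then have "q \<le> q1" using h1[of q] nonint[of "h q"] q by (cases "q \<le> q1") auto
    then have "q \<in> ?S" using hq q mm by auto
    then have "q \<le> m" unfolding m_def mS using bdd by (rule cSup_upper)
    then show False using q by simp
  qed
  have mq: "m < q1"
    using mm h1[of q1] nonint[of "h q1"] q1 by (cases "m = q1") auto
  have hm_nonneg: "0 \<le> h m" using mm q1 leftmost_le_rightmost[OF t, of m \<theta> z] by (simp add: h_def)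
  have "h m \<le> 1"
  proof (rule ccontr)
    assume nle: "\<not> h m \<le> 1"
    have "\<exists>q\<ge>m. q \<le> q1 \<and> h q = 1"
      using nle h1[of q1] q1 mm by (intro IVT2') (auto intro: continuous_on_subset[OF cont1])
    then obtain q where q: "m \<le> q" "q \<le> q1" "h q = 1" by blast
    then have "m < q" using nle by (cases "m = q") auto
    then show False using gt[of q] q q1 by simp
  qed
  moreover obtain i where i: "h m = of_int i" using mm by (auto elim: Ints_cases)
  ultimately have i01: "i = 0 \<or> i = 1" using hm_nonneg by auto
  have eh: "e = h m" by (simp add: e_def h_def m_def)
  show "s0 \<le> meeting_time \<theta> t z" "meeting_time \<theta> t z < t" using mm q1 by (auto simp: m_def)
  show "e = 0 \<or> e = 1" using eh i i01 by auto
  show "rightmost \<theta> t z q - leftmost \<theta> t z q \<notin> \<int>" if "meeting_time \<theta> t z < q" "q < t" for q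
    using gt[of q] that by (simp add: h_def m_def)
  have Rm: "rightmost \<theta> t z m = leftmost \<theta> t z m + of_int i" using i by (simp add: h_def)
  show "0 < w (meeting_time \<theta> t z) (leftmost \<theta> t z (meeting_time \<theta> t z))" if s: "s0 < meeting_time \<theta> t z"
  proof (rule ccontr)
    assume "\<not> ?thesis"
    then have w0: "w m (leftmost \<theta> t z m) = 0" using w_nonneg[of m "leftmost \<theta> t z m"] by (simp add: m_def)
    have F': "(\<lambda>q. rightmost \<theta> t z q + of_int (- i)) \<in> tilted_min \<theta> t (z + of_int (- i))"
      by (rule tilted_min_shift[OF rightmost_tilted_min[OF t]])
    have "m < t" using mq q1 by simp
    from meeting_without_weight[OF leftmost_tilted_min[OF t] F' _ this _ w0] s Rm obtain q where
      q: "m < q" "q < t" "rightmost \<theta> t z q + of_int (- i) = leftmost \<theta> t z q" by (auto simp: m_def)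
    then have "h q = of_int i" by (simp add: h_def)
    then show False using gt[OF q(1,2)] by simp
  qed
  show "winding_gap \<theta> t z = e + (if s0 < meeting_time \<theta> t z then winding_gap \<theta> (meeting_time \<theta> t z) (leftmost \<theta> t z (meeting_time \<theta> t z)) else 0)"
  proof (cases "s0 < m")
    case True
    have mt: "m \<le> t" using mq q1 by simp
    have "rightmost \<theta> m (leftmost \<theta> t z m + of_int i) s0 = rightmost \<theta> t z s0"
      using rightmost_sub[OF True mt, of s0 \<theta> z] Rm True by simp
    then have "rightmost \<theta> m (leftmost \<theta> t z m) s0 = rightmost \<theta> t z s0 - of_int i"
      using rightmost_shift[of m s0 \<theta> "leftmost \<theta> t z m" i] True by simp
    then show ?thesis using leftmost_sub[OF True mt, of s0 \<theta> z] True i eh by (simp add: winding_gap_def m_def)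
  next
    case False
    then have "m = s0" using mm by simp
    then show ?thesis using False eh by (simp add: winding_gap_def h_def m_def)
  qed
qed

end

section \<open>Last corners and flat pieces of the winding cost\<close>

context based_env begin

text \<open>
  Each unit step within the flat range of the winding cost keeps the last corner modulo 1.
\<close>

lemma left_active_chain:
  assumes t: "s0 < t" and p: "left_active t (left_end t \<theta> z) (r, y)"
  shows "a t \<theta> < left_end t \<theta> z - real n \<Longrightarrow> left_active t (left_end t \<theta> z - real n) (r, y - real n) \<and> (0 < n \<longrightarrow> s0 < r \<and> 0 < w r y)"
proof (induction n)
  case (Suc n)
  let ?v = "left_end t \<theta> z - real (Suc n)"
  have IH: "left_active t (?v + 1) (r, y - real n)" using Suc by simp
  have "?v \<le> b t \<theta>" using left_end_props(2)[OF t, of \<theta> z] by simp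
  then have G: "G t ?v = \<theta>" using G_eq_iff[OF t, of ?v \<theta>] Suc.prems by simp
  have eq: "left_slope t (?v + 1) = left_slope t ?v"
    by (rule flat_left_imp_slopes[OF t Suc.prems]) (simp only: G G_a[OF t])
  obtain p0 where p0: "left_active t ?v p0" using left_active_exists[OF t] by blast
  note sh = slopes_imp_shift[OF t p0 IH eq]
  have f: "fst p0 = r" "snd p0 = y - real (Suc n)" using sh(1) by simp_all
  then have "p0 = (r, y - real (Suc n))" by (simp add: prod_eq_iff)
  moreover have "0 < w r y"
  proof -
    have "w r (y - real (Suc n)) = w r y" by (rule w_period_Ints) simp
    then show ?thesis using sh(3) unfolding f by simp
  qed
  ultimately show ?case using p0 sh(2) f by simp
qed (use p in simp)

text \<open>
  If the winding cost is flat to the left of v, then v and v + 1 are reached through the same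
  corner modulo 1, so that corner itself admits two optimal windings. Conversely, if the last
  corner admits two windings, then all end points that are reached through it have winding
  cost \<open>\<theta>\<close>.
\<close>

lemma left_corner:
  assumes t: "s0 < t"
  shows "\<exists>r. s0 \<le> r \<and> r < t \<and>
    (\<forall>n. 0 < n \<longrightarrow> a t \<theta> < left_end t \<theta> z - real n \<longrightarrow>
       s0 < r \<and> 0 < w r (leftmost \<theta> t z r) \<and> real n \<le> winding_gap \<theta> r (leftmost \<theta> t z r)) \<and>
    (s0 < r \<longrightarrow> 1 \<le> winding_gap \<theta> r (leftmost \<theta> t z r) \<longrightarrow> a t \<theta> < left_end t \<theta> z - 1) \<and>
    (\<forall>q. r < q \<longrightarrow> q < t \<longrightarrow> w q (leftmost \<theta> t z q) = 0)"
proof -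
  obtain r y k where L: "left_active t (left_end t \<theta> z) (r, y)" "z = left_end t \<theta> z + of_int k" "s0 \<le> r" "r < t"
    "leftmost \<theta> t z r = y + of_int k" "leftmost \<theta> t z s0 = Y0 + of_int k"
    and Ll: "\<And>q. r \<le> q \<Longrightarrow> q \<le> t \<Longrightarrow> leftmost \<theta> t z q = z - left_slope t (left_end t \<theta> z) * (t - q)"
    using leftmost_last[OF t, of \<theta> z] by blast
  let ?c = "leftmost \<theta> t z r"
  have active: "active t (left_end t \<theta> z) (r, y)" by (rule left_active_active[OF L(1)])
  have LM: "leftmost \<theta> t z \<in> tilted_min \<theta> r ?c" using tilted_min_sub[OF leftmost_tilted_min[OF t]] L(3,4) by simp
  have 1: "s0 < r \<and> 0 < w r ?c \<and> real n \<le> winding_gap \<theta> r ?c"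
    if n: "0 < n" "a t \<theta> < left_end t \<theta> z - real n" for n
  proof -
    have ch: "left_active t (left_end t \<theta> z - real n) (r, y - real n)" "s0 < r" "0 < w r y"
      using left_active_chain[OF t L(1) n(2)] n(1) by auto
    have an: "active t (left_end t \<theta> z - real n) (r, y - real n)" by (rule left_active_active[OF ch(1)])
    have pn: "(r, y - real n) \<in> corners t" using an by (simp add: active_def)
    obtain F where F: "F \<in> fixed_min r (y - real n)" using corners_fixed_min_nonempty[OF t pn] by blast
    let ?K = "glue r F (chord r (y - real n) t (left_end t \<theta> z - real n))"
    let ?k = "k + int n"
    have v: "left_end t \<theta> z - real n = z - of_int ?k" using L(2) by simp
    have "?K \<in> fixed_min t (z - of_int ?k)" using A_le_parabola(3)[OF t pn F an] unfolding v .
    moreover have "optimal_end \<theta> t (z - of_int ?k)"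
      using n(2) left_end_props(2)[OF t, of \<theta> z] v[symmetric] by (simp add: optimal_end_def)
    ultimately have "(\<lambda>q. ?K q + of_int ?k) \<in> tilted_min \<theta> t z"
      unfolding tilted_min_iff[OF t] by (intro exI[of _ ?k]) simp
    from tilted_min_sub[OF this L(3)] L(4) have "(\<lambda>q. ?K q + of_int ?k) \<in> tilted_min \<theta> r (?K r + of_int ?k)" by simp
    moreover have "?K r + of_int ?k = ?c" using F L(5) by (simp add: glue_def fixed_min_def path_to_def)
    ultimately have "(\<lambda>q. ?K q + of_int ?k) \<in> tilted_min \<theta> r ?c" by simp
    from rightmost_ge[OF ch(2) this, of s0] ch(2) have "?K s0 + of_int ?k \<le> rightmost \<theta> r ?c s0" by simp
    moreover have "?K s0 = Y0" using F L(3) by (simp add: glue_def fixed_min_def path_to_def)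
    moreover have "leftmost \<theta> r ?c s0 = Y0 + of_int k" using leftmost_sub[OF ch(2), of t s0 \<theta> z] ch(2) L(4,6) by simp
    ultimately have "real n \<le> winding_gap \<theta> r ?c" by (simp add: winding_gap_def)
    moreover have "0 < w r ?c" using ch(3) L(5) w_period[of r y k] by simp
    ultimately show ?thesis using ch(2) by blast
  qed
  have 2: "a t \<theta> < left_end t \<theta> z - 1" if r: "s0 < r" and d: "1 \<le> winding_gap \<theta> r ?c"
  proof -
    have start: "optimal_end \<theta> r (?c - of_int m)" if K: "K \<in> tilted_min \<theta> r ?c" "K s0 = Y0 + of_int m" for K m
    proof -
      obtain m' where m': "(\<lambda>q. K q + of_int (- m')) \<in> fixed_min r (?c - of_int m')"
        "optimal_end \<theta> r (?c - of_int m')" using K(1) tilted_min_iff[OF r] by blast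
      have "K s0 + of_int (- m') = Y0" using m'(1) by (simp add: fixed_min_def path_to_def)
      then have "m' = m" using K(2) by simp
      then show ?thesis using m'(2) by simp
    qed
    have o1: "optimal_end \<theta> r (?c - of_int k)" by (rule start[OF LM L(6)])
    have L0: "leftmost \<theta> r ?c s0 = Y0 + of_int k" using leftmost_sub[OF r, of t s0 \<theta> z] r L(4,6) by simp
    obtain j where j: "winding_gap \<theta> r ?c = of_int j" using winding_gap_Ints[OF r] by (rule Ints_cases)
    have "rightmost \<theta> r ?c s0 = Y0 + of_int (k + j)" using L0 j by (simp add: winding_gap_def)
    then have o2: "optimal_end \<theta> r (?c - of_int (k + j))" by (rule start[OF rightmost_tilted_min[OF r]])
    have j1: "1 \<le> j" using d j by simp
    have "a r \<theta> \<le> y - 1" "y - 1 \<le> b r \<theta>"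
      using o1 o2 j1 L(5) by (auto simp: optimal_end_def)
    then have Gr: "G r (y - 1) = \<theta>" using G_eq_iff[OF r] by simp
    obtain e where e: "e > 0" "\<And>u. left_end t \<theta> z - e \<le> u \<Longrightarrow> u \<le> left_end t \<theta> z \<Longrightarrow> active t u (r, y)"
      using left_active_local[OF t L(1)] by blast
    define u where "u = left_end t \<theta> z - e"
    have "active t u (r, y)" using e(1) by (intro e(2)) (auto simp: u_def)
    then have Au: "A t u = parabola (r, y) t u" by (simp add: active_def)
    have "(r, y + of_int (- 1)) \<in> corners t" using active r by (intro corners_int_shift) (auto simp: active_def)
    from A_le_parabola(1)[OF t this, of "u - 1"]
    have "A t (u - 1) \<le> parabola (r, y - 1) t (u - 1)" by simp
    also have "\<dots> = parabola (r, y) t u - \<theta>"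
      using Gr w_period[of r y "- 1"] by (simp add: parabola_def G_def)
    finally have "\<theta> \<le> G t (u - 1)" using Au by (simp add: G_def)
    then have "a t \<theta> \<le> u - 1" using a_le_iff[OF t] by blast
    then show ?thesis using e(1) by (simp add: u_def)
  qed
  have 3: "w q (leftmost \<theta> t z q) = 0" if q: "r < q" "q < t" for q
  proof -
    have "leftmost \<theta> t z q = z - left_slope t (left_end t \<theta> z) * (t - q)" using q by (intro Ll) auto
    also have "\<dots> = chord r y t (left_end t \<theta> z) q + of_int k"
      using chord_from_end[OF L(4), of y "left_end t \<theta> z" q] left_slope_eq[OF t L(1)] L(2) by (simp add: slope_def)
    finally show ?thesis using active_no_visits[OF t active q] w_period by simp
  qed
  show ?thesis using 1 2 3 L(3,4) by blast
qed

end

context based_env begin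

interpretation neg: based_env "\<lambda>r y. w r (- y)" s0 "- Y0" by (rule neg_env)

lemma neg_winding_gap: "neg.winding_gap (- \<theta>) r (- y) = winding_gap \<theta> r y"
  by (simp add: winding_gap_def neg.winding_gap_def neg_leftmost neg_rightmost)

lemma right_corner:
  assumes t: "s0 < t"
  shows "\<exists>r. s0 \<le> r \<and> r < t \<and>
    (\<forall>n. 0 < n \<longrightarrow> right_end t \<theta> z + real n - 1 < b t \<theta> \<longrightarrow>
       s0 < r \<and> 0 < w r (rightmost \<theta> t z r) \<and> real n \<le> winding_gap \<theta> r (rightmost \<theta> t z r)) \<and>
    (s0 < r \<longrightarrow> 1 \<le> winding_gap \<theta> r (rightmost \<theta> t z r) \<longrightarrow> right_end t \<theta> z < b t \<theta>) \<and>
    (\<forall>q. r < q \<longrightarrow> q < t \<longrightarrow> w q (rightmost \<theta> t z q) = 0)"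
proof -
  have e: "neg.a t (- \<theta>) < neg.left_end t (- \<theta>) (- z) - x \<longleftrightarrow> right_end t \<theta> z + x - 1 < b t \<theta>" for x
    unfolding neg_a[OF t] neg_left_end[OF t] by linarith
  show ?thesis
    using neg.left_corner[OF t, of "- \<theta>" "- z"] unfolding e unfolding neg_leftmost neg_winding_gap by simp
qed

lemma flat_right_imp_slopes:
  assumes t: "s0 < t" and u: "v < u" "G t u = G t v"
  shows "right_slope t (v + 1) = right_slope t v"
proof -
  have "- u - 1 < - v - 1" "neg.G t (- u - 1) = neg.G t (- v - 1)" using u by (simp_all add: neg_G)
  from neg.flat_left_imp_slopes[OF t this] show ?thesis
    using neg_left_slope[OF t, of v] neg_left_slope[OF t, of "v + 1"] by simp
qed

lemma neg_Dl1: "s0 < t \<Longrightarrow> neg.left_slope t (- 1 - v) = - right_slope t (v + 1)"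
proof -
  assume t: "s0 < t"
  have "- 1 - v = - (v + 1)" by simp
  then show ?thesis by (simp only: neg_left_slope[OF t])
qed

lemma b_slope_pos:
  assumes t: "s0 < t" shows "right_slope t (b t \<theta>) < right_slope t (b t \<theta> + 1)"
  using neg.a_slope_pos[OF t, of "- \<theta>"] neg_left_slope[OF t, of "b t \<theta>"] neg_Dl1[OF t, of "b t \<theta>"]
  by (simp add: neg_a[OF t])

lemma b_right_deriv:
  assumes t: "s0 < t"
  shows "(b t has_real_derivative 1 / (right_slope t (b t \<theta> + 1) - right_slope t (b t \<theta>))) (at \<theta> within {\<theta>..})"
proof -
  let ?D = "1 / (right_slope t (b t \<theta> + 1) - right_slope t (b t \<theta>))"
  have "(neg.a t has_real_derivative ?D) (at (- \<theta>) within {..- \<theta>})"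
    using neg.a_left_deriv[OF t, of "- \<theta>"] neg_left_slope[OF t, of "b t \<theta>"] neg_Dl1[OF t, of "b t \<theta>"]
    by (simp add: neg_a[OF t])
  then have "(neg.a t has_real_derivative ?D) (at (- \<theta>) within uminus ` {\<theta>..})" by simp
  moreover have "(uminus has_real_derivative - 1) (at \<theta> within {\<theta>..})"
    by (auto intro!: derivative_eq_intros)
  ultimately have "(neg.a t \<circ> uminus has_real_derivative ?D * - 1) (at \<theta> within {\<theta>..})"
    by (rule DERIV_image_chain)
  then have "((\<lambda>x. - 1 - (neg.a t \<circ> uminus) x) has_real_derivative 0 - ?D * - 1) (at \<theta> within {\<theta>..})"
    by (intro DERIV_diff DERIV_const)
  moreover have "(\<lambda>x. - 1 - (neg.a t \<circ> uminus) x) = b t" by (simp add: fun_eq_iff neg_a[OF t])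
  ultimately show ?thesis by simp
qed

theorem right_jump_sum:
  assumes t: "s0 < t" and le: "\<theta>1 < \<theta>2"
  shows "((\<lambda>\<theta>. right_slope t (b t \<theta> + 1) - right_slope t (b t \<theta>)) has_sum (right_slope t (right_end t \<theta>2 z) - right_slope t (right_end t \<theta>1 z)))
     {\<theta> \<in> {\<theta>1..<\<theta>2}. b t \<theta> - z \<in> \<int>}"
proof -
  let ?g = "\<lambda>\<theta>. neg.left_slope t (neg.a t \<theta> + 1) - neg.left_slope t (neg.a t \<theta>)"
  let ?S' = "{\<theta> \<in> {- \<theta>2<..- \<theta>1}. neg.a t \<theta> - - z \<in> \<int>}"
  let ?S = "{\<theta> \<in> {\<theta>1..<\<theta>2}. b t \<theta> - z \<in> \<int>}"
  have 1: "(?g has_sum (neg.left_slope t (neg.left_end t (- \<theta>1) (- z)) - neg.left_slope t (neg.left_end t (- \<theta>2) (- z)))) ?S'"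
    using le by (intro neg.left_jump_sum t) simp
  have mem: "- \<theta> \<in> ?S' \<longleftrightarrow> \<theta> \<in> ?S" for \<theta>
  proof -
    have "neg.a t (- \<theta>) - - z = - (b t \<theta> - z) - 1" by (simp add: neg_a[OF t])
    moreover have "- x - 1 \<in> \<int> \<longleftrightarrow> x \<in> \<int>" for x :: real
    proof
      assume "- x - 1 \<in> \<int>"
      from Ints_minus[OF Ints_add[OF this Ints_1]] show "x \<in> \<int>" by simp
    qed simp
    ultimately have "neg.a t (- \<theta>) - - z \<in> \<int> \<longleftrightarrow> b t \<theta> - z \<in> \<int>" by metis
    then show ?thesis by auto
  qed
  have "bij_betw uminus ?S ?S'"
  proof (rule bij_betwI[of _ _ _ uminus])
    show "uminus \<in> ?S \<rightarrow> ?S'" using mem by blast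
    show "uminus \<in> ?S' \<rightarrow> ?S"
    proof
      fix x assume "x \<in> ?S'"
      then show "- x \<in> ?S" using mem[of "- x"] by simp
    qed
  qed auto
  from has_sum_reindex_bij_betw[OF this, of ?g] 1
  have "((\<lambda>\<theta>. ?g (- \<theta>)) has_sum (neg.left_slope t (neg.left_end t (- \<theta>1) (- z)) - neg.left_slope t (neg.left_end t (- \<theta>2) (- z)))) ?S"
    by blast
  moreover have "?g (- \<theta>) = right_slope t (b t \<theta> + 1) - right_slope t (b t \<theta>)" for \<theta>
    using neg_left_slope[OF t, of "b t \<theta>"] neg_Dl1[OF t, of "b t \<theta>"] by (simp add: neg_a[OF t])
  ultimately show ?thesis by (simp add: neg_left_end[OF t] neg_left_slope[OF t])
qed

end

section \<open>Global shocks\<close>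

text \<open>
  For the atoms after time s0: every shock among them is global, and for each tilt at most one
  of them is a global shock. It plays the role of the source of the other global shocks.
\<close>

locale omega_env = based_env +
  assumes N_shock: "s0 < r \<Longrightarrow> 0 < w r y \<Longrightarrow> shock \<theta> r y \<Longrightarrow> global_shock \<theta> r y"
    and N_unique: "s0 < r \<Longrightarrow> 0 < w r y \<Longrightarrow> global_shock \<theta> r y \<Longrightarrow>
      s0 < r' \<Longrightarrow> 0 < w r' y' \<Longrightarrow> global_shock \<theta> r' y' \<Longrightarrow> r = r' \<and> y - y' \<in> \<int>"
begin

text \<open>
  The exceptional atom. It is unique modulo 1, and every ambiguity of the winding at an atom
  is inherited from it.
\<close>

definition source :: "real \<Rightarrow> real \<Rightarrow> real \<Rightarrow> bool" where
  "source \<theta> r y \<longleftrightarrow> s0 < r \<and> 0 < w r y \<and> global_shock \<theta> r y"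

lemma T_card_less:
  assumes "s0 < r" "r < t" "0 < w r y"
  shows "card (T \<inter> {s0<..<r}) < card (T \<inter> {s0<..<t})"
proof -
  have "r \<in> T" using assms by (auto simp: T_def)
  then have "T \<inter> {s0<..<r} \<subset> T \<inter> {s0<..<t}" using assms by auto
  then show ?thesis by (intro psubset_card_mono) auto
qed

text \<open>
  Follow the common last corners down until the extremal paths separate; a corner where they
  do is a shock at an atom.
\<close>

lemma source_below:
  assumes "s0 < r" "0 < w r y" "0 < winding_gap \<theta> r y"
  shows "\<exists>\<tau>. \<tau> \<le> r \<and> source \<theta> \<tau> (leftmost \<theta> r y \<tau>) \<and> rightmost \<theta> r y \<tau> = leftmost \<theta> r y \<tau> \<and>
    winding_gap \<theta> \<tau> (leftmost \<theta> r y \<tau>) = winding_gap \<theta> r y"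
  using assms
proof (induction "card (T \<inter> {s0<..<r})" arbitrary: r y rule: less_induct)
  case less
  show ?case
  proof (cases "shock \<theta> r y")
    case True
    then have "source \<theta> r y" using N_shock less(2,3) by (simp add: source_def)
    moreover have "leftmost \<theta> r y r = y" "rightmost \<theta> r y r = y"
      using tilted_min_end[OF leftmost_tilted_min[OF less(2)]] tilted_min_end[OF rightmost_tilted_min[OF less(2)]] by auto
    ultimately show ?thesis by (intro exI[of _ r]) simp
  next
    case False
    obtain r1 where r1: "s0 < r1" "r1 < r" "0 < w r1 (leftmost \<theta> r y r1)" "rightmost \<theta> r y r1 = leftmost \<theta> r y r1"
      "winding_gap \<theta> r1 (leftmost \<theta> r y r1) = winding_gap \<theta> r y" by (rule branch[OF less(2) False less(4)])
    let ?c = "leftmost \<theta> r y r1"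
    have "0 < winding_gap \<theta> r1 ?c" using r1(5) less(4) by simp
    from less(1)[OF T_card_less[OF r1(1,2,3)] r1(1,3) this] obtain \<tau> where
      \<tau>: "\<tau> \<le> r1" "source \<theta> \<tau> (leftmost \<theta> r1 ?c \<tau>)" "rightmost \<theta> r1 ?c \<tau> = leftmost \<theta> r1 ?c \<tau>"
      "winding_gap \<theta> \<tau> (leftmost \<theta> r1 ?c \<tau>) = winding_gap \<theta> r1 ?c" by blast
    have s: "s0 < \<tau>" using \<tau>(2) by (simp add: source_def)
    have "leftmost \<theta> r1 ?c \<tau> = leftmost \<theta> r y \<tau>" using leftmost_sub[of r1 r \<tau> \<theta> y] r1 \<tau>(1) s by simp
    moreover have "rightmost \<theta> r1 ?c \<tau> = rightmost \<theta> r y \<tau>" using rightmost_sub[of r1 r \<tau> \<theta> y] r1 \<tau>(1) s by simp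
    ultimately show ?thesis using \<tau> r1(2,5) by (intro exI[of _ \<tau>]) simp
  qed
qed

lemma meeting_time_weight_zero_winding:
  assumes t: "s0 < t" and g: "global_shock \<theta> t z"
  shows "winding_gap \<theta> t z = 1 + (if s0 < meeting_time \<theta> t z then winding_gap \<theta> (meeting_time \<theta> t z) (leftmost \<theta> t z (meeting_time \<theta> t z)) else 0)"
    and "rightmost \<theta> t z (meeting_time \<theta> t z) = leftmost \<theta> t z (meeting_time \<theta> t z) + 1"
proof -
  have sh: "shock \<theta> t z" and lt: "leftmost \<theta> t z (meeting_time \<theta> t z) < rightmost \<theta> t z (meeting_time \<theta> t z)"
    using g by (auto simp: global_shock_def)
  have e: "rightmost \<theta> t z (meeting_time \<theta> t z) - leftmost \<theta> t z (meeting_time \<theta> t z) = 1"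
    using coalesce(3)[OF t sh] lt by auto
  then show "rightmost \<theta> t z (meeting_time \<theta> t z) = leftmost \<theta> t z (meeting_time \<theta> t z) + 1" by simp
  show "winding_gap \<theta> t z = 1 + (if s0 < meeting_time \<theta> t z then winding_gap \<theta> (meeting_time \<theta> t z) (leftmost \<theta> t z (meeting_time \<theta> t z)) else 0)"
    using coalesce(6)[OF t sh] e by simp
qed

text \<open>
  The two paths from a source wind once around the circle before they meet; a further
  ambiguity below their meeting point would come from a second, earlier source.
\<close>

lemma source_winding_gap: assumes "source \<theta> r y" shows "winding_gap \<theta> r y = 1"
proof (rule ccontr)
  assume ne: "winding_gap \<theta> r y \<noteq> 1"
  have r: "s0 < r" "0 < w r y" and g: "global_shock \<theta> r y" using assms by (auto simp: source_def)
  have sh: "shock \<theta> r y" using g by (simp add: global_shock_def)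
  let ?m = "meeting_time \<theta> r y"
  have m: "s0 < ?m" "winding_gap \<theta> ?m (leftmost \<theta> r y ?m) \<noteq> 0"
    using meeting_time_weight_zero_winding(1)[OF r(1) g] ne by (auto split: if_splits)
  have wm: "0 < w ?m (leftmost \<theta> r y ?m)" by (rule coalesce(5)[OF r(1) sh m(1)])
  have "0 < winding_gap \<theta> ?m (leftmost \<theta> r y ?m)" using m winding_gap_nonneg[OF m(1), of \<theta>] by (simp add: less_le)
  from source_below[OF m(1) wm this] obtain \<tau> c where "\<tau> \<le> ?m" "source \<theta> \<tau> c" by blast
  then have "\<tau> = r" using N_unique[of r y \<theta> \<tau> c] r g by (auto simp: source_def)
  then show False using \<open>\<tau> \<le> ?m\<close> coalesce(2)[OF r(1) sh] by simp
qed

lemma weight_winding_gap: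
  assumes "s0 < r" "0 < w r y" "0 < winding_gap \<theta> r y"
  shows "winding_gap \<theta> r y = 1" and
    "\<exists>\<tau>\<le>r. source \<theta> \<tau> (leftmost \<theta> r y \<tau>) \<and> rightmost \<theta> r y \<tau> = leftmost \<theta> r y \<tau>"
  using source_below[OF assms] source_winding_gap by auto

text \<open>
  A flat piece longer than 1 would give the last corner of some minimizer two extra windings,
  but an atom has at most one.
\<close>

lemma b_le_a: assumes t: "s0 < t" shows "b t \<theta> \<le> a t \<theta> + 1"
proof (rule ccontr)
  assume nle: "\<not> ?thesis"
  have left_end: "left_end t \<theta> (b t \<theta> + 1) = b t \<theta> + 1" by (rule left_end_unique) auto
  obtain r where r: "\<forall>n. 0 < n \<longrightarrow> a t \<theta> < left_end t \<theta> (b t \<theta> + 1) - real n \<longrightarrow>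
       s0 < r \<and> 0 < w r (leftmost \<theta> t (b t \<theta> + 1) r) \<and> real n \<le> winding_gap \<theta> r (leftmost \<theta> t (b t \<theta> + 1) r)"
    using left_corner[OF t, of \<theta> "b t \<theta> + 1"] by blast
  have "s0 < r" "0 < w r (leftmost \<theta> t (b t \<theta> + 1) r)" "2 \<le> winding_gap \<theta> r (leftmost \<theta> t (b t \<theta> + 1) r)"
    using r[rule_format, of 2] nle left_end by auto
  then show False using weight_winding_gap(1)[of r "leftmost \<theta> t (b t \<theta> + 1) r" \<theta>] by simp
qed

lemma left_source:
  assumes t: "s0 < t" and lt: "a t \<theta> < left_end t \<theta> z - 1"
  shows "\<exists>\<tau><t. source \<theta> \<tau> (leftmost \<theta> t z \<tau>)"
proof -
  obtain r where r: "s0 \<le> r" "r < t" "s0 < r" "0 < w r (leftmost \<theta> t z r)" "1 \<le> winding_gap \<theta> r (leftmost \<theta> t z r)"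
    using left_corner[OF t, of \<theta> z] lt by (metis of_nat_1 zero_less_one)
  then obtain \<tau> where \<tau>: "\<tau> \<le> r" "source \<theta> \<tau> (leftmost \<theta> r (leftmost \<theta> t z r) \<tau>)"
    using weight_winding_gap(2)[of r "leftmost \<theta> t z r" \<theta>] by auto
  then have "leftmost \<theta> r (leftmost \<theta> t z r) \<tau> = leftmost \<theta> t z \<tau>"
    using leftmost_sub[of r t \<tau> \<theta> z] r by (simp add: source_def)
  then show ?thesis using \<tau> r(2) by (intro exI[of _ \<tau>]) auto
qed

lemma right_source:
  assumes t: "s0 < t" and lt: "right_end t \<theta> z < b t \<theta>"
  shows "\<exists>\<tau><t. source \<theta> \<tau> (rightmost \<theta> t z \<tau>)"
proof -
  obtain r where r: "s0 \<le> r" "r < t" and *: "\<forall>n. 0 < n \<longrightarrow> right_end t \<theta> z + real n - 1 < b t \<theta> \<longrightarrow>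
       s0 < r \<and> 0 < w r (rightmost \<theta> t z r) \<and> real n \<le> winding_gap \<theta> r (rightmost \<theta> t z r)"
    using right_corner[OF t, of \<theta> z] by blast
  have r': "s0 < r" "0 < w r (rightmost \<theta> t z r)" "1 \<le> winding_gap \<theta> r (rightmost \<theta> t z r)"
    using *[rule_format, of 1] lt by auto
  then obtain \<tau> where \<tau>: "\<tau> \<le> r" "source \<theta> \<tau> (leftmost \<theta> r (rightmost \<theta> t z r) \<tau>)"
    "rightmost \<theta> r (rightmost \<theta> t z r) \<tau> = leftmost \<theta> r (rightmost \<theta> t z r) \<tau>"
    using weight_winding_gap(2)[of r "rightmost \<theta> t z r" \<theta>] by auto
  then have "rightmost \<theta> r (rightmost \<theta> t z r) \<tau> = rightmost \<theta> t z \<tau>"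
    using rightmost_sub[of r t \<tau> \<theta> z] r by (simp add: source_def)
  then show ?thesis using \<tau> r(2) by (intro exI[of _ \<tau>]) auto
qed

lemma left_visit:
  assumes t: "s0 < t" and q: "s0 < q" "q < t" "0 < w q (leftmost \<theta> t z q)" "1 \<le> winding_gap \<theta> q (leftmost \<theta> t z q)"
  shows "a t \<theta> < left_end t \<theta> z - 1"
proof -
  obtain r where r: "s0 \<le> r" "r < t" "s0 < r \<longrightarrow> 1 \<le> winding_gap \<theta> r (leftmost \<theta> t z r) \<longrightarrow> a t \<theta> < left_end t \<theta> z - 1"
    "\<forall>q. r < q \<longrightarrow> q < t \<longrightarrow> w q (leftmost \<theta> t z q) = 0"
    using left_corner[OF t, of \<theta> z] by blast
  have qr: "q \<le> r" using r(4) q by (cases "q \<le> r") auto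
  have "leftmost \<theta> t z \<in> tilted_min \<theta> r (leftmost \<theta> t z r)" using tilted_min_sub[OF leftmost_tilted_min[OF t]] r by simp
  from winding_gap_mono[OF this q(1) qr] show ?thesis using r(3) q qr by simp
qed

lemma right_visit:
  assumes t: "s0 < t" and q: "s0 < q" "q < t" "0 < w q (rightmost \<theta> t z q)" "1 \<le> winding_gap \<theta> q (rightmost \<theta> t z q)"
  shows "right_end t \<theta> z < b t \<theta>"
proof -
  obtain r where r: "s0 \<le> r" "r < t" "s0 < r \<longrightarrow> 1 \<le> winding_gap \<theta> r (rightmost \<theta> t z r) \<longrightarrow> right_end t \<theta> z < b t \<theta>"
    "\<forall>q. r < q \<longrightarrow> q < t \<longrightarrow> w q (rightmost \<theta> t z q) = 0"
    using right_corner[OF t, of \<theta> z] by blast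
  have qr: "q \<le> r" using r(4) q by (cases "q \<le> r") auto
  have "rightmost \<theta> t z \<in> tilted_min \<theta> r (rightmost \<theta> t z r)" using tilted_min_sub[OF rightmost_tilted_min[OF t]] r by simp
  from winding_gap_mono[OF this q(1) qr] show ?thesis using r(3) q qr by simp
qed

text \<open>
  If the source were visited at or before the meeting time, its ambiguity would add a second
  extra winding.
\<close>

lemma left_source_after_meeting_time:
  assumes t: "s0 < t" and g: "global_shock \<theta> t z" and d: "winding_gap \<theta> t z = 1" and s: "source \<theta> \<tau> (leftmost \<theta> t z \<tau>)"
  shows "meeting_time \<theta> t z < \<tau>"
proof (rule ccontr)
  assume nlt: "\<not> meeting_time \<theta> t z < \<tau>"
  let ?m = "meeting_time \<theta> t z"
  have sh: "shock \<theta> t z" using g by (simp add: global_shock_def)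
  have m: "s0 < ?m" "\<tau> \<le> ?m" "s0 < \<tau>" using nlt s by (auto simp: source_def)
  have "leftmost \<theta> t z \<in> tilted_min \<theta> ?m (leftmost \<theta> t z ?m)" using tilted_min_sub[OF leftmost_tilted_min[OF t]] m coalesce(2)[OF t sh] by simp
  from winding_gap_mono[OF this m(3,2)] have "1 \<le> winding_gap \<theta> ?m (leftmost \<theta> t z ?m)" using source_winding_gap[OF s] by simp
  then show False using meeting_time_weight_zero_winding(1)[OF t g] d m(1) by simp
qed

lemma right_source_after_meeting_time:
  assumes t: "s0 < t" and g: "global_shock \<theta> t z" and d: "winding_gap \<theta> t z = 1" and s: "source \<theta> \<tau> (rightmost \<theta> t z \<tau>)"
  shows "meeting_time \<theta> t z < \<tau>"
proof (rule ccontr)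
  assume nlt: "\<not> meeting_time \<theta> t z < \<tau>"
  let ?m = "meeting_time \<theta> t z"
  have sh: "shock \<theta> t z" using g by (simp add: global_shock_def)
  have m: "s0 < ?m" "\<tau> \<le> ?m" "s0 < \<tau>" using nlt s by (auto simp: source_def)
  have "rightmost \<theta> t z \<in> tilted_min \<theta> ?m (rightmost \<theta> t z ?m)" using tilted_min_sub[OF rightmost_tilted_min[OF t]] m coalesce(2)[OF t sh] by simp
  from winding_gap_mono[OF this m(3,2)] have "1 \<le> winding_gap \<theta> ?m (rightmost \<theta> t z ?m)" using source_winding_gap[OF s] by simp
  also have "rightmost \<theta> t z ?m = leftmost \<theta> t z ?m + of_int 1" using meeting_time_weight_zero_winding(2)[OF t g] by simp
  also have "winding_gap \<theta> ?m (leftmost \<theta> t z ?m + of_int 1) = winding_gap \<theta> ?m (leftmost \<theta> t z ?m)" by (rule winding_gap_shift[OF m(1)])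
  finally show False using meeting_time_weight_zero_winding(1)[OF t g] d m(1) by simp
qed

text \<open>
  If the extremal paths do not separate into a loop around the circle, they agree at an atom
  that carries the whole ambiguity of the winding.
\<close>

lemma not_global_shock_visit:
  assumes t: "s0 < t" and ng: "\<not> global_shock \<theta> t z" and d: "0 < winding_gap \<theta> t z"
  shows "\<exists>q. s0 < q \<and> q < t \<and> 0 < w q (leftmost \<theta> t z q) \<and> rightmost \<theta> t z q = leftmost \<theta> t z q \<and>
    winding_gap \<theta> q (leftmost \<theta> t z q) = winding_gap \<theta> t z"
proof (cases "shock \<theta> t z")
  case False
  show ?thesis by (rule branch[OF t False d]) blast
next
  case True
  let ?m = "meeting_time \<theta> t z"
  have e: "rightmost \<theta> t z ?m - leftmost \<theta> t z ?m = 0" using coalesce(3)[OF t True] ng True by (auto simp: global_shock_def)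
  then have "winding_gap \<theta> t z = (if s0 < ?m then winding_gap \<theta> ?m (leftmost \<theta> t z ?m) else 0)" using coalesce(6)[OF t True] by simp
  then have m: "s0 < ?m" "winding_gap \<theta> ?m (leftmost \<theta> t z ?m) = winding_gap \<theta> t z" using d by (auto split: if_splits)
  show ?thesis using coalesce(2)[OF t True] coalesce(5)[OF t True m(1)] m e by (intro exI[of _ ?m]) simp
qed

text \<open>
  In the interior of the flat piece both extremal paths come through the source, so they meet
  there or later and cannot form a loop.
\<close>

lemma global_shock_imp:
  assumes t: "s0 < t" and g: "global_shock \<theta> t z"
  shows "left_end t \<theta> z = a t \<theta> + 1 \<or> left_end t \<theta> z = b t \<theta> + 1"
proof (rule ccontr)
  assume "\<not> ?thesis"
  then have ne: "left_end t \<theta> z \<noteq> a t \<theta> + 1" "left_end t \<theta> z \<noteq> b t \<theta> + 1" by auto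
  have sh: "shock \<theta> t z" using g by (simp add: global_shock_def)
  let ?m = "meeting_time \<theta> t z"
  let ?dm = "if s0 < ?m then winding_gap \<theta> ?m (leftmost \<theta> t z ?m) else 0"
  have d: "winding_gap \<theta> t z = 1 + ?dm" by (rule meeting_time_weight_zero_winding(1)[OF t g])
  have zz: "winding_gap \<theta> t z = left_end t \<theta> z - right_end t \<theta> z" by (rule winding_gap_eq[OF t])
  have "?dm = 0 \<or> ?dm = 1"
    using weight_winding_gap(1)[OF _ coalesce(5)[OF t sh], of \<theta>] winding_gap_nonneg[of ?m \<theta> "leftmost \<theta> t z ?m"]
    by (auto simp: less_le)
  then show False
  proof
    assume "?dm = 0"
    then have d1: "winding_gap \<theta> t z = 1" using d by simp
    have "a t \<theta> < left_end t \<theta> z - 1" using right_end_props(1)[of t \<theta> z] zz d1 ne(1) by simp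
    from left_source[OF t this] obtain \<tau> where \<tau>: "\<tau> < t" "source \<theta> \<tau> (leftmost \<theta> t z \<tau>)" by blast
    have "right_end t \<theta> z < b t \<theta>" using left_end_props(2)[OF t, of \<theta> z] zz d1 ne(2) by simp
    from right_source[OF t this] obtain \<tau>' where \<tau>': "\<tau>' < t" "source \<theta> \<tau>' (rightmost \<theta> t z \<tau>')" by blast
    have e: "\<tau>' = \<tau>" and i: "rightmost \<theta> t z \<tau>' - leftmost \<theta> t z \<tau> \<in> \<int>"
      using N_unique[of \<tau>' "rightmost \<theta> t z \<tau>'" \<theta> \<tau> "leftmost \<theta> t z \<tau>"] \<tau>(2) \<tau>'(2)
      unfolding source_def by blast+
    have "?m < \<tau>" by (rule left_source_after_meeting_time[OF t g d1 \<tau>(2)])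
    then show False using coalesce(4)[OF t sh, of \<tau>] \<tau>(1) i unfolding e by blast
  next
    assume "?dm = 1"
    then have "left_end t \<theta> z = right_end t \<theta> z + 2" using d zz by simp
    then show False
      using right_end_props(1)[of t \<theta> z] left_end_props(2)[OF t, of \<theta> z] b_le_a[OF t, of \<theta>] ne(2) by simp
  qed
qed

lemma gshockI_a:
  assumes t: "s0 < t" and z: "left_end t \<theta> z = a t \<theta> + 1"
  shows "global_shock \<theta> t z" "winding_gap \<theta> t z = 1" "right_end t \<theta> z = a t \<theta>"
proof -
  have "a t \<theta> - z = (left_end t \<theta> z - z) - 1" using z by simp
  then have "a t \<theta> - z \<in> \<int>" using Ints_diff[OF left_end_props(3)[OF t, of \<theta> z] Ints_1] by (simp only:)
  then show right_end: "right_end t \<theta> z = a t \<theta>" by (intro right_end_unique) auto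
  then show d: "winding_gap \<theta> t z = 1" using winding_gap_eq[OF t, of \<theta> z] z by simp
  show "global_shock \<theta> t z"
  proof (rule ccontr)
    assume "\<not> ?thesis"
    from not_global_shock_visit[OF t this] d obtain q where
      "s0 < q" "q < t" "0 < w q (leftmost \<theta> t z q)" "winding_gap \<theta> q (leftmost \<theta> t z q) = winding_gap \<theta> t z" by auto
    then show False using left_visit[OF t, of q \<theta> z] d z by simp
  qed
qed

lemma gshockI_b:
  assumes t: "s0 < t" and z: "left_end t \<theta> z = b t \<theta> + 1"
  shows "global_shock \<theta> t z" "b t \<theta> < a t \<theta> + 1 \<Longrightarrow> winding_gap \<theta> t z = 1" "b t \<theta> < a t \<theta> + 1 \<Longrightarrow> right_end t \<theta> z = b t \<theta>"
proof -
  have "b t \<theta> - z = (left_end t \<theta> z - z) - 1" using z by simp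
  then have zi: "b t \<theta> - z \<in> \<int>" using Ints_diff[OF left_end_props(3)[OF t, of \<theta> z] Ints_1] by (simp only:)
  show right_end: "right_end t \<theta> z = b t \<theta>" if "b t \<theta> < a t \<theta> + 1"
    using that zi a_le_b[OF t, of \<theta>] by (intro right_end_unique) auto
  then show d: "winding_gap \<theta> t z = 1" if "b t \<theta> < a t \<theta> + 1" using that winding_gap_eq[OF t, of \<theta> z] z by simp
  have dpos: "0 < winding_gap \<theta> t z"
    using right_end_props(2)[of t \<theta> z] winding_gap_eq[OF t, of \<theta> z] z a_le_b[OF t, of \<theta>] by simp
  show "global_shock \<theta> t z"
  proof (rule ccontr)
    assume "\<not> ?thesis"
    from not_global_shock_visit[OF t this dpos] obtain q where
      q: "s0 < q" "q < t" "0 < w q (leftmost \<theta> t z q)" "rightmost \<theta> t z q = leftmost \<theta> t z q"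
      "winding_gap \<theta> q (leftmost \<theta> t z q) = winding_gap \<theta> t z" by auto
    have d1: "winding_gap \<theta> t z = 1" using weight_winding_gap(1)[OF q(1,3), of \<theta>] dpos q(5) by simp
    have "right_end t \<theta> z < b t \<theta>" using right_visit[OF t q(1,2)] q d1 by simp
    moreover have "right_end t \<theta> z = b t \<theta>" using winding_gap_eq[OF t, of \<theta> z] d1 z by simp
    ultimately show False by simp
  qed
qed

lemma Ints_left_end:
  assumes t: "s0 < t"
  shows "z - b t \<theta> \<in> \<int> \<Longrightarrow> left_end t \<theta> z = b t \<theta> + 1"
    and "z - a t \<theta> \<in> \<int> \<Longrightarrow> b t \<theta> < a t \<theta> + 1 \<Longrightarrow> left_end t \<theta> z = a t \<theta> + 1"
proof -
  have *: "x + 1 - z \<in> \<int>" if "z - x \<in> \<int>" for x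
  proof -
    have "x + 1 - z = 1 - (z - x)" by simp
    then show ?thesis using that by (metis Ints_1 Ints_diff)
  qed
  show "z - b t \<theta> \<in> \<int> \<Longrightarrow> left_end t \<theta> z = b t \<theta> + 1" using * by (intro left_end_unique) auto
  show "z - a t \<theta> \<in> \<int> \<Longrightarrow> b t \<theta> < a t \<theta> + 1 \<Longrightarrow> left_end t \<theta> z = a t \<theta> + 1"
    using * a_le_b[OF t, of \<theta>] by (intro left_end_unique) auto
qed

theorem global_shock_iff:
  assumes t: "s0 < t"
  shows "global_shock \<theta> t z \<longleftrightarrow> z - a t \<theta> \<in> \<int> \<or> z - b t \<theta> \<in> \<int>"
proof
  assume "global_shock \<theta> t z"
  moreover have "z - x \<in> \<int>" if "left_end t \<theta> z = x + 1" for x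
  proof -
    have "z - x = 1 - (left_end t \<theta> z - z)" using that by simp
    then show ?thesis using left_end_props(3)[OF t, of \<theta> z] by (metis Ints_1 Ints_diff)
  qed
  ultimately show "z - a t \<theta> \<in> \<int> \<or> z - b t \<theta> \<in> \<int>" using global_shock_imp[OF t] by blast
next
  assume *: "z - a t \<theta> \<in> \<int> \<or> z - b t \<theta> \<in> \<int>"
  show "global_shock \<theta> t z"
  proof (cases "z - b t \<theta> \<in> \<int>")
    case True then show ?thesis using Ints_left_end(1)[OF t] gshockI_b(1)[OF t] by blast
  next
    case False
    then have za: "z - a t \<theta> \<in> \<int>" using * by simp
    have "b t \<theta> \<noteq> a t \<theta> + 1"
    proof
      assume "b t \<theta> = a t \<theta> + 1"
      then have "z - b t \<theta> = (z - a t \<theta>) - 1" by simp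
      then have "z - b t \<theta> \<in> \<int>" using za Ints_diff[OF za Ints_1] by metis
      then show False using False by blast
    qed
    then have "b t \<theta> < a t \<theta> + 1" using b_le_a[OF t, of \<theta>] by simp
    then show ?thesis using Ints_left_end(2)[OF t za] gshockI_a(1)[OF t] by blast
  qed
qed

lemma ab_strict:
  assumes t: "s0 < t" and ne: "b t \<theta> - a t \<theta> \<notin> \<int>"
  shows "a t \<theta> < b t \<theta>" "b t \<theta> < a t \<theta> + 1"
proof -
  show "a t \<theta> < b t \<theta>" using a_le_b[OF t, of \<theta>] ne by (cases "a t \<theta> = b t \<theta>") auto
  show "b t \<theta> < a t \<theta> + 1" using b_le_a[OF t, of \<theta>] ne by (cases "b t \<theta> = a t \<theta> + 1") auto
qed

text \<open>
  Strictly between a and b both extremal minimizers come through the source. At a only the rightmost one does,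
  and at b only the leftmost one.
\<close>

theorem source_sides:
  assumes t: "s0 < t" and ne: "b t \<theta> - a t \<theta> \<notin> \<int>"
  shows "z - a t \<theta> \<in> \<int> \<Longrightarrow> \<exists>s. meeting_time \<theta> t z < s \<and> s < t \<and> source \<theta> s (rightmost \<theta> t z s)"
    and "z - b t \<theta> \<in> \<int> \<Longrightarrow> \<exists>s. meeting_time \<theta> t z < s \<and> s < t \<and> source \<theta> s (leftmost \<theta> t z s)"
    and "z - b t \<theta> \<in> \<int> \<Longrightarrow> s < t \<Longrightarrow> \<not> source \<theta> s (rightmost \<theta> t z s)"
    and "z - a t \<theta> \<in> \<int> \<Longrightarrow> s < t \<Longrightarrow> \<not> source \<theta> s (leftmost \<theta> t z s)"
proof -
  note ab = ab_strict[OF t ne]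
  {
    assume "z - a t \<theta> \<in> \<int>"
    then have left_end: "left_end t \<theta> z = a t \<theta> + 1" using Ints_left_end(2)[OF t] ab by blast
    note g = gshockI_a[OF t left_end]
    show "\<exists>s. meeting_time \<theta> t z < s \<and> s < t \<and> source \<theta> s (rightmost \<theta> t z s)"
      using right_source[OF t, of \<theta> z] right_source_after_meeting_time[OF t g(1,2)] g(3) ab by auto
    show "\<not> source \<theta> s (leftmost \<theta> t z s)" if "s < t"
    proof
      assume s: "source \<theta> s (leftmost \<theta> t z s)"
      have "a t \<theta> < left_end t \<theta> z - 1"
        by (rule left_visit[OF t _ that]) (use s source_winding_gap[OF s] in \<open>auto simp: source_def\<close>)
      then show False using left_end by simp
    qed
  }
  {
    assume "z - b t \<theta> \<in> \<int>"
    then have left_end: "left_end t \<theta> z = b t \<theta> + 1" using Ints_left_end(1)[OF t] by blast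
    note g = gshockI_b[OF t left_end]
    show "\<exists>s. meeting_time \<theta> t z < s \<and> s < t \<and> source \<theta> s (leftmost \<theta> t z s)"
      using left_source[OF t, of \<theta> z] left_source_after_meeting_time[OF t g(1) g(2)[OF ab(2)]] left_end ab by auto
    show "\<not> source \<theta> s (rightmost \<theta> t z s)" if "s < t"
    proof
      assume s: "source \<theta> s (rightmost \<theta> t z s)"
      have "right_end t \<theta> z < b t \<theta>"
        by (rule right_visit[OF t _ that]) (use s source_winding_gap[OF s] in \<open>auto simp: source_def\<close>)
      then show False using g(3)[OF ab(2)] by simp
    qed
  }
qed

text \<open>
  At a the winding cost has a positive left and a vanishing right derivative. So the jump of
  the slopes at a + 1, the lift that is optimal for slightly larger tilts, exceeds the jump at
  a. The reflected argument applies at b.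
\<close>

theorem shocks_persist:
  assumes t: "s0 < t" and ne: "b t \<theta> - a t \<theta> \<notin> \<int>"
  shows "\<exists>\<epsilon>>0. (\<forall>\<theta>'\<in>{\<theta>..<\<theta> + \<epsilon>}. shock \<theta>' t (a t \<theta>)) \<and> (\<forall>\<theta>'\<in>{\<theta> - \<epsilon><..\<theta>}. shock \<theta>' t (b t \<theta>))"
proof -
  let ?a = "a t \<theta>" and ?b = "b t \<theta>"
  note ab = ab_strict[OF t ne]
  have Ga: "\<theta> < G t (?a + 1)" using le_b_iff[OF t, of "?a + 1" \<theta>] ab by linarith
  have Gb: "G t (?b - 1) < \<theta>" using a_le_iff[OF t, of \<theta> "?b - 1"] ab by linarith
  \<comment> \<open>Tilts closer to \<theta> than this stay strictly between the values of G at b - 1 and at a + 1.\<close>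
  define e where "e = min (G t (?a + 1) - \<theta>) (\<theta> - G t (?b - 1))"
  have e: "e > 0" using Ga Gb by (simp add: e_def)
  have Gab: "G t ?b = G t ?a" by (simp add: G_a[OF t] G_b[OF t])
  have sa: "right_slope t (?a + 1) < left_slope t (?a + 1)"
    using a_slope_pos[OF t, of \<theta>] flat_right_imp_slopes[OF t ab(1) Gab] right_slope_le_left_slope[OF t, of ?a] by simp
  have sb: "right_slope t ?b < left_slope t ?b"
    using b_slope_pos[OF t, of \<theta>] flat_left_imp_slopes[OF t ab(1) Gab[symmetric]]
      right_slope_le_left_slope[OF t, of "?b + 1"] by simp
  have "shock \<theta>' t ?a" if th: "\<theta> \<le> \<theta>'" "\<theta>' < \<theta> + e" for \<theta>'
  proof (cases "\<theta>' = \<theta>")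
    case True
    then show ?thesis using global_shock_iff[OF t, of \<theta> ?a] by (simp add: global_shock_def)
  next
    case False
    have G1: "\<theta>' < G t (?a + 1)" using th by (simp add: e_def)
    have "left_end t \<theta>' ?a = ?a + 1"
      using le_b_iff[OF t, of ?a \<theta>'] le_b_iff[OF t, of "?a + 1" \<theta>'] G1 th
      by (intro left_end_unique) (auto simp: G_a[OF t])
    moreover have "right_end t \<theta>' ?a = ?a + 1"
      using a_le_iff[OF t, of \<theta>' "?a + 1"] G1 a_less[OF t, of \<theta> \<theta>'] th False by (intro right_end_unique) auto
    ultimately show ?thesis using sa by (simp add: shock_def)
  qed
  moreover have "shock \<theta>' t ?b" if th: "\<theta> - e < \<theta>'" "\<theta>' \<le> \<theta>" for \<theta>'
  proof (cases "\<theta>' = \<theta>")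
    case True
    then show ?thesis using global_shock_iff[OF t, of \<theta> ?b] by (simp add: global_shock_def)
  next
    case False
    have G1: "G t (?b - 1) < \<theta>'" using th by (simp add: e_def)
    have "left_end t \<theta>' ?b = ?b"
      using le_b_iff[OF t, of ?b \<theta>'] le_b_iff[OF t, of "?b - 1" \<theta>'] G1 th False
      by (intro left_end_unique) (auto simp: G_b[OF t])
    moreover have "right_end t \<theta>' ?b = ?b"
      using a_le_iff[OF t, of \<theta>' ?b] a_le_iff[OF t, of \<theta>' "?b - 1"] G1 th
      by (intro right_end_unique) (auto simp: G_b[OF t])
    ultimately show ?thesis using sb by (simp add: shock_def)
  qed
  ultimately show ?thesis using e by (intro exI[of _ e]) auto
qed

end

section \<open>Atoms of the forcing measure\<close>

lemma to_circle_surj: "\<exists>y. c = to_circle y"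
  using Quotient_abs_rep[OF Quotient_circle, of c] by metis

lemma to_circle_shift: "to_circle (y + of_int k) = to_circle y"
  by (simp add: to_circle_eq_iff)

text \<open>
  The covering map of the cylinder, which is open and thus a quotient map.
\<close>

definition proj :: "real \<times> real \<Rightarrow> real \<times> circle" where
  "proj p = (fst p, to_circle (snd p))"

lemma proj_pair [simp]: "proj (r, y) = (r, to_circle y)"
  by (simp add: proj_def)

lemma proj_surj: "\<exists>q. p = proj q"
proof -
  obtain y where "snd p = to_circle y" using to_circle_surj by blast
  then have "p = proj (fst p, y)" by (simp add: prod_eq_iff)
  then show ?thesis by blast
qed

lemma continuous_to_circle: "continuous_on UNIV to_circle"
  unfolding continuous_on_open_vimage[OF open_UNIV] by (simp add: open_circle_def)

lemma continuous_proj: "continuous_on UNIV proj"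
  unfolding proj_def
  by (intro continuous_on_Pair continuous_intros continuous_on_compose2[OF continuous_to_circle]) auto

lemma open_to_circle_image:
  assumes "open J" shows "open (to_circle ` J)"
proof -
  have "to_circle -` (to_circle ` J) = (\<Union>k::int. (\<lambda>x. of_int k + x) ` J)"
  proof (intro equalityI subsetI)
    fix x assume "x \<in> to_circle -` (to_circle ` J)"
    then obtain y where y: "y \<in> J" "to_circle x = to_circle y" by auto
    then have "x - y \<in> \<int>" by (simp add: to_circle_eq_iff)
    then obtain k where "x - y = of_int k" by (rule Ints_cases)
    then have "x = of_int k + y" by simp
    then show "x \<in> (\<Union>k::int. (\<lambda>x. of_int k + x) ` J)" using y(1) by blast
  next
    fix x assume "x \<in> (\<Union>k::int. (\<lambda>x. of_int k + x) ` J)"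
    then obtain k y where y: "y \<in> J" "x = of_int k + y" by blast
    then have "to_circle x = to_circle y" by (simp add: to_circle_eq_iff)
    then show "x \<in> to_circle -` (to_circle ` J)" using y(1) by simp
  qed
  moreover have "open (\<Union>k::int. (\<lambda>x. of_int k + x) ` J)"
    using assms by (intro open_UN ballI open_translation)
  ultimately show ?thesis by (simp add: open_circle_def)
qed

lemma open_iff_proj: "open U \<longleftrightarrow> open (proj -` U)"
proof
  assume "open U"
  then show "open (proj -` U)"
    using continuous_proj unfolding continuous_on_open_vimage[OF open_UNIV] by simp
next
  assume V: "open (proj -` U)"
  show "open U"
  proof (rule open_prod_intro)
    fix p assume p: "p \<in> U"
    obtain q where q: "p = proj q" using proj_surj by blast
    then have "q \<in> proj -` U" using p by simp
    from open_prod_elim[OF V this] obtain I J where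
      IJ: "open I" "open J" "q \<in> I \<times> J" "I \<times> J \<subseteq> proj -` U" by blast
    have "p \<in> I \<times> to_circle ` J" using IJ(3) q by (auto simp: proj_def)
    moreover have "I \<times> to_circle ` J \<subseteq> U" using IJ(4) by (auto simp: subset_iff)
    ultimately show "\<exists>A B. open A \<and> open B \<and> p \<in> A \<times> B \<and> A \<times> B \<subseteq> U"
      using IJ(1) open_to_circle_image[OF IJ(2)] by blast
  qed
qed

lemma closed_iff_proj: "closed U \<longleftrightarrow> closed (proj -` U)"
  unfolding closed_def by (simp add: open_iff_proj vimage_Compl)

lemma closed_graph:
  fixes F :: "real \<Rightarrow> real"
  assumes "continuous_on UNIV F"
  shows "closed {p. snd p = to_circle (F (fst p))}"
proof -
  have "proj -` {p. snd p = to_circle (F (fst p))} = (\<lambda>q. snd q - F (fst q)) -` \<int>"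
    by (auto simp: proj_def to_circle_eq_iff)
  moreover have "closed ((\<lambda>q. snd q - F (fst q)) -` \<int>)"
    by (intro closed_vimage closed_Ints continuous_intros continuous_on_compose2[OF assms]) auto
  ultimately show ?thesis by (simp add: closed_iff_proj)
qed

lemma closed_point: "closed {p :: real \<times> circle}"
proof -
  obtain r y where q: "p = proj (r, y)" using proj_surj by (metis surj_pair)
  have "{p} = {p. snd p = to_circle ((\<lambda>_. y) (fst p))} \<inter> ({r} \<times> UNIV)" by (auto simp: q)
  moreover have "closed {p. snd p = to_circle ((\<lambda>_. y) (fst p :: real))}" by (rule closed_graph) simp
  ultimately show ?thesis by (simp add: closed_Int closed_Times)
qed

definition weight :: "(real \<times> circle) measure \<Rightarrow> real \<Rightarrow> real \<Rightarrow> real" where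
  "weight \<mu> r y = measure \<mu> {(r, to_circle y)}"

lemma point_sets: "sets \<mu> = sets borel \<Longrightarrow> {p :: real \<times> circle} \<in> sets \<mu>"
  using closed_point[of p] by (simp add: borel_closed)

text \<open>
  Every point off the support has a null neighbourhood that is the projection of one of
  countably many open sets.
\<close>

lemma null_off_support:
  assumes \<mu>: "sets \<mu> = sets (borel :: (real \<times> circle) measure)" and B: "B \<in> sets \<mu>" "B \<inter> msupp \<mu> = {}"
  shows "B \<in> null_sets \<mu>"
proof -
  obtain \<B> :: "(real \<times> real) set set" where \<B>: "countable \<B>" "topological_basis \<B>"
    using ex_countable_basis by blast
  have op: "open (proj ` V)" if "open V" for V
    unfolding open_prod_def
  proof
    fix p assume "p \<in> proj ` V"
    then obtain q where q: "q \<in> V" "p = proj q" by blast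
    from open_prod_elim[OF that q(1)] obtain I J where
      IJ: "open I" "open J" "q \<in> I \<times> J" "I \<times> J \<subseteq> V" by blast
    have "p \<in> I \<times> to_circle ` J" using IJ(3) q by (auto simp: proj_def)
    moreover have "I \<times> to_circle ` J \<subseteq> proj ` V"
    proof
      fix x assume "x \<in> I \<times> to_circle ` J"
      then obtain r y where x: "x = (r, to_circle y)" "r \<in> I" "y \<in> J" by auto
      then have "(r, y) \<in> V" using IJ(4) by auto
      then show "x \<in> proj ` V" using x(1) by (intro image_eqI[of _ _ "(r, y)"]) auto
    qed
    ultimately show "\<exists>A B. open A \<and> open B \<and> p \<in> A \<times> B \<and> A \<times> B \<subseteq> proj ` V"
      using IJ(1) open_to_circle_image[OF IJ(2)] by blast
  qed
  define \<N> where "\<N> = {V \<in> \<B>. proj ` V \<in> null_sets \<mu>}"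
  have "countable \<N>" using \<B>(1) by (rule countable_subset[rotated]) (auto simp: \<N>_def)
  then have null: "(\<Union>V\<in>\<N>. proj ` V) \<in> null_sets \<mu>" by (rule null_sets_UN') (simp add: \<N>_def)
  have "B \<subseteq> (\<Union>V\<in>\<N>. proj ` V)"
  proof
    fix p assume "p \<in> B"
    then have "p \<notin> msupp \<mu>" using B(2) by blast
    then obtain U where U: "open U" "p \<in> U" "emeasure \<mu> U = 0" unfolding msupp_def by auto
    obtain q where q: "p = proj q" using proj_surj by blast
    have "open (proj -` U)" "q \<in> proj -` U" using U q open_iff_proj by auto
    then obtain V where V: "V \<in> \<B>" "q \<in> V" "V \<subseteq> proj -` U" using topological_basisE[OF \<B>(2)] by metis
    have "open V" using V(1) \<B>(2) topological_basis_open by blast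
    then have "proj ` V \<in> sets \<mu>" using op \<mu> by simp
    moreover have "U \<in> null_sets \<mu>" using U \<mu> by (auto simp: null_sets_def)
    moreover have "proj ` V \<subseteq> U" using V(3) by auto
    ultimately have "proj ` V \<in> null_sets \<mu>" by (metis null_sets_subset)
    then show "p \<in> (\<Union>V\<in>\<N>. proj ` V)" using V q by (auto simp: \<N>_def)
  qed
  then show ?thesis using null B(1) null_sets_subset by blast
qed

context
  fixes \<mu> :: "(real \<times> circle) measure"
  assumes \<mu>: "\<mu> \<in> Omega"
begin

lemma sets_mu: "sets \<mu> = sets borel"
  using \<mu> by (simp add: Omega_def)

lemma not_islimpt: "\<not> p islimpt msupp \<mu>"
  using \<mu> unfolding Omega_def by blast

text \<open>
  An isolated point of the support is an atom.
\<close>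

lemma support_point:
  assumes p: "p \<in> msupp \<mu>"
  shows "emeasure \<mu> {p} > 0" and "emeasure \<mu> {p} < \<infinity>"
proof -
  have "\<not> p islimpt msupp \<mu>" by (rule not_islimpt)
  then obtain U where U: "open U" "p \<in> U" "\<forall>q\<in>msupp \<mu>. q \<in> U \<longrightarrow> q = p" unfolding islimpt_def by blast
  have Us: "U \<in> sets \<mu>" using U(1) sets_mu by simp
  have ps: "{p} \<in> sets \<mu>" by (rule point_sets[OF sets_mu])
  have "U - {p} \<in> null_sets \<mu>"
    by (rule null_off_support[OF sets_mu]) (use Us ps U(3) in auto)
  then have "emeasure \<mu> ({p} \<union> (U - {p})) = emeasure \<mu> {p}" by (rule emeasure_Un_null_set[OF ps])
  moreover have "{p} \<union> (U - {p}) = U" using U(2) by auto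
  moreover have "emeasure \<mu> U > 0" using p U(1,2) by (simp add: msupp_def)
  ultimately show pos: "emeasure \<mu> {p} > 0" by simp
  have "atom \<mu> {p}" unfolding atom_def
  proof (intro conjI ballI impI)
    fix B assume "B \<subseteq> {p}"
    then have "B = {} \<or> B = {p}" by auto
    then show "emeasure \<mu> B = 0 \<or> emeasure \<mu> B = emeasure \<mu> {p}" by auto
  qed (use pos ps in auto)
  then show "emeasure \<mu> {p} < \<infinity>" using \<mu> by (simp add: Omega_def)
qed

lemma weight_pos_iff: "weight \<mu> r y > 0 \<longleftrightarrow> (r, to_circle y) \<in> msupp \<mu>"
proof
  assume "(r, to_circle y) \<in> msupp \<mu>"
  from support_point[OF this] show "weight \<mu> r y > 0"
    by (simp add: weight_def measure_def enn2real_positive_iff)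
next
  assume pos: "weight \<mu> r y > 0"
  show "(r, to_circle y) \<in> msupp \<mu>"
  proof (rule ccontr)
    assume "(r, to_circle y) \<notin> msupp \<mu>"
    then have "{(r, to_circle y)} \<in> null_sets \<mu>"
      by (intro null_off_support[OF sets_mu] point_sets[OF sets_mu]) auto
    then have "weight \<mu> r y = 0" by (simp add: weight_def measure_def null_sets_def)
    then show False using pos by simp
  qed
qed

text \<open>
  Infinitely many lifted atoms in a box would accumulate, and so would their projections, as
  the covering map is injective on small sets.
\<close>

lemma env_weight: "env (weight \<mu>)"
proof
  fix r y a b c d :: real
  show "0 \<le> weight \<mu> r y" by (simp add: weight_def)
  show "weight \<mu> r (y + 1) = weight \<mu> r y" using to_circle_shift[of y 1] by (simp add: weight_def)
  let ?S = "{(r, y). r \<in> {a..b} \<and> y \<in> {c..d} \<and> weight \<mu> r y > 0}"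
  show "finite ?S"
  proof (rule ccontr)
    assume inf: "infinite ?S"
    have "compact ({a..b} \<times> {c..d})" by (intro compact_Times) auto
    moreover have "?S \<subseteq> {a..b} \<times> {c..d}" by auto
    ultimately obtain q where q: "q islimpt ?S"
      using inf compact_eq_Bolzano_Weierstrass[of "{a..b} \<times> {c..d}"] by blast
    have "proj q islimpt msupp \<mu>"
    proof (rule islimptI)
      fix U assume U: "proj q \<in> U" "open U"
      let ?V = "proj -` U \<inter> (UNIV \<times> ball (snd q) (1/2))"
      have "open (proj -` U)" using U open_iff_proj by blast
      then have oV: "open ?V" by (intro open_Int open_Times) auto
      have qV: "q \<in> ?V" using U by (simp add: mem_Times_iff)
      obtain x where x: "x \<in> ?S" "x \<in> ?V" "x \<noteq> q"
        using q[unfolded islimpt_def, rule_format, OF qV oV] by (elim bexE conjE)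
      have "weight \<mu> (fst x) (snd x) > 0" using x(1) by (simp add: case_prod_beta)
      then have "proj x \<in> msupp \<mu>" unfolding weight_pos_iff proj_def .
      moreover have "proj x \<noteq> proj q"
      proof
        assume e: "proj x = proj q"
        then have i: "snd x - snd q \<in> \<int>" by (simp add: proj_def to_circle_eq_iff)
        have "dist (snd q) (snd x) < 1 / 2" using x(2) by (simp add: mem_Times_iff)
        then have "\<bar>snd x - snd q\<bar> < 1" unfolding dist_real_def by linarith
        then have "snd x - snd q = 0" using Ints_nonzero_abs_less1[OF i] by blast
        then show False using e x(3) by (simp add: proj_def prod_eq_iff)
      qed
      ultimately show "\<exists>y\<in>msupp \<mu>. y \<in> U \<and> y \<noteq> proj q" using x(2) by auto
    qed
    then show False using not_islimpt by blast
  qed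
qed

lemma based_env_weight: "based_env (weight \<mu>)"
  using env_weight by (simp add: based_env_def)

interpretation env "weight \<mu>" by (rule env_weight)

text \<open>
  Outside the support the graph is a null set, and it meets the support at finitely many
  times.
\<close>

lemma graph_measure:
  assumes F: "continuous_on {s..t} F" and X: "\<And>r. s \<le> r \<Longrightarrow> r \<le> t \<Longrightarrow> X r = to_circle (F r)"
  shows "measure \<mu> ((\<lambda>r. (r, X r)) ` {s..<t}) = mass F s t"
proof (cases "s \<le> t")
  case True
  let ?\<Gamma> = "(\<lambda>r. (r, X r)) ` {s..<t}"
  define F' where "F' r = F (max s (min t r))" for r
  have cF': "continuous_on UNIV F'" unfolding F'_def
    by (intro continuous_on_compose2[OF F] continuous_intros) (use True in auto)
  have eq: "?\<Gamma> = {p. snd p = to_circle (F' (fst p))} \<inter> (({s..} \<times> UNIV) \<inter> ({..<t} \<times> UNIV))"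
  proof (intro equalityI subsetI)
    fix p assume "p \<in> {p. snd p = to_circle (F' (fst p))} \<inter> (({s..} \<times> UNIV) \<inter> ({..<t} \<times> UNIV))"
    then have "snd p = to_circle (F' (fst p))" "s \<le> fst p" "fst p < t" by auto
    moreover from this have "F' (fst p) = F (fst p)" by (simp add: F'_def)
    ultimately have "p = (fst p, X (fst p))" using X by (simp add: prod_eq_iff)
    then show "p \<in> ?\<Gamma>" using \<open>s \<le> fst p\<close> \<open>fst p < t\<close> by (metis atLeastLessThan_iff image_eqI)
  qed (use X in \<open>auto simp: F'_def\<close>)
  have "?\<Gamma> \<in> sets borel" unfolding eq
    by (intro sets.Int borel_closed[OF closed_graph[OF cF']] borel_closed[OF closed_Times] borel_open[OF open_Times]) auto
  then have \<Gamma>: "?\<Gamma> \<in> sets \<mu>" by (simp add: sets_mu)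
  define K where "K = {r \<in> T \<inter> {s..<t}. weight \<mu> r (F r) > 0}"
  have finK: "finite K" unfolding K_def by (rule finite_subset[OF _ finite_T_intervals(1)[of s t]]) auto
  let ?\<Delta> = "(\<lambda>r. (r, X r)) ` K"
  have \<Delta>s: "?\<Delta> \<in> sets \<mu>"
    by (rule sets.countable[OF point_sets[OF sets_mu]]) (simp add: finK countable_finite)
  have sub: "?\<Delta> \<subseteq> ?\<Gamma>" by (auto simp: K_def)
  have "(?\<Gamma> - ?\<Delta>) \<inter> msupp \<mu> = {}"
  proof -
    have "r \<in> K" if "s \<le> r" "r < t" "(r, X r) \<in> msupp \<mu>" for r
    proof -
      have "weight \<mu> r (F r) > 0" using that X[of r] weight_pos_iff by simp
      then show ?thesis using that by (auto simp: K_def T_def)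
    qed
    then show ?thesis by auto
  qed
  then have null: "?\<Gamma> - ?\<Delta> \<in> null_sets \<mu>" using \<Gamma> \<Delta>s by (intro null_off_support[OF sets_mu]) auto
  have "measure \<mu> ?\<Gamma> = measure \<mu> (?\<Delta> \<union> (?\<Gamma> - ?\<Delta>))" using sub by (simp add: Un_absorb1)
  also have "\<dots> = measure \<mu> ?\<Delta>" using emeasure_Un_null_set[OF \<Delta>s null] by (simp add: measure_def)
  also have "\<dots> = (\<Sum>p\<in>?\<Delta>. measure \<mu> {p})"
  proof (rule measure_eq_sum_singleton)
    show "emeasure \<mu> {p} \<noteq> \<infinity>" if p: "p \<in> ?\<Delta>" for p
    proof -
      obtain r where r: "r \<in> K" "p = (r, X r)" using p by blast
      then have "p \<in> msupp \<mu>" using X[of r] weight_pos_iff[of r "F r"] by (auto simp: K_def)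
      from support_point(2)[OF this] show ?thesis by simp
    qed
  qed (auto simp: finK point_sets[OF sets_mu])
  also have "\<dots> = (\<Sum>r\<in>K. measure \<mu> {(r, X r)})" by (subst sum.reindex) (auto simp: inj_on_def)
  also have "\<dots> = (\<Sum>r\<in>K. weight \<mu> r (F r))"
    by (rule sum.cong) (auto simp: K_def weight_def X)
  also have "\<dots> = mass F s t" unfolding mass_def
  proof (rule sum.mono_neutral_left)
    show "\<forall>r\<in>T \<inter> {s..<t} - K. weight \<mu> r (F r) = 0"
      using w_nonneg by (auto simp: K_def not_less intro: antisym)
  qed (auto simp: K_def)
  finally show ?thesis .
qed (simp add: mass_def)

end

section \<open>Lifts of circle-valued paths\<close>

lemma continuous_Ints_constant:
  fixes h :: "real \<Rightarrow> real"
  assumes c: "continuous_on {s..t} h" and i: "\<And>r. s \<le> r \<Longrightarrow> r \<le> t \<Longrightarrow> h r \<in> \<int>"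
    and r: "s \<le> r" "r \<le> t"
  shows "h r = h s"
proof (rule ccontr)
  assume ne: "h r \<noteq> h s"
  have c': "continuous_on {s..r} h" using r by (intro continuous_on_subset[OF c]) auto
  have "h s \<in> \<int>" using i[of s] r by simp
  then obtain k where k: "h s = of_int k" by (rule Ints_cases)
  have "h r \<in> \<int>" using i[of r] r by simp
  then obtain m where m: "h r = of_int m" by (rule Ints_cases)
  have "\<exists>x. s \<le> x \<and> x \<le> r \<and> (h x = of_int k + 1/2 \<or> h x = of_int k - 1/2)"
  proof (cases "k < m")
    case True
    then have "of_int k + 1 \<le> (of_int m :: real)" by linarith
    then have "\<exists>x\<ge>s. x \<le> r \<and> h x = of_int k + 1/2"
      using r k m by (intro IVT' c') simp_all
    then show ?thesis by blast
  next
    case False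
    then have "m < k" using ne k m by (cases "m = k") auto
    then have "of_int m + 1 \<le> (of_int k :: real)" by linarith
    then have "\<exists>x\<ge>s. x \<le> r \<and> h x = of_int k - 1/2"
      using r k m by (intro IVT2' c') simp_all
    then show ?thesis by blast
  qed
  then obtain x where x: "s \<le> x" "x \<le> r" "h x = of_int k + 1/2 \<or> h x = of_int k - 1/2" by blast
  have "h x \<in> \<int>" using i[of x] x r by simp
  then obtain n where n: "h x = of_int n" by (rule Ints_cases)
  have "(of_int (2 * n) :: real) = of_int (2 * k + 1) \<or> (of_int (2 * n) :: real) = of_int (2 * k - 1)"
    using x(3) n by simp linarith
  then have "2 * n = 2 * k + 1 \<or> 2 * n = 2 * k - 1" by (simp only: of_int_eq_iff)
  then show False by presburger
qed

text \<open>
  F is a Sobolev lift of X on [s, t]. Lifts are unique up to an integer.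
\<close>

definition lifts :: "(real \<Rightarrow> real) \<Rightarrow> (real \<Rightarrow> circle) \<Rightarrow> real \<Rightarrow> real \<Rightarrow> bool" where
  "lifts F X s t \<longleftrightarrow> H1 F s t \<and> (\<forall>r. s \<le> r \<longrightarrow> r \<le> t \<longrightarrow> X r = to_circle (F r))"

lemma lifts_sub: "lifts F X s t \<Longrightarrow> s \<le> s' \<Longrightarrow> t' \<le> t \<Longrightarrow> lifts F X s' t'"
  unfolding lifts_def by (auto intro: H1_sub)

lemma lifts_unique:
  assumes "lifts F X s t" "lifts F' X s t" and r: "s \<le> r" "r \<le> t"
  shows "F r = F' r + (F t - F' t)"
proof -
  have i: "F q - F' q \<in> \<int>" if "s \<le> q" "q \<le> t" for q
  proof -
    have "X q = to_circle (F q)" "X q = to_circle (F' q)"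
      using assms(1,2) that by (simp_all add: lifts_def)
    then have "to_circle (F q) = to_circle (F' q)" by simp
    then show ?thesis by (simp only: to_circle_eq_iff)
  qed
  have c: "continuous_on {s..t} (\<lambda>q. F q - F' q)"
    using assms(1,2) by (intro continuous_intros H1_continuous) (auto simp: lifts_def)
  show ?thesis
    using continuous_Ints_constant[OF c i r] continuous_Ints_constant[OF c i, of t] r by linarith
qed

lemma lifts_weak_derivative:
  assumes F: "lifts F X s t" and g: "weak_derivative s t X g"
  shows "has_wderiv F g s t"
proof -
  obtain F' where F': "has_wderiv F' g s t" "\<forall>r\<in>{s..t}. X r = to_circle (F' r)"
    using g weak_derivative_iff_lift by blast
  then have l: "lifts F' X s t" by (auto simp: lifts_def H1_def)
  show ?thesis unfolding has_wderiv_def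
  proof (intro conjI ballI has_wderivD(1,2)[OF F'(1)])
    fix r assume r: "r \<in> {s..t}"
    show "F r = F s + (LINT q:{s..r}|lborel. g q)"
      using has_wderivD(3)[OF F'(1), of r] lifts_unique[OF F l, of r] lifts_unique[OF F l, of s] r
      by simp
  qed
qed

lemma lifts_path_deriv:
  assumes F: "lifts F X s t" shows "has_wderiv F (path_deriv s t X) s t"
proof -
  have "\<exists>g. weak_derivative s t X g"
    using F weak_derivative_iff_lift unfolding lifts_def H1_def by fastforce
  then have "weak_derivative s t X (path_deriv s t X)" unfolding path_deriv_def by (rule someI_ex)
  then show ?thesis by (rule lifts_weak_derivative[OF F])
qed

lemma displacement_lift:
  assumes "lifts F X r t" "r \<le> t" shows "displacement X r t = F t - F r"
  using has_wderiv_integral[OF lifts_path_deriv[OF assms(1)] order_refl assms(2) order_refl]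
  unfolding displacement_def by simp

lemma lifts_shift:
  assumes "lifts F X s t" shows "lifts (\<lambda>r. F r + of_int k) X s t"
  using assms by (simp add: lifts_def to_circle_shift)

lemma lift_exists:
  assumes X: "X \<in> H1_paths s t" and st: "s \<le> t" and z: "X t = to_circle z"
  shows "\<exists>F. lifts F X s t \<and> F t = z"
proof -
  obtain g where "weak_derivative s t X g" using X by (auto simp: H1_paths_def)
  then obtain F where "has_wderiv F g s t" "\<forall>r\<in>{s..t}. X r = to_circle (F r)"
    using weak_derivative_iff_lift by blast
  then have F: "lifts F X s t" by (auto simp: lifts_def H1_def)
  then have "to_circle z = to_circle (F t)" using st z by (simp add: lifts_def)
  then have "z - F t \<in> \<int>" by (simp add: to_circle_eq_iff)
  then obtain k where "z - F t = of_int k" by (rule Ints_cases)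
  then show ?thesis using lifts_shift[OF F, of k] by (intro exI[of _ "\<lambda>r. F r + of_int k"]) simp
qed

lemma lifts_H1_paths:
  assumes "lifts F X s t" shows "restrict X {s..t} \<in> H1_paths s t"
proof -
  obtain g where "has_wderiv F g s t" using assms by (auto simp: lifts_def H1_def)
  then have "weak_derivative s t (restrict X {s..t}) g"
    unfolding weak_derivative_iff_lift using assms by (intro exI[of _ F]) (auto simp: lifts_def)
  then show ?thesis by (auto simp: H1_paths_def)
qed

lemma action_lift:
  assumes \<mu>: "\<mu> \<in> Omega" and F: "lifts F X s t" and st: "s \<le> t"
  shows "action \<mu> \<theta> s t X = env.J (weight \<mu>) F s t + \<theta> * F s - \<theta> * F t + \<theta>\<^sup>2 * (t - s) / 2"
proof -
  interpret env "weight \<mu>" by (rule env_weight[OF \<mu>])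
  let ?g = "path_deriv s t X"
  have g: "has_wderiv F ?g s t" by (rule lifts_path_deriv[OF F])
  note gi = has_wderivD(1,2)[OF g]
  have G: "(LINT r:{s..t}|lborel. ?g r) = F t - F s"
    using has_wderiv_integral[OF g order_refl st order_refl] by simp
  have "(LINT r:{s..t}|lborel. (?g r - \<theta>)\<^sup>2) = (LINT r:{s..t}|lborel. ((?g r)\<^sup>2 - (2 * \<theta>) * ?g r) + \<theta>\<^sup>2)"
    by (rule set_lebesgue_integral_cong) (auto simp: power2_eq_square algebra_simps)
  also have "\<dots> = (LINT r:{s..t}|lborel. (?g r)\<^sup>2) - 2 * \<theta> * (F t - F s) + \<theta>\<^sup>2 * (t - s)"
    using gi st by (simp add: set_integral_const G)
  finally have "1 / 2 * (LINT r:{s..t}|lborel. (?g r - \<theta>)\<^sup>2) = energy F s t - \<theta> * (F t - F s) + \<theta>\<^sup>2 * (t - s) / 2"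
    by (simp add: energy_eq_integral[OF g])
  moreover have "measure \<mu> ((\<lambda>r. (r, X r)) ` {s..<t}) = mass F s t"
    using F by (intro graph_measure[OF \<mu>] H1_continuous) (auto simp: lifts_def)
  ultimately show ?thesis by (simp add: action_def J_def algebra_simps)
qed

text \<open>
  Both problems have the same admissible lifts, and the action differs from
  \<open>cost\<close> by a constant.
\<close>

lemma p2p_minimizers_iff:
  assumes \<mu>: "\<mu> \<in> Omega" and st: "s < t"
  shows "X \<in> p2p_minimizers \<mu> \<theta> s (to_circle Y) t (to_circle z) \<longleftrightarrow>
    X \<in> extensional {s..t} \<and> (\<exists>F \<in> based_env.tilted_min (weight \<mu>) s Y \<theta> t z. lifts F X s t)"
proof -
  interpret based_env "weight \<mu>" s Y by (rule based_env_weight[OF \<mu>])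
  have active: "action \<mu> \<theta> s t X = cost \<theta> F t - \<theta> * F t + \<theta>\<^sup>2 * (t - s) / 2" if "lifts F X s t" for F X
    using action_lift[OF \<mu> that, of \<theta>] st by (simp add: cost_def)
  have lift: "\<exists>F. lifts F X s t \<and> adm F t z"
    if X: "X \<in> H1_paths s t" "X s = to_circle Y" "X t = to_circle z" for X
  proof -
    obtain F where F: "lifts F X s t" "F t = z" using lift_exists[OF X(1) _ X(3)] st by auto
    then have "to_circle (F s) = to_circle Y" using X(2) st by (simp add: lifts_def)
    then have "adm F t z" using F by (simp add: adm_def lifts_def to_circle_eq_iff)
    then show ?thesis using F by blast
  qed
  have proj: "restrict (\<lambda>r. to_circle (F r)) {s..t} \<in> H1_paths s t \<and>
      restrict (\<lambda>r. to_circle (F r)) {s..t} s = to_circle Y \<and>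
      restrict (\<lambda>r. to_circle (F r)) {s..t} t = to_circle z \<and>
      lifts F (restrict (\<lambda>r. to_circle (F r)) {s..t}) s t" if F: "adm F t z" for F
  proof -
    have "lifts F (\<lambda>r. to_circle (F r)) s t" using F by (simp add: lifts_def adm_def)
    from lifts_H1_paths[OF this] this show ?thesis
      using F st by (auto simp: adm_def to_circle_eq_iff lifts_def)
  qed
  show ?thesis
  proof
    assume X: "X \<in> p2p_minimizers \<mu> \<theta> s (to_circle Y) t (to_circle z)"
    then have X': "X \<in> H1_paths s t" "X s = to_circle Y" "X t = to_circle z"
      and min: "\<And>Z. Z \<in> H1_paths s t \<Longrightarrow> Z s = to_circle Y \<Longrightarrow> Z t = to_circle z \<Longrightarrow>
        action \<mu> \<theta> s t X \<le> action \<mu> \<theta> s t Z" by (auto simp: p2p_minimizers_def)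
    obtain F where F: "lifts F X s t" "adm F t z" using lift[OF X'] by blast
    have "cost \<theta> F t \<le> cost \<theta> F' t" if F': "adm F' t z" for F'
    proof -
      let ?X' = "restrict (\<lambda>r. to_circle (F' r)) {s..t}"
      note p = proj[OF F']
      have "action \<mu> \<theta> s t X \<le> action \<mu> \<theta> s t ?X'" using p by (intro min) auto
      moreover have "action \<mu> \<theta> s t ?X' = cost \<theta> F' t - \<theta> * F' t + \<theta>\<^sup>2 * (t - s) / 2"
        using p by (intro active) auto
      ultimately show ?thesis using active[OF F(1)] F(2) F' by (simp add: adm_def)
    qed
    then have "F \<in> tilted_min \<theta> t z" using F(2) by (simp add: tilted_min_def)
    then show "X \<in> extensional {s..t} \<and> (\<exists>F \<in> tilted_min \<theta> t z. lifts F X s t)"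
      using X'(1) F(1) by (auto simp: H1_paths_def)
  next
    assume "X \<in> extensional {s..t} \<and> (\<exists>F \<in> tilted_min \<theta> t z. lifts F X s t)"
    then obtain F where X: "X \<in> extensional {s..t}" and F: "F \<in> tilted_min \<theta> t z" "lifts F X s t" by blast
    have adm: "adm F t z" using F(1) by (simp add: tilted_min_def)
    have XX: "restrict X {s..t} = X" using X by (rule extensional_restrict)
    have X': "X \<in> H1_paths s t" using lifts_H1_paths[OF F(2)] XX by simp
    have ends: "X s = to_circle Y" "X t = to_circle z"
      using F(2) adm st by (auto simp: lifts_def adm_def to_circle_eq_iff)
    have "action \<mu> \<theta> s t X \<le> action \<mu> \<theta> s t Z"
      if Z: "Z \<in> H1_paths s t" "Z s = to_circle Y" "Z t = to_circle z" for Z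
    proof -
      obtain F' where F': "lifts F' Z s t" "adm F' t z" using lift[OF Z] by blast
      have "cost \<theta> F t \<le> cost \<theta> F' t" using F(1) F'(2) by (simp add: tilted_min_def)
      then show ?thesis using active[OF F(2)] active[OF F'(1)] adm F'(2) by (simp add: adm_def)
    qed
    then show "X \<in> p2p_minimizers \<mu> \<theta> s (to_circle Y) t (to_circle z)"
      using X' ends by (simp add: p2p_minimizers_def)
  qed
qed

section \<open>Bottlenecks and semi-infinite minimizers\<close>

context env begin

text \<open>
  A detour of a straight piece over [s - R, s + R] through a lift of the bottleneck costs at
  most 1 / (4 R), since some lift is within distance 1 / 2 of the midpoint of the piece.
\<close>

lemma pass_bottleneck:
  assumes R: "R > 0"
    and only: "\<And>q y. s - R \<le> q \<Longrightarrow> q \<le> s + R \<Longrightarrow> 0 < w q y \<Longrightarrow> q = s \<and> y - Y \<in> \<int>"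
    and heavy: "1 / (4 * R) < w s Y" and g: "geod F r t" and rt: "r \<le> s - R" "s + R \<le> t"
  shows "F s - Y \<in> \<int>"
proof (rule ccontr)
  assume no: "F s - Y \<notin> \<int>"
  let ?l = "s - R" and ?u = "s + R"
  have g': "geod F ?l ?u" using geod_sub[OF g] rt R by auto
  have nv: "w q (F q) = 0" if "?l \<le> q" "q \<le> ?u" for q
  proof (rule ccontr)
    assume "w q (F q) \<noteq> 0"
    then have "0 < w q (F q)" using w_nonneg[of q "F q"] by simp
    from only[OF that this] no show False by auto
  qed
  have massF: "mass F ?l ?u = 0" unfolding mass_def using nv by (intro sum.neutral) auto
  define c where "c = (F ?l + F ?u) / 2"
  define k where "k = round (c - Y)"
  define v where "v = Y + of_int k"
  have dist: "\<bar>v - c\<bar> \<le> 1 / 2"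
    using of_int_round_abs_le[of "c - Y"] unfolding v_def k_def by (simp add: algebra_simps)
  let ?A = "chord ?l (F ?l) s v" and ?B = "chord s v ?u (F ?u)"
  have lu: "?l < s" "s < ?u" using R by auto
  note A = chord_H1[OF lu(1), of "F ?l" v] and B = chord_H1[OF lu(2), of v "F ?u"]
  have AB: "?A s = ?B s" by (simp add: chord_end[OF lu(1)])
  let ?G = "glue s ?A ?B"
  have lu': "?l \<le> s" "s \<le> ?u" using lu by auto
  have HG: "H1 ?G ?l ?u" by (rule glue_H1[OF A(1) B(1) AB lu'])
  have ends: "?G ?l = F ?l" "?G ?u = F ?u" using lu chord_end[OF lu(2)] by (auto simp: glue_def)
  have JG: "J ?G ?l ?u = J ?A ?l s + J ?B s ?u" by (rule J_glue[OF A(1) B(1) AB lu'])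
  have "w s v \<le> mass ?B s ?u" using mass_ge_start[OF lu(2), of ?B] by simp
  moreover have "w s v = w s Y" unfolding v_def by (rule w_period)
  moreover have "0 \<le> mass ?A ?l s" by (rule mass_nonneg)
  ultimately have "J ?G ?l ?u < (v - F ?l)\<^sup>2 / (2 * R) + (F ?u - v)\<^sup>2 / (2 * R) - 1 / (4 * R)"
    using JG A(2) B(2) heavy by (simp add: J_def)
  also have "\<dots> \<le> (F ?u - F ?l)\<^sup>2 / (4 * R)"
  proof -
    have "2 * (v - F ?l)\<^sup>2 + 2 * (F ?u - v)\<^sup>2 = (F ?u - F ?l)\<^sup>2 + 4 * (v - c)\<^sup>2"
      unfolding c_def by (simp add: power2_eq_square field_simps)
    moreover have "(v - c)\<^sup>2 \<le> (1 / 2)\<^sup>2" using dist by (metis abs_ge_zero power2_abs power_mono)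
    ultimately have "2 * (v - F ?l)\<^sup>2 + 2 * (F ?u - v)\<^sup>2 - 1 \<le> (F ?u - F ?l)\<^sup>2"
      by (simp add: power_divide)
    then have "(2 * (v - F ?l)\<^sup>2 + 2 * (F ?u - v)\<^sup>2 - 1) / (4 * R) \<le> (F ?u - F ?l)\<^sup>2 / (4 * R)"
      using R by (intro divide_right_mono) auto
    moreover have "(2 * (v - F ?l)\<^sup>2 + 2 * (F ?u - v)\<^sup>2 - 1) / (4 * R)
        = (v - F ?l)\<^sup>2 / (2 * R) + (F ?u - v)\<^sup>2 / (2 * R) - 1 / (4 * R)"
      using R by (simp add: add_divide_distrib diff_divide_distrib)
    ultimately show ?thesis by simp
  qed
  also have "\<dots> \<le> J F ?l ?u"
    using energy_ge_chord[OF geod_H1[OF g']] R massF by (simp add: J_def)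
  finally show False using g' HG ends unfolding geod_def by fastforce
qed

text \<open>
  An improvement after the intermediate point could be inserted into the long path, after an
  integer shift of its first part.
\<close>

lemma tilted_min_rebase:
  assumes F: "F \<in> based_env.tilted_min w s1 Y1 \<theta> t z" and s: "s1 \<le> s0" "s0 \<le> t" and i: "F s0 - Y0 \<in> \<int>"
  shows "F \<in> based_env.tilted_min w s0 Y0 \<theta> t z"
proof -
  interpret A: based_env w s1 Y1 by unfold_locales
  interpret B: based_env w s0 Y0 by unfold_locales
  have a: "H1 F s1 t" "F t = z" "F s1 - Y1 \<in> \<int>" using F by (auto simp: A.tilted_min_def A.adm_def)
  have H: "H1 F s1 s0" "H1 F s0 t" using H1_sub[OF a(1)] s by auto
  have "B.cost \<theta> F t \<le> B.cost \<theta> F' t" if F': "B.adm F' t z" for F'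
  proof -
    have f: "H1 F' s0 t" "F' t = z" "F' s0 - Y0 \<in> \<int>" using F' by (auto simp: B.adm_def)
    have "F' s0 - F s0 = (F' s0 - Y0) - (F s0 - Y0)" by simp
    then have "F' s0 - F s0 \<in> \<int>" using Ints_diff[OF f(3) i] by simp
    then obtain m where "F' s0 - F s0 = of_int m" by (rule Ints_cases)
    then have m: "F' s0 = F s0 + of_int m" by simp
    let ?G = "glue s0 (\<lambda>q. F q + of_int m) F'"
    have Hm: "H1 (\<lambda>q. F q + of_int m) s1 s0" using H(1) by (simp only: H1_shift)
    have HG: "H1 ?G s1 t" using m by (intro glue_H1[OF Hm f(1)] s) simp
    have G1: "?G s1 = F s1 + of_int m" using s(1) by (simp add: glue_def)
    have G2: "?G t = z" using s(2) f(2) m a(2) by (cases "t = s0") (auto simp: glue_def)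
    have "?G s1 - Y1 = (F s1 - Y1) + of_int m" unfolding G1 by simp
    then have "?G s1 - Y1 \<in> \<int>" using Ints_add[OF a(3) Ints_of_int[of m]] by metis
    then have "A.adm ?G t z" unfolding A.adm_def using HG G2 by blast
    then have "A.cost \<theta> F t \<le> A.cost \<theta> ?G t" using F by (simp add: A.tilted_min_def)
    moreover have "J ?G s1 t = J (\<lambda>q. F q + of_int m) s1 s0 + J F' s0 t"
      using m by (intro J_glue[OF Hm f(1)] s) simp
    moreover have "J (\<lambda>q. F q + of_int m) s1 s0 = J F s1 s0" by (rule J_shift)
    ultimately have "J F s0 t \<le> J F' s0 t + \<theta> * of_int m"
      using J_split[OF a(1) s] unfolding A.cost_def G1 distrib_left by linarith
    then show ?thesis unfolding B.cost_def m distrib_left by linarith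
  qed
  then show ?thesis using H(2) a(2) i by (simp add: B.tilted_min_def B.adm_def)
qed

lemma tilted_min_extend:
  assumes F: "F \<in> based_env.tilted_min w s1 Y1 \<theta> t z" and s: "s1 \<le> s0" "s0 \<le> t" and i: "F s0 - Y0 \<in> \<int>"
    and F': "F' \<in> based_env.tilted_min w s0 Y0 \<theta> t z"
  shows "\<exists>m. F' s0 = F s0 + of_int m \<and> glue s0 (\<lambda>q. F q + of_int m) F' \<in> based_env.tilted_min w s1 Y1 \<theta> t z"
proof -
  interpret A: based_env w s1 Y1 by unfold_locales
  interpret B: based_env w s0 Y0 by unfold_locales
  have a: "H1 F s1 t" "F t = z" "F s1 - Y1 \<in> \<int>" using F by (auto simp: A.tilted_min_def A.adm_def)
  have H: "H1 F s1 s0" "H1 F s0 t" using H1_sub[OF a(1)] s by auto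
  have f: "H1 F' s0 t" "F' t = z" "F' s0 - Y0 \<in> \<int>" using F' by (auto simp: B.tilted_min_def B.adm_def)
  have "F' s0 - F s0 = (F' s0 - Y0) - (F s0 - Y0)" by simp
  then have "F' s0 - F s0 \<in> \<int>" using Ints_diff[OF f(3) i] by simp
  then obtain m where "F' s0 - F s0 = of_int m" by (rule Ints_cases)
  then have m: "F' s0 = F s0 + of_int m" by simp
  let ?G = "glue s0 (\<lambda>q. F q + of_int m) F'"
  have Hm: "H1 (\<lambda>q. F q + of_int m) s1 s0" using H(1) by (simp only: H1_shift)
  have HG: "H1 ?G s1 t" using m by (intro glue_H1[OF Hm f(1)] s) simp
  have G1: "?G s1 = F s1 + of_int m" using s(1) by (simp add: glue_def)
  have G2: "?G t = z" using s(2) f(2) m a(2) by (cases "t = s0") (auto simp: glue_def)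
  have "?G s1 - Y1 = (F s1 - Y1) + of_int m" unfolding G1 by simp
  then have "?G s1 - Y1 \<in> \<int>" using Ints_add[OF a(3) Ints_of_int[of m]] by metis
  then have adm: "A.adm ?G t z" unfolding A.adm_def using HG G2 by blast
  have "B.cost \<theta> F' t \<le> B.cost \<theta> F t" using F' H(2) a(2) i by (simp add: B.tilted_min_def B.adm_def)
  moreover have "J ?G s1 t = J (\<lambda>q. F q + of_int m) s1 s0 + J F' s0 t"
    using m by (intro J_glue[OF Hm f(1)] s) simp
  moreover have "J (\<lambda>q. F q + of_int m) s1 s0 = J F s1 s0" by (rule J_shift)
  ultimately have le: "A.cost \<theta> ?G t \<le> A.cost \<theta> F t"
    using J_split[OF a(1) s] unfolding A.cost_def B.cost_def G1 m distrib_left by linarith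
  have "A.cost \<theta> ?G t \<le> A.cost \<theta> K t" if "A.adm K t z" for K
    using le F that by (auto simp: A.tilted_min_def intro: order_trans)
  then have "?G \<in> A.tilted_min \<theta> t z" using adm by (simp add: A.tilted_min_def)
  then show ?thesis using m by blast
qed

text \<open>
  If all minimizers from the earlier base point pass the later one, the two problems have the
  same minimizers after the later base time.
\<close>

lemma extremal_rebase:
  assumes s: "s1 < s0" "s0 < t" and q: "s0 \<le> q" "q \<le> t"
    and pass: "\<And>F. F \<in> based_env.tilted_min w s1 Y1 \<theta> t z \<Longrightarrow> F s0 - Y0 \<in> \<int>"
  shows "based_env.leftmost w s1 Y1 \<theta> t z q = based_env.leftmost w s0 Y0 \<theta> t z q"
    and "based_env.rightmost w s1 Y1 \<theta> t z q = based_env.rightmost w s0 Y0 \<theta> t z q"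
proof -
  interpret A: based_env w s1 Y1 by unfold_locales
  interpret B: based_env w s0 Y0 by unfold_locales
  have st: "s1 \<le> s0" "s0 \<le> t" "s1 < t" using s by auto
  have down: "F \<in> B.tilted_min \<theta> t z" if "F \<in> A.tilted_min \<theta> t z" for F
    by (rule tilted_min_rebase[OF that st(1,2) pass[OF that]])
  have up: "\<exists>K\<in>A.tilted_min \<theta> t z. K q = F' q" if F': "F' \<in> B.tilted_min \<theta> t z" for F'
  proof -
    have F: "A.leftmost \<theta> t z \<in> A.tilted_min \<theta> t z" by (rule A.leftmost_tilted_min[OF st(3)])
    from tilted_min_extend[OF F st(1,2) pass[OF F] F'] obtain m where
      m: "F' s0 = A.leftmost \<theta> t z s0 + of_int m" "glue s0 (\<lambda>q. A.leftmost \<theta> t z q + of_int m) F' \<in> A.tilted_min \<theta> t z" by blast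
    have "glue s0 (\<lambda>q. A.leftmost \<theta> t z q + of_int m) F' q = F' q" using m(1) q by (auto simp: glue_def)
    then show ?thesis using m(2) by blast
  qed
  have qq: "s1 \<le> q" using q s by simp
  have "(\<lambda>F. F q) ` A.tilted_min \<theta> t z = (\<lambda>F. F q) ` B.tilted_min \<theta> t z"
  proof (intro equalityI subsetI)
    fix x assume "x \<in> (\<lambda>F. F q) ` B.tilted_min \<theta> t z"
    then obtain F' where F': "F' \<in> B.tilted_min \<theta> t z" "x = F' q" by blast
    obtain K where "K \<in> A.tilted_min \<theta> t z" "K q = F' q" using up[OF F'(1)] by blast
    then show "x \<in> (\<lambda>F. F q) ` A.tilted_min \<theta> t z" using F'(2) by (intro image_eqI[of _ _ K]) simp_all
  next
    fix x assume "x \<in> (\<lambda>F. F q) ` A.tilted_min \<theta> t z"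
    then obtain F where "F \<in> A.tilted_min \<theta> t z" "x = F q" by blast
    then show "x \<in> (\<lambda>F. F q) ` B.tilted_min \<theta> t z" using down by (intro image_eqI[of _ _ F]) simp_all
  qed
  then show "A.leftmost \<theta> t z q = B.leftmost \<theta> t z q" "A.rightmost \<theta> t z q = B.rightmost \<theta> t z q"
    by (simp_all only: A.leftmost_def B.leftmost_def A.rightmost_def B.rightmost_def)
qed

end

definition bottleneck :: "(real \<times> circle) measure \<Rightarrow> real \<Rightarrow> real \<Rightarrow> real \<Rightarrow> bool" where
  "bottleneck \<mu> R s Y \<longleftrightarrow> msupp \<mu> \<inter> ({s - R..s + R} \<times> UNIV) = {(s, to_circle Y)} \<and>
     measure \<mu> {(s, to_circle Y)} > 1 / (4 * R)"

text \<open>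
  A sequence of bottlenecks that recedes to time minus infinity. All semi-infinite minimizers
  that end late enough pass each of them.
\<close>

locale bottlenecks =
  fixes \<mu> :: "(real \<times> circle) measure" and R :: real and bs Ys :: "nat \<Rightarrow> real"
  assumes mu: "\<mu> \<in> Omega" and R: "R > 0" and bn: "bottleneck \<mu> R (bs k) (Ys k)"
    and bs_step: "bs (Suc k) \<le> bs k - R"
begin

sublocale env "weight \<mu>" by (rule env_weight[OF mu])

lemma based: "based_env (weight \<mu>)" by (rule based_env_weight[OF mu])

abbreviation Mk :: "nat \<Rightarrow> real \<Rightarrow> real \<Rightarrow> real \<Rightarrow> (real \<Rightarrow> real) set" where
  "Mk k \<equiv> based_env.tilted_min (weight \<mu>) (bs k) (Ys k)"

abbreviation Lk :: "nat \<Rightarrow> real \<Rightarrow> real \<Rightarrow> real \<Rightarrow> real \<Rightarrow> real" where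
  "Lk k \<equiv> based_env.leftmost (weight \<mu>) (bs k) (Ys k)"

abbreviation Rk :: "nat \<Rightarrow> real \<Rightarrow> real \<Rightarrow> real \<Rightarrow> real \<Rightarrow> real" where
  "Rk k \<equiv> based_env.rightmost (weight \<mu>) (bs k) (Ys k)"

lemma bs_less: "j < k \<Longrightarrow> bs k \<le> bs j - R"
proof (induction k)
  case (Suc k)
  show ?case
  proof (cases "j = k")
    case True then show ?thesis using bs_step by simp
  next
    case False
    then have "bs k \<le> bs j - R" using Suc by simp
    then show ?thesis using bs_step[of k] R by simp
  qed
qed simp

lemma bs_mono: "j \<le> k \<Longrightarrow> bs k \<le> bs j"
  using bs_less[of j k] R by (cases "j = k") auto

lemma bs_unbounded: "\<exists>k. bs k \<le> r"
proof -
  have le: "bs k \<le> bs 0 - real k * R" for k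
  proof (induction k)
    case (Suc k) then show ?case using bs_step[of k] by (simp add: distrib_right)
  qed simp
  obtain k :: nat where "(bs 0 - r) / R < real k" using reals_Archimedean2 by blast
  then have "bs 0 - r < real k * R" using R by (simp add: pos_divide_less_eq)
  then show ?thesis using le[of k] by (intro exI[of _ k]) simp
qed

lemma bottleneck_only:
  assumes "bs k - R \<le> q" "q \<le> bs k + R" "0 < weight \<mu> q y"
  shows "q = bs k \<and> y - Ys k \<in> \<int>"
proof -
  have "(q, to_circle y) \<in> msupp \<mu>" using assms(3) weight_pos_iff[OF mu] by blast
  then have "(q, to_circle y) \<in> msupp \<mu> \<inter> ({bs k - R..bs k + R} \<times> UNIV)" using assms by simp
  then have "(q, to_circle y) = (bs k, to_circle (Ys k))" using bn[of k] unfolding bottleneck_def by simp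
  then show ?thesis by (simp add: to_circle_eq_iff)
qed

lemma pass:
  assumes F: "F \<in> based_env.tilted_min (weight \<mu>) s Y \<theta> t z" and s: "s \<le> bs j - R" "bs j + R \<le> t"
  shows "F (bs j) - Ys j \<in> \<int>"
proof -
  interpret B: based_env "weight \<mu>" s Y by (rule based)
  have "1 / (4 * R) < weight \<mu> (bs j) (Ys j)" using bn[of j] by (simp add: bottleneck_def weight_def)
  from pass_bottleneck[OF R bottleneck_only this B.tilted_min_geod[OF F] s] show ?thesis .
qed

lemma extremal_consistent:
  assumes t: "bs 0 + R \<le> t" and jk: "j \<le> k" and q: "bs j \<le> q" "q \<le> t"
  shows "Lk k \<theta> t z q = Lk j \<theta> t z q" and "Rk k \<theta> t z q = Rk j \<theta> t z q"
proof -
  have "Lk k \<theta> t z q = Lk j \<theta> t z q \<and> Rk k \<theta> t z q = Rk j \<theta> t z q"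
  proof (cases "j = k")
    case False
    then have b: "bs k \<le> bs j - R" using bs_less jk by simp
    have jt: "bs j + R \<le> t" using bs_mono[of 0 j] t by simp
    have lt: "bs k < bs j" "bs j < t" using b jt R by auto
    note rebase = extremal_rebase[where ?s1.0 = "bs k" and ?s0.0 = "bs j" and ?Y1.0 = "Ys k" and ?Y0.0 = "Ys j"
        and \<theta> = \<theta> and z = z and t = t and q = q, OF lt q]
    show ?thesis by (intro conjI rebase) (rule pass[OF _ b jt], assumption)+
  qed simp
  then show "Lk k \<theta> t z q = Lk j \<theta> t z q" "Rk k \<theta> t z q = Rk j \<theta> t z q" by auto
qed

lemma minimizer_lift:
  assumes t: "bs 0 + R \<le> t" and Y: "Y \<in> minimizers \<mu> \<theta> t (to_circle z)"
  shows "\<exists>H\<in>Mk k \<theta> t z. lifts H Y (bs k) t"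
proof -
  let ?s = "bs (Suc k)"
  have kt: "bs k + R \<le> t" using bs_mono[of 0 k] t by simp
  have st: "?s < t" "?s \<le> bs k" "bs k \<le> t" using bs_step[of k] kt R by auto
  obtain y where y: "Y ?s = to_circle y" using to_circle_surj by blast
  have "restrict Y {?s..t} \<in> p2p_minimizers \<mu> \<theta> ?s (Y ?s) t (Y t)" "Y t = to_circle z"
    using Y st(1) by (auto simp: minimizers_def minimizers_to_time_def)
  then have "restrict Y {?s..t} \<in> p2p_minimizers \<mu> \<theta> ?s (to_circle y) t (to_circle z)" using y by simp
  then obtain H where H: "H \<in> based_env.tilted_min (weight \<mu>) ?s y \<theta> t z" "lifts H (restrict Y {?s..t}) ?s t"
    using p2p_minimizers_iff[OF mu st(1)] by blast
  have "lifts H Y ?s t" using H(2) by (simp add: lifts_def)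
  then have "lifts H Y (bs k) t" using lifts_sub[of H Y ?s t "bs k" t] st by simp
  moreover have "H (bs k) - Ys k \<in> \<int>" by (rule pass[OF H(1) bs_step kt])
  then have "H \<in> Mk k \<theta> t z" by (rule tilted_min_rebase[OF H(1) st(2,3)])
  ultimately show ?thesis by blast
qed

lemma project_minimizer:
  assumes t: "bs 0 + R \<le> t" and H: "\<And>k. H \<in> Mk k \<theta> t z"
  defines "X \<equiv> restrict (\<lambda>r. to_circle (H r)) {..t}"
  shows "X \<in> minimizers \<mu> \<theta> t (to_circle z)" and "s \<le> t \<Longrightarrow> lifts H X s t"
proof -
  have lift: "lifts H X s t" if "s \<le> t" for s
  proof -
    obtain k where k: "bs k \<le> s" using bs_unbounded by blast
    interpret B: based_env "weight \<mu>" "bs k" "Ys k" by (rule based)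
    have "H1 H s t" using H1_sub[OF B.tilted_min_H1[OF H]] k by simp
    then show ?thesis by (simp add: lifts_def X_def)
  qed
  then show "s \<le> t \<Longrightarrow> lifts H X s t" .
  have Ht: "H t = z"
  proof -
    interpret B: based_env "weight \<mu>" "bs 0" "Ys 0" by (rule based)
    show ?thesis by (rule B.tilted_min_end[OF H])
  qed
  have Xt: "X t = to_circle z" by (simp add: X_def Ht)
  have "restrict X {s..t} \<in> p2p_minimizers \<mu> \<theta> s (X s) t (X t)" if s: "s < t" for s
  proof -
    obtain k where k: "bs k \<le> s" using bs_unbounded by blast
    have "H \<in> based_env.tilted_min (weight \<mu>) s (H s) \<theta> t z"
      by (rule tilted_min_rebase[OF H k]) (use s in auto)
    moreover have "lifts H (restrict X {s..t}) s t" using lift[of s] s by (simp add: lifts_def)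
    ultimately have "restrict X {s..t} \<in> p2p_minimizers \<mu> \<theta> s (to_circle (H s)) t (to_circle z)"
      unfolding p2p_minimizers_iff[OF mu s] by auto
    then show ?thesis using s Xt by (simp add: X_def)
  qed
  moreover have "X \<in> H1_loc_paths t"
    unfolding H1_loc_paths_def using lifts_H1_paths[OF lift] by (auto simp: X_def)
  ultimately show "X \<in> minimizers \<mu> \<theta> t (to_circle z)"
    using Xt by (simp add: minimizers_def minimizers_to_time_def)
qed

lemma minimizer_ext: "Y \<in> minimizers \<mu> \<theta> t x \<Longrightarrow> Y \<in> extensional {..t}"
  by (simp add: minimizers_def minimizers_to_time_def H1_loc_paths_def)

lemma minimizer_displacement:
  assumes t: "bs 0 + R \<le> t" and Y: "Y \<in> minimizers \<mu> \<theta> t (to_circle z)" and r: "bs k \<le> r" "r \<le> t"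
  shows "\<exists>H\<in>Mk k \<theta> t z. displacement Y r t = z - H r \<and> Y r = to_circle (H r)"
proof -
  obtain H where H: "H \<in> Mk k \<theta> t z" "lifts H Y (bs k) t" using minimizer_lift[OF t Y] by blast
  interpret B: based_env "weight \<mu>" "bs k" "Ys k" by (rule based)
  have "lifts H Y r t" by (rule lifts_sub[OF H(2) r(1)]) simp
  from displacement_lift[OF this r(2)] have "displacement Y r t = z - H r" using B.tilted_min_end[OF H(1)] by simp
  moreover have "Y r = to_circle (H r)" using H(2) r by (simp add: lifts_def)
  ultimately show ?thesis using H(1) by blast
qed

text \<open>
  The index of the latest bottleneck that is not after time r.
\<close>

definition level :: "real \<Rightarrow> nat" where "level r = (LEAST k. bs k \<le> r)"

lemma level: "bs (level r) \<le> r"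
  unfolding level_def using bs_unbounded by (rule LeastI_ex)

lemma level_le: "bs k \<le> r \<Longrightarrow> level r \<le> k"
  unfolding level_def by (rule Least_le)

text \<open>
  The semi-infinite extremal minimizers: those that start at successive bottlenecks extend
  each other.
\<close>

definition Linf :: "real \<Rightarrow> real \<Rightarrow> real \<Rightarrow> real \<Rightarrow> real" where
  "Linf \<theta> t z r = Lk (level r) \<theta> t z r"

definition Rinf :: "real \<Rightarrow> real \<Rightarrow> real \<Rightarrow> real \<Rightarrow> real" where
  "Rinf \<theta> t z r = Rk (level r) \<theta> t z r"

lemma Linf_eq: "bs 0 + R \<le> t \<Longrightarrow> bs k \<le> r \<Longrightarrow> r \<le> t \<Longrightarrow> Linf \<theta> t z r = Lk k \<theta> t z r"
  and Rinf_eq: "bs 0 + R \<le> t \<Longrightarrow> bs k \<le> r \<Longrightarrow> r \<le> t \<Longrightarrow> Rinf \<theta> t z r = Rk k \<theta> t z r"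
  unfolding Linf_def Rinf_def using extremal_consistent[OF _ level_le level] by simp_all

lemma bs_lt: "bs 0 + R \<le> t \<Longrightarrow> bs k < t"
  using bs_mono[of 0 k] R by simp

lemma inf_tilted_min:
  assumes t: "bs 0 + R \<le> t"
  shows "Linf \<theta> t z \<in> Mk k \<theta> t z" and "Rinf \<theta> t z \<in> Mk k \<theta> t z"
proof -
  interpret B: based_env "weight \<mu>" "bs k" "Ys k" by (rule based)
  have kt: "bs k < t" by (rule bs_lt[OF t])
  show "Linf \<theta> t z \<in> B.tilted_min \<theta> t z"
    by (rule B.tilted_min_cong[OF B.leftmost_tilted_min[OF kt]]) (use kt Linf_eq[OF t] in auto)
  show "Rinf \<theta> t z \<in> B.tilted_min \<theta> t z"
    by (rule B.tilted_min_cong[OF B.rightmost_tilted_min[OF kt]]) (use kt Rinf_eq[OF t] in auto)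
qed

text \<open>
  The path \<open>Linf\<close> lies to the left of every other minimizer at all times, so it
  is both the only minimizer that is extremal in the order of displacements and a least one;
  similarly for \<open>Rinf\<close>.
\<close>

lemma extremal_path_eq:
  assumes t: "bs 0 + R \<le> t"
  shows "extremal_path \<mu> Lft \<theta> t (to_circle z) = restrict (\<lambda>r. to_circle (Linf \<theta> t z r)) {..t}" (is "_ = ?L")
    and "extremal_path \<mu> Rgt \<theta> t (to_circle z) = restrict (\<lambda>r. to_circle (Rinf \<theta> t z r)) {..t}" (is "_ = ?R")
proof -
  let ?min = "minimizers \<mu> \<theta> t (to_circle z)"
  note PL = project_minimizer[OF t inf_tilted_min(1)[OF t, where \<theta> = \<theta> and z = z]]
  note PR = project_minimizer[OF t inf_tilted_min(2)[OF t, where \<theta> = \<theta> and z = z]]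
  have ends: "Linf \<theta> t z t = z" "Rinf \<theta> t z t = z"
  proof -
    interpret B: based_env "weight \<mu>" "bs 0" "Ys 0" by (rule based)
    show "Linf \<theta> t z t = z" "Rinf \<theta> t z t = z" by (auto intro: B.tilted_min_end inf_tilted_min[OF t])
  qed
  have dL: "displacement ?L r t = z - Linf \<theta> t z r" if "r \<le> t" for r
    using displacement_lift[OF PL(2)[OF that] that] ends by simp
  have dR: "displacement ?R r t = z - Rinf \<theta> t z r" if "r \<le> t" for r
    using displacement_lift[OF PR(2)[OF that] that] ends by simp
  have cmp: "\<exists>h. displacement Y r t = z - h \<and> Y r = to_circle h \<and> Linf \<theta> t z r \<le> h \<and> h \<le> Rinf \<theta> t z r"
    if Y: "Y \<in> ?min" and r: "r \<le> t" for Y r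
  proof -
    interpret B: based_env "weight \<mu>" "bs (level r)" "Ys (level r)" by (rule based)
    obtain H where H: "H \<in> B.tilted_min \<theta> t z" "displacement Y r t = z - H r" "Y r = to_circle (H r)"
      using minimizer_displacement[OF t Y level r] by blast
    show ?thesis
      using H B.leftmost_le[OF bs_lt[OF t] H(1) level r] B.rightmost_ge[OF bs_lt[OF t] H(1) level r]
      by (intro exI[of _ "H r"]) (simp add: Linf_def Rinf_def)
  qed
  have eqL: "Y = ?L" if Y: "Y \<in> ?min" "path_le t Y ?L" for Y
  proof (rule extensionalityI[OF minimizer_ext[OF Y(1)]])
    show "?L \<in> extensional {..t}" by simp
    fix r assume "r \<in> {..t}"
    then have r: "r \<le> t" by simp
    obtain h where "displacement Y r t = z - h" "Y r = to_circle h" "Linf \<theta> t z r \<le> h"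
      using cmp[OF Y(1) r] by blast
    moreover have "displacement ?L r t \<le> displacement Y r t" using Y(2) r by (simp add: path_le_def)
    ultimately show "Y r = ?L r" using dL[OF r] r by simp
  qed
  have eqR: "Y = ?R" if Y: "Y \<in> ?min" "path_le t ?R Y" for Y
  proof (rule extensionalityI[OF minimizer_ext[OF Y(1)]])
    show "?R \<in> extensional {..t}" by simp
    fix r assume "r \<in> {..t}"
    then have r: "r \<le> t" by simp
    obtain h where "displacement Y r t = z - h" "Y r = to_circle h" "h \<le> Rinf \<theta> t z r"
      using cmp[OF Y(1) r] by blast
    moreover have "displacement Y r t \<le> displacement ?R r t" using Y(2) r by (simp add: path_le_def)
    ultimately show "Y r = ?R r" using dR[OF r] r by simp
  qed
  have leL: "path_le t ?L Y" if Y: "Y \<in> ?min" for Y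
    unfolding path_le_def
  proof (intro allI impI)
    fix r assume r: "r \<le> t"
    obtain h where "displacement Y r t = z - h" "Linf \<theta> t z r \<le> h" using cmp[OF Y r] by blast
    then show "displacement Y r t \<le> displacement ?L r t" using dL[OF r] by linarith
  qed
  have leR: "path_le t Y ?R" if Y: "Y \<in> ?min" for Y
    unfolding path_le_def
  proof (intro allI impI)
    fix r assume r: "r \<le> t"
    obtain h where "displacement Y r t = z - h" "h \<le> Rinf \<theta> t z r" using cmp[OF Y r] by blast
    then show "displacement ?R r t \<le> displacement Y r t" using dR[OF r] by linarith
  qed
  have L: "?L \<in> ?min" by (rule PL(1))
  have R': "?R \<in> ?min" by (rule PR(1))
  show "extremal_path \<mu> Lft \<theta> t (to_circle z) = ?L"
    unfolding extremal_path.simps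
  proof (rule the_equality)
    show "?L \<in> ?min \<and> (\<forall>Y\<in>?min. path_le t Y ?L \<longrightarrow> Y = ?L)" using L eqL by blast
    show "X = ?L" if "X \<in> ?min \<and> (\<forall>Y\<in>?min. path_le t Y X \<longrightarrow> Y = X)" for X
      using that L leL[of X] by blast
  qed
  show "extremal_path \<mu> Rgt \<theta> t (to_circle z) = ?R"
    unfolding extremal_path.simps
  proof (rule the_equality)
    show "?R \<in> ?min \<and> (\<forall>Y\<in>?min. path_le t ?R Y \<longrightarrow> Y = ?R)" using R' eqR by blast
    show "X = ?R" if "X \<in> ?min \<and> (\<forall>Y\<in>?min. path_le t X Y \<longrightarrow> Y = X)" for X
      using that R' leR[of X] by blast
  qed
qed

lemma extremal_path_lifts:
  assumes t: "bs 0 + R \<le> t"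
  shows "lifts (Lk 0 \<theta> t z) (extremal_path \<mu> Lft \<theta> t (to_circle z)) (bs 0) t"
    and "lifts (Rk 0 \<theta> t z) (extremal_path \<mu> Rgt \<theta> t (to_circle z)) (bs 0) t"
proof -
  interpret B: based_env "weight \<mu>" "bs 0" "Ys 0" by (rule based)
  have t': "bs 0 < t" by (rule bs_lt[OF t])
  show "lifts (B.leftmost \<theta> t z) (extremal_path \<mu> Lft \<theta> t (to_circle z)) (bs 0) t"
    unfolding extremal_path_eq[OF t] lifts_def using B.tilted_min_H1[OF B.leftmost_tilted_min[OF t']] Linf_eq[OF t, of 0] by simp
  show "lifts (B.rightmost \<theta> t z) (extremal_path \<mu> Rgt \<theta> t (to_circle z)) (bs 0) t"
    unfolding extremal_path_eq[OF t] lifts_def using B.tilted_min_H1[OF B.rightmost_tilted_min[OF t']] Rinf_eq[OF t, of 0] by simp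
qed

end

section \<open>Translation to velocities and shocks on the circle\<close>

lemma at_within_atMost: "at (x::real) within {..x} = at_left x"
proof -
  have "{..x} - {x} = {..<x} - {x}" by auto
  then show ?thesis unfolding at_within_def by simp
qed

lemma at_within_atLeast: "at (x::real) within {x..} = at_right x"
proof -
  have "{x..} - {x} = {x<..} - {x}" by auto
  then show ?thesis unfolding at_within_def by simp
qed

lemma circle_deriv_eq:
  assumes "has_circle_derivative f d x A" "at x within A \<noteq> bot"
  shows "circle_deriv f x A = d"
  unfolding circle_deriv_def
proof (rule the_equality)
  show "e = d" if "has_circle_derivative f e x A" for e
    by (rule has_circle_derivative_unique[OF that assms])
qed (rule assms(1))

lemma has_circle_derivative_end:
  assumes lin: "\<And>q. r \<le> q \<Longrightarrow> q \<le> t \<Longrightarrow> X q = to_circle (z - d * (t - q))" and r: "r < t"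
  shows "has_circle_derivative X d t {..t}"
  unfolding has_circle_derivative_def
proof (intro exI[of _ "\<lambda>q. z - d * (t - q)"] conjI)
  show "X t = to_circle (z - d * (t - t))" using lin[of t] r by simp
  show "\<forall>\<^sub>F y in at t within {..t}. X y = to_circle (z - d * (t - y))"
    unfolding at_within_atMost eventually_at_left_field using r lin by (intro exI[of _ r]) simp
  show "((\<lambda>q. z - d * (t - q)) has_real_derivative d) (at t within {..t})"
    by (auto intro!: derivative_eq_intros)
qed

context bottlenecks begin

interpretation B: based_env "weight \<mu>" "bs 0" "Ys 0" by (rule based)

lemma velocity_eq:
  assumes t: "bs 0 + R \<le> t"
  shows "velocity \<mu> Lft \<theta> t (to_circle z) = B.left_slope t (B.left_end t \<theta> z)"
    and "velocity \<mu> Rgt \<theta> t (to_circle z) = B.right_slope t (B.right_end t \<theta> z)"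
proof -
  have t': "bs 0 < t" by (rule bs_lt[OF t])
  have nb: "at t within {..t} \<noteq> bot" unfolding at_within_atMost by simp
  note XL = extremal_path_lifts(1)[OF t, of \<theta> z] and XR = extremal_path_lifts(2)[OF t, of \<theta> z]
  obtain r where r: "bs 0 \<le> r" "r < t"
    and l: "\<And>q. r \<le> q \<Longrightarrow> q \<le> t \<Longrightarrow> B.leftmost \<theta> t z q = z - B.left_slope t (B.left_end t \<theta> z) * (t - q)"
    using B.leftmost_last[OF t', of \<theta> z] by blast
  have "extremal_path \<mu> Lft \<theta> t (to_circle z) q = to_circle (z - B.left_slope t (B.left_end t \<theta> z) * (t - q))"
    if "r \<le> q" "q \<le> t" for q
    using XL that r l[OF that] by (simp add: lifts_def)
  from circle_deriv_eq[OF has_circle_derivative_end[OF this r(2)] nb]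
  show "velocity \<mu> Lft \<theta> t (to_circle z) = B.left_slope t (B.left_end t \<theta> z)" unfolding velocity_def by simp
  obtain r where r: "bs 0 \<le> r" "r < t"
    and l: "\<And>q. r \<le> q \<Longrightarrow> q \<le> t \<Longrightarrow> B.rightmost \<theta> t z q = z - B.right_slope t (B.right_end t \<theta> z) * (t - q)"
    using B.rightmost_last[OF t', of \<theta> z] by blast
  have "extremal_path \<mu> Rgt \<theta> t (to_circle z) q = to_circle (z - B.right_slope t (B.right_end t \<theta> z) * (t - q))"
    if "r \<le> q" "q \<le> t" for q
    using XR that r l[OF that] by (simp add: lifts_def)
  from circle_deriv_eq[OF has_circle_derivative_end[OF this r(2)] nb]
  show "velocity \<mu> Rgt \<theta> t (to_circle z) = B.right_slope t (B.right_end t \<theta> z)" unfolding velocity_def by simp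
qed

lemma shocks_iff:
  assumes t: "bs 0 + R \<le> t"
  shows "(\<theta>, t, to_circle z) \<in> shocks \<mu> \<longleftrightarrow> B.shock \<theta> t z"
  by (simp add: shocks_def velocity_eq[OF t] B.shock_def)

lemma extremal_path_at:
  assumes t: "bs 0 + R \<le> t" and q: "bs 0 \<le> q" "q \<le> t"
  shows "extremal_path \<mu> Lft \<theta> t (to_circle z) q = to_circle (B.leftmost \<theta> t z q)"
    and "extremal_path \<mu> Rgt \<theta> t (to_circle z) q = to_circle (B.rightmost \<theta> t z q)"
  using extremal_path_lifts[OF t, of \<theta> z] q by (auto simp: lifts_def)

lemma T_vee_eq:
  assumes t: "bs 0 + R \<le> t" and sh: "B.shock \<theta> t z"
  shows "T_vee \<mu> \<theta> t (to_circle z) = B.meeting_time \<theta> t z"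
proof -
  have t': "bs 0 < t" by (rule bs_lt[OF t])
  note co = B.coalesce[OF t' sh]
  have same: "extremal_path \<mu> Lft \<theta> t (to_circle z) q = extremal_path \<mu> Rgt \<theta> t (to_circle z) q \<longleftrightarrow>
      B.rightmost \<theta> t z q - B.leftmost \<theta> t z q \<in> \<int>" if "bs 0 \<le> q" "q \<le> t" for q
  proof -
    have "extremal_path \<mu> Lft \<theta> t (to_circle z) q = extremal_path \<mu> Rgt \<theta> t (to_circle z) q \<longleftrightarrow>
        to_circle (B.rightmost \<theta> t z q) = to_circle (B.leftmost \<theta> t z q)"
      unfolding extremal_path_at[OF t that] by (rule eq_commute)
    then show ?thesis by (simp only: to_circle_eq_iff)
  qed
  have int: "B.rightmost \<theta> t z (B.meeting_time \<theta> t z) - B.leftmost \<theta> t z (B.meeting_time \<theta> t z) \<in> \<int>" using co(3) by auto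
  show ?thesis unfolding T_vee_def
  proof (rule cSup_eq_maximum)
    show "B.meeting_time \<theta> t z \<in> {s. s < t \<and> extremal_path \<mu> Lft \<theta> t (to_circle z) s = extremal_path \<mu> Rgt \<theta> t (to_circle z) s}"
      using same[of "B.meeting_time \<theta> t z"] int co(1,2) by simp
    fix s assume s: "s \<in> {s. s < t \<and> extremal_path \<mu> Lft \<theta> t (to_circle z) s = extremal_path \<mu> Rgt \<theta> t (to_circle z) s}"
    show "s \<le> B.meeting_time \<theta> t z"
    proof (rule ccontr)
      assume "\<not> s \<le> B.meeting_time \<theta> t z"
      then have "B.meeting_time \<theta> t z < s" "s < t" "bs 0 \<le> s" using s co(1) by auto
      then show False using co(4)[of s] same[of s] s by simp
    qed
  qed
qed

lemma global_shocks_iff: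
  assumes t: "bs 0 + R \<le> t"
  shows "(\<theta>, t, to_circle z) \<in> global_shocks \<mu> \<longleftrightarrow> B.global_shock \<theta> t z"
proof (cases "B.shock \<theta> t z")
  case True
  have t': "bs 0 < t" by (rule bs_lt[OF t])
  let ?m = "B.meeting_time \<theta> t z"
  have m: "bs 0 \<le> ?m" "?m < t" using B.coalesce(1,2)[OF t' True] by auto
  have "lifts (B.leftmost \<theta> t z) (extremal_path \<mu> Lft \<theta> t (to_circle z)) ?m t"
    "lifts (B.rightmost \<theta> t z) (extremal_path \<mu> Rgt \<theta> t (to_circle z)) ?m t"
    by (rule lifts_sub[OF extremal_path_lifts(1)[OF t]] lifts_sub[OF extremal_path_lifts(2)[OF t]]; use m in simp)+
  then have "displacement (extremal_path \<mu> Lft \<theta> t (to_circle z)) ?m t = z - B.leftmost \<theta> t z ?m"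
    "displacement (extremal_path \<mu> Rgt \<theta> t (to_circle z)) ?m t = z - B.rightmost \<theta> t z ?m"
    using displacement_lift m B.tilted_min_end[OF B.leftmost_tilted_min[OF t']] B.tilted_min_end[OF B.rightmost_tilted_min[OF t']] by auto
  then show ?thesis
    using True by (simp add: global_shocks_def shocks_iff[OF t] T_vee_eq[OF t] B.global_shock_def)
qed (simp add: global_shocks_def shocks_iff[OF t] B.global_shock_def)

lemma weight_late:
  assumes "bs 0 < r" "0 < weight \<mu> r y" shows "bs 0 + R \<le> r"
  using bottleneck_only[of 0 r y] assms R by (cases "bs 0 + R \<le> r") auto

text \<open>
  Atoms after the bottleneck come later than its window, so that the description of shocks and
  global shocks by minimizers from the bottleneck applies to them.
\<close>

lemma omega:
  assumes \<mu>: "\<mu> \<in> OmegaT" shows "omega_env (weight \<mu>) (bs 0) (Ys 0)"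
proof
  fix r y \<theta>
  assume r: "bs 0 < r" "0 < weight \<mu> r y" and sh: "B.shock \<theta> r y"
  have t: "bs 0 + R \<le> r" by (rule weight_late[OF r])
  have "(r, to_circle y) \<in> shocks_at \<mu> \<theta> \<inter> msupp \<mu>"
    using sh r(2) shocks_iff[OF t] weight_pos_iff[OF mu] by (simp add: shocks_at_def)
  then have "(r, to_circle y) \<in> global_shocks_at \<mu> \<theta>" using \<mu> by (auto simp: OmegaT_def)
  then show "B.global_shock \<theta> r y" using global_shocks_iff[OF t] by (simp add: global_shocks_at_def)
next
  fix r y \<theta> r' y'
  assume r: "bs 0 < r" "0 < weight \<mu> r y" "B.global_shock \<theta> r y"
    and r': "bs 0 < r'" "0 < weight \<mu> r' y'" "B.global_shock \<theta> r' y'"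
  let ?S = "global_shocks_at \<mu> \<theta> \<inter> msupp \<mu>"
  have "finite ?S" "card ?S \<le> Suc 0" using \<mu> by (auto simp: OmegaT_def)
  then have "\<forall>p\<in>?S. \<forall>q\<in>?S. p = q" using card_le_Suc0_iff_eq by blast
  moreover have "(r, to_circle y) \<in> ?S"
    using r global_shocks_iff[OF weight_late[OF r(1,2)]] weight_pos_iff[OF mu] by (simp add: global_shocks_at_def)
  moreover have "(r', to_circle y') \<in> ?S"
    using r' global_shocks_iff[OF weight_late[OF r'(1,2)]] weight_pos_iff[OF mu] by (simp add: global_shocks_at_def)
  ultimately have "(r, to_circle y) = (r', to_circle y')" by blast
  then show "r = r' \<and> y - y' \<in> \<int>" by (simp add: to_circle_eq_iff)
qed

context
  assumes OT: "\<mu> \<in> OmegaT"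
begin

interpretation O: omega_env "weight \<mu>" "bs 0" "Ys 0" by (rule omega[OF OT])

lemma sided_iff:
  assumes t: "bs 0 + R \<le> t"
  shows "(\<theta>, t, to_circle z) \<in> sided_global_shocks \<mu> Lft \<longleftrightarrow>
      B.global_shock \<theta> t z \<and> (\<exists>s. B.meeting_time \<theta> t z < s \<and> s < t \<and> O.source \<theta> s (B.rightmost \<theta> t z s))"
    and "(\<theta>, t, to_circle z) \<in> sided_global_shocks \<mu> Rgt \<longleftrightarrow>
      B.global_shock \<theta> t z \<and> (\<exists>s. B.meeting_time \<theta> t z < s \<and> s < t \<and> O.source \<theta> s (B.leftmost \<theta> t z s))"
proof -
  have src: "(s, to_circle y) \<in> global_shocks_at \<mu> \<theta> \<inter> msupp \<mu> \<longleftrightarrow> O.source \<theta> s y" if s: "bs 0 < s" for s y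
  proof (cases "0 < weight \<mu> s y")
    case True
    then show ?thesis
      using s global_shocks_iff[OF weight_late[OF s True]] weight_pos_iff[OF mu]
      by (simp add: O.source_def global_shocks_at_def)
  qed (use weight_pos_iff[OF mu] in \<open>simp add: O.source_def\<close>)
  have *: "B.meeting_time \<theta> t z < s \<and> s < t \<and> (s, extremal_path \<mu> Rgt \<theta> t (to_circle z) s) \<in> global_shocks_at \<mu> \<theta> \<inter> msupp \<mu> \<longleftrightarrow>
      B.meeting_time \<theta> t z < s \<and> s < t \<and> O.source \<theta> s (B.rightmost \<theta> t z s)"
    "B.meeting_time \<theta> t z < s \<and> s < t \<and> (s, extremal_path \<mu> Lft \<theta> t (to_circle z) s) \<in> global_shocks_at \<mu> \<theta> \<inter> msupp \<mu> \<longleftrightarrow>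
      B.meeting_time \<theta> t z < s \<and> s < t \<and> O.source \<theta> s (B.leftmost \<theta> t z s)" if g: "B.global_shock \<theta> t z" for s
  proof -
    have "bs 0 \<le> B.meeting_time \<theta> t z"
      using B.coalesce(1)[OF bs_lt[OF t]] g by (simp add: B.global_shock_def)
    then have "bs 0 < s" if "B.meeting_time \<theta> t z < s" using that by simp
    then show "B.meeting_time \<theta> t z < s \<and> s < t \<and> (s, extremal_path \<mu> Rgt \<theta> t (to_circle z) s) \<in> global_shocks_at \<mu> \<theta> \<inter> msupp \<mu> \<longleftrightarrow>
      B.meeting_time \<theta> t z < s \<and> s < t \<and> O.source \<theta> s (B.rightmost \<theta> t z s)"
      "B.meeting_time \<theta> t z < s \<and> s < t \<and> (s, extremal_path \<mu> Lft \<theta> t (to_circle z) s) \<in> global_shocks_at \<mu> \<theta> \<inter> msupp \<mu> \<longleftrightarrow>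
      B.meeting_time \<theta> t z < s \<and> s < t \<and> O.source \<theta> s (B.leftmost \<theta> t z s)"
      using extremal_path_at[OF t, of s \<theta> z] src by (metis less_imp_le)+
  qed
  have TV: "T_vee \<mu> \<theta> t (to_circle z) = B.meeting_time \<theta> t z" if "B.global_shock \<theta> t z"
    using T_vee_eq[OF t] that by (simp add: B.global_shock_def)
  show "(\<theta>, t, to_circle z) \<in> sided_global_shocks \<mu> Lft \<longleftrightarrow>
      B.global_shock \<theta> t z \<and> (\<exists>s. B.meeting_time \<theta> t z < s \<and> s < t \<and> O.source \<theta> s (B.rightmost \<theta> t z s))"
  proof (cases "B.global_shock \<theta> t z")
    case True
    have "(\<theta>, t, to_circle z) \<in> sided_global_shocks \<mu> Lft \<longleftrightarrow>
      (\<exists>s. B.meeting_time \<theta> t z < s \<and> s < t \<and> (s, extremal_path \<mu> Rgt \<theta> t (to_circle z) s) \<in> global_shocks_at \<mu> \<theta> \<inter> msupp \<mu>)"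
      using True by (simp add: sided_global_shocks_def global_shocks_iff[OF t] TV)
    then show ?thesis unfolding *(1)[OF True] using True by blast
  qed (simp add: sided_global_shocks_def global_shocks_iff[OF t])
  show "(\<theta>, t, to_circle z) \<in> sided_global_shocks \<mu> Rgt \<longleftrightarrow>
      B.global_shock \<theta> t z \<and> (\<exists>s. B.meeting_time \<theta> t z < s \<and> s < t \<and> O.source \<theta> s (B.leftmost \<theta> t z s))"
  proof (cases "B.global_shock \<theta> t z")
    case True
    have "(\<theta>, t, to_circle z) \<in> sided_global_shocks \<mu> Rgt \<longleftrightarrow>
      (\<exists>s. B.meeting_time \<theta> t z < s \<and> s < t \<and> (s, extremal_path \<mu> Lft \<theta> t (to_circle z) s) \<in> global_shocks_at \<mu> \<theta> \<inter> msupp \<mu>)"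
      using True by (simp add: sided_global_shocks_def global_shocks_iff[OF t] TV)
    then show ?thesis unfolding *(2)[OF True] using True by blast
  qed (simp add: sided_global_shocks_def global_shocks_iff[OF t])
qed

lemma global_shocks_points:
  assumes t: "bs 0 + R \<le> t"
  shows "(\<theta>, t, x) \<in> global_shocks \<mu> \<longleftrightarrow> x = to_circle (B.a t \<theta>) \<or> x = to_circle (B.b t \<theta>)"
proof -
  obtain z where z: "x = to_circle z" using to_circle_surj by blast
  show ?thesis unfolding z
    using global_shocks_iff[OF t, of \<theta> z] O.global_shock_iff[OF bs_lt[OF t], of \<theta> z] by (simp only: to_circle_eq_iff)
qed

lemma shock_loc_eq:
  assumes t: "bs 0 + R \<le> t"
  shows "shock_loc \<mu> Lft \<theta> t = to_circle (B.a t \<theta>)" and "shock_loc \<mu> Rgt \<theta> t = to_circle (B.b t \<theta>)"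
proof -
  let ?a = "to_circle (B.a t \<theta>)" and ?b = "to_circle (B.b t \<theta>)"
  have t': "bs 0 < t" by (rule bs_lt[OF t])
  note GS = global_shocks_points[OF t, of \<theta>]
  have "shock_loc \<mu> Lft \<theta> t = ?a \<and> shock_loc \<mu> Rgt \<theta> t = ?b"
  proof (cases "?a = ?b")
    case True
    have GS': "(\<theta>, t, x) \<in> global_shocks \<mu> \<longleftrightarrow> x = ?b" for x using GS[of x] True by simp
    show ?thesis unfolding shock_loc_def GS' using True by simp
  next
    case False
    have nint: "B.b t \<theta> - B.a t \<theta> \<notin> \<int>"
    proof
      assume "B.b t \<theta> - B.a t \<theta> \<in> \<int>"
      then have "?b = ?a" by (simp only: to_circle_eq_iff)
      then show False using False by simp
    qed
    have nex: "\<not> (\<exists>!x. (\<theta>, t, x) \<in> global_shocks \<mu>)" unfolding GS using False by blast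
    note src = O.source_sides[OF t' nint]
    have za: "to_circle z = ?a \<longleftrightarrow> z - B.a t \<theta> \<in> \<int>" and zb: "to_circle z = ?b \<longleftrightarrow> z - B.b t \<theta> \<in> \<int>" for z
      by (simp_all only: to_circle_eq_iff)
    have L: "(\<theta>, t, x) \<in> sided_global_shocks \<mu> Lft \<longleftrightarrow> x = ?a" for x
    proof -
      obtain z where z: "x = to_circle z" using to_circle_surj by blast
      show ?thesis unfolding z sided_iff(1)[OF t] za O.global_shock_iff[OF t'] using src(1,3)[of z] by blast
    qed
    have R': "(\<theta>, t, x) \<in> sided_global_shocks \<mu> Rgt \<longleftrightarrow> x = ?b" for x
    proof -
      obtain z where z: "x = to_circle z" using to_circle_surj by blast
      show ?thesis unfolding z sided_iff(2)[OF t] zb O.global_shock_iff[OF t'] using src(2,4)[of z] by blast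
    qed
    show ?thesis unfolding shock_loc_def using nex by (simp add: L R')
  qed
  then show "shock_loc \<mu> Lft \<theta> t = ?a" "shock_loc \<mu> Rgt \<theta> t = ?b" by auto
qed

lemma shock_loc_has_derivative:
  assumes t: "bs 0 + R \<le> t"
  shows "has_circle_derivative (\<lambda>\<theta>'. shock_loc \<mu> Lft \<theta>' t) (1 / (B.left_slope t (B.a t \<theta> + 1) - B.left_slope t (B.a t \<theta>))) \<theta> {..\<theta>}"
    and "has_circle_derivative (\<lambda>\<theta>'. shock_loc \<mu> Rgt \<theta>' t) (1 / (B.right_slope t (B.b t \<theta> + 1) - B.right_slope t (B.b t \<theta>))) \<theta> {\<theta>..}"
  unfolding has_circle_derivative_def shock_loc_eq[OF t]
  by (intro exI[of _ "B.a t"] exI[of _ "B.b t"] conjI refl B.a_left_deriv B.b_right_deriv bs_lt[OF t] always_eventually allI)+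

lemma shock_loc_deriv_eq:
  assumes t: "bs 0 + R \<le> t"
  shows "shock_loc_deriv \<mu> Lft \<theta> t = 1 / (B.left_slope t (B.a t \<theta> + 1) - B.left_slope t (B.a t \<theta>))"
    and "shock_loc_deriv \<mu> Rgt \<theta> t = 1 / (B.right_slope t (B.b t \<theta> + 1) - B.right_slope t (B.b t \<theta>))"
  unfolding shock_loc_deriv_def ray.simps
  by (rule circle_deriv_eq[OF shock_loc_has_derivative(1)[OF t]], simp add: at_within_atMost)
    (rule circle_deriv_eq[OF shock_loc_has_derivative(2)[OF t]], simp add: at_within_atLeast)

lemma velocity_jump:
  assumes t: "bs 0 + R \<le> t" and le: "\<theta>1 < \<theta>2"
  shows "(\<forall>\<theta>\<in>{\<theta> \<in> param_interval \<sigma> \<theta>1 \<theta>2. shock_loc \<mu> \<sigma> \<theta> t = x}. shock_loc_deriv \<mu> \<sigma> \<theta> t \<noteq> 0) \<and>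
    ((\<lambda>\<theta>. 1 / shock_loc_deriv \<mu> \<sigma> \<theta> t) has_sum (velocity \<mu> \<sigma> \<theta>2 t x - velocity \<mu> \<sigma> \<theta>1 t x))
      {\<theta> \<in> param_interval \<sigma> \<theta>1 \<theta>2. shock_loc \<mu> \<sigma> \<theta> t = x}"
proof -
  obtain z where z: "x = to_circle z" using to_circle_surj by blast
  have t': "bs 0 < t" by (rule bs_lt[OF t])
  show ?thesis
  proof (cases \<sigma>)
    case Lft
    have S: "{\<theta> \<in> param_interval \<sigma> \<theta>1 \<theta>2. shock_loc \<mu> \<sigma> \<theta> t = x} = {\<theta> \<in> {\<theta>1<..\<theta>2}. B.a t \<theta> - z \<in> \<int>}"
      unfolding Lft z shock_loc_eq[OF t] to_circle_eq_iff by simp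
    have "shock_loc_deriv \<mu> Lft \<theta> t \<noteq> 0" for \<theta>
      using B.a_slope_pos[OF t', of \<theta>] by (simp add: shock_loc_deriv_eq[OF t])
    then show ?thesis unfolding S unfolding Lft z
      using B.left_jump_sum[OF t' le, of z] by (simp add: shock_loc_deriv_eq[OF t] velocity_eq[OF t])
  next
    case Rgt
    have S: "{\<theta> \<in> param_interval \<sigma> \<theta>1 \<theta>2. shock_loc \<mu> \<sigma> \<theta> t = x} = {\<theta> \<in> {\<theta>1..<\<theta>2}. B.b t \<theta> - z \<in> \<int>}"
      unfolding Rgt z shock_loc_eq[OF t] to_circle_eq_iff by simp
    have "shock_loc_deriv \<mu> Rgt \<theta> t \<noteq> 0" for \<theta>
      using B.b_slope_pos[OF t', of \<theta>] by (simp add: shock_loc_deriv_eq[OF t])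
    then show ?thesis unfolding S unfolding Rgt z
      using B.right_jump_sum[OF t' le, of z] by (simp add: shock_loc_deriv_eq[OF t] velocity_eq[OF t])
  qed
qed

lemma double_shocks_persist:
  assumes t: "bs 0 + R \<le> t" and ne: "shock_loc \<mu> Lft \<theta> t \<noteq> shock_loc \<mu> Rgt \<theta> t"
  shows "\<exists>\<epsilon>>0. (\<forall>\<theta>'\<in>{\<theta>..<\<theta> + \<epsilon>}. (\<theta>', t, shock_loc \<mu> Lft \<theta> t) \<in> shocks \<mu>) \<and>
      (\<forall>\<theta>'\<in>{\<theta> - \<epsilon><..\<theta>}. (\<theta>', t, shock_loc \<mu> Rgt \<theta> t) \<in> shocks \<mu>)"
proof -
  have "B.b t \<theta> - B.a t \<theta> \<notin> \<int>"
  proof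
    assume "B.b t \<theta> - B.a t \<theta> \<in> \<int>"
    then have "to_circle (B.b t \<theta>) = to_circle (B.a t \<theta>)" by (simp only: to_circle_eq_iff)
    then show False using ne by (simp add: shock_loc_eq[OF t])
  qed
  from O.shocks_persist[OF bs_lt[OF t] this] show ?thesis
    unfolding shock_loc_eq[OF t] shocks_iff[OF t] .
qed

end

end

lemma bottleneck_chain:
  assumes "\<mu> \<in> Omega1"
  obtains R bs Ys where "bottlenecks \<mu> R bs Ys" "bs 0 + R \<le> t"
proof -
  obtain R s where R: "R > 0" and s: "\<And>t. s t \<le> t - R"
    "\<And>t. \<exists>y. msupp \<mu> \<inter> ({s t - R..s t + R} \<times> UNIV) = {(s t, y)} \<and> measure \<mu> {(s t, y)} > 1 / (4 * R)"
    using assms unfolding Omega1_def by blast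
  define bs where "bs k = (s ^^ Suc k) t" for k
  have "\<exists>Y. bottleneck \<mu> R (bs k) Y" for k
  proof -
    obtain y where y: "msupp \<mu> \<inter> ({bs k - R..bs k + R} \<times> UNIV) = {(bs k, y)}"
      "measure \<mu> {(bs k, y)} > 1 / (4 * R)" using s(2)[of "(s ^^ k) t"] by (auto simp: bs_def)
    obtain Y where "y = to_circle Y" using to_circle_surj by blast
    then show ?thesis using y unfolding bottleneck_def by blast
  qed
  then obtain Ys where Ys: "\<And>k. bottleneck \<mu> R (bs k) (Ys k)" by metis
  show ?thesis
  proof (rule that)
    show "bottlenecks \<mu> R bs Ys"
    proof
      show "\<mu> \<in> Omega" using assms by (simp add: Omega1_def)
      show "bs (Suc k) \<le> bs k - R" for k using s(1)[of "(s ^^ Suc k) t"] by (simp add: bs_def)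
    qed (use R Ys in auto)
    show "bs 0 + R \<le> t" using s(1)[of t] by (simp add: bs_def)
  qed
qed

theorem theorem1p9:
  fixes \<mu> :: "(real \<times> circle) measure" and t :: real
  assumes "\<mu> \<in> OmegaT"
  shows
    "(\<forall>\<theta>. \<exists>d. has_circle_derivative (\<lambda>\<theta>'. shock_loc \<mu> Lft \<theta>' t) d \<theta> {..\<theta>}) \<and>
     (\<forall>\<theta>. \<exists>d. has_circle_derivative (\<lambda>\<theta>'. shock_loc \<mu> Rgt \<theta>' t) d \<theta> {\<theta>..}) \<and>
     (\<forall>\<theta>1 \<theta>2 x \<sigma>. \<theta>1 < \<theta>2 \<longrightarrow>
        (\<forall>\<theta>\<in>{\<theta> \<in> param_interval \<sigma> \<theta>1 \<theta>2. shock_loc \<mu> \<sigma> \<theta> t = x}. shock_loc_deriv \<mu> \<sigma> \<theta> t \<noteq> 0) \<and>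
        ((\<lambda>\<theta>. 1 / shock_loc_deriv \<mu> \<sigma> \<theta> t) has_sum (velocity \<mu> \<sigma> \<theta>2 t x - velocity \<mu> \<sigma> \<theta>1 t x))
          {\<theta> \<in> param_interval \<sigma> \<theta>1 \<theta>2. shock_loc \<mu> \<sigma> \<theta> t = x}) \<and>
     (\<forall>\<theta>. shock_loc \<mu> Lft \<theta> t \<noteq> shock_loc \<mu> Rgt \<theta> t \<longrightarrow>
        (\<exists>\<epsilon>>0. (\<forall>\<theta>'\<in>{\<theta>..<\<theta> + \<epsilon>}. (\<theta>', t, shock_loc \<mu> Lft \<theta> t) \<in> shocks \<mu>) \<and>
                (\<forall>\<theta>'\<in>{\<theta> - \<epsilon><..\<theta>}. (\<theta>', t, shock_loc \<mu> Rgt \<theta> t) \<in> shocks \<mu>)))"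
proof -
  have "\<mu> \<in> Omega1" using assms by (simp add: OmegaT_def)
  then obtain R bs Ys where "bottlenecks \<mu> R bs Ys" and t: "bs 0 + R \<le> t"
    by (rule bottleneck_chain)
  then interpret bottlenecks \<mu> R bs Ys by simp
  show ?thesis
    using shock_loc_has_derivative[OF assms t] velocity_jump[OF assms t] double_shocks_persist[OF assms t]
    by blast
qed

end
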